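(* Let $k$ be an algebraically closed field of characteristic $p>2$, let $0<g_1\le g_2$ and $0\le r\le 2g_1+2$ be integers, and let $C_1,C_2$ be the nonsingular projective models over $k$ of $$y_1^2=(x-a_1)\cdots(x-a_r)(x-a_{r+1})\cdots(x-a_{2g_1+2}),$$ $$y_2^2=(x-a_1)\cdots(x-a_r)(x-b_{r+1})\cdots(x-b_{2g_2+2}),$$ where $a_i\ne a_j$ and $b_i\neq b_j$ for $i\ne j$, and $a_i\neq b_j$ for all $i,j$. Let $\psi_i:C_i\to\mathbf{P}^1$ ($i=1,2$) be the hyperelliptic structures (given by $x$), and assume that there is no isomorphism $\varphi:C_1\to C_2$ with $\psi_2\circ\varphi=\psi_1$. Let $C$ be the associated generalized Howe curve, i.e. the nonsingular projective model of the fiber product $C_1\times_{\mathbf{P}^1}C_2$ formed with respect to $\psi_1,\psi_2$, and let $C_3$ be the nonsingular projective model of $$y_3^2=(x-a_{r+1})\cdots(x-a_{2g_1+2})(x-b_{r+1})\cdots(x-b_{2g_2+2}).$$ Assume that the genus of $C$ satisfies $g(C)\ge 4$. Then $C$ is hyperelliptic if and only if $r=g_1+g_2+1$, i.e. the curve $C_3$ is rational.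
   Context: Here genus-one curves of the form $y^2=$ quartic are allowed for $C_1$, $C_2$ (so $g_1=1$ or $g_2=1$ is permitted), and $r$ is the number of common branch points of $\psi_1$ and $\psi_2$. The assumption that no isomorphism $\varphi$ with $\psi_2\circ\varphi=\psi_1$ exists guarantees that $C_1\times_{\mathbf{P}^1}C_2$ is irreducible. The curve $C_3$ is the quotient $C/\langle\sigma\circ\tau\rangle$, where $\sigma$ and $\tau$ are the automorphisms of $C$ given by $\sigma:(x,y_1,y_2)\mapsto(x,-y_1,y_2)$ and $\tau:(x,y_1,y_2)\mapsto(x,y_1,-y_2)$, with $y_3=y_1y_2/((x-a_1)\cdots(x-a_r))$; its genus is $g_1+g_2+1-r$. *)

theory Defs
  imports
    "HOL-Computational_Algebra.Polynomial"
    "HOL-Computational_Algebra.Fraction_Field"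
begin

text \<open>
  Nonsingular projective curves over an algebraically closed field k are treated as abstract
  nonsingular curves in the sense of Hartshorne, Section I.6.  Such a curve is given by its function
  field K, a type of class field, together with the embedding c of the constants k into K.  Its
  closed points are the discrete valuation rings of K/k, each being the local ring of the point
  it stands for.  The nonsingular projective model of an integral curve X is the curve
  whose function field is that of X.
\<close>

definition field_embedding :: "('a::field \<Rightarrow> 'b::field) \<Rightarrow> bool" where
  "field_embedding h \<longleftrightarrow>
     h 1 = 1 \<and> (\<forall>u v. h (u + v) = h u + h v) \<and> (\<forall>u v. h (u * v) = h u * h v)"

definition generated_field :: "'a::field set \<Rightarrow> 'a set" where
  "generated_field A = \<Inter> {S. A \<subseteq> S \<and> 1 \<in> S \<and>
     (\<forall>u\<in>S. \<forall>v\<in>S. u - v \<in> S \<and> u * v \<in> S) \<and> (\<forall>u\<in>S. inverse u \<in> S)}"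


subsection \<open>Points, divisors and the genus\<close>

definition is_unit_of :: "'a::field set \<Rightarrow> 'a \<Rightarrow> bool" where
  "is_unit_of R u \<longleftrightarrow> u \<noteq> 0 \<and> u \<in> R \<and> inverse u \<in> R"

definition is_uniformizer :: "'a::field set \<Rightarrow> 'a \<Rightarrow> bool" where
  "is_uniformizer R t \<longleftrightarrow> t \<noteq> 0 \<and> t \<in> R \<and> inverse t \<notin> R \<and>
     (\<forall>f. f \<noteq> 0 \<longrightarrow> (\<exists>(n::int) u. is_unit_of R u \<and> f = u * t powi n))"

text \<open>
  The existence of a uniformizer forces R to be a proper subring with fraction field the whole type.
\<close>

definition is_dvr :: "'a::field set \<Rightarrow> bool" where
  "is_dvr R \<longleftrightarrow> 1 \<in> R \<and> (\<forall>u\<in>R. \<forall>v\<in>R. u - v \<in> R \<and> u * v \<in> R) \<and> (\<exists>t. is_uniformizer R t)"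

definition points :: "('k::field \<Rightarrow> 'a::field) \<Rightarrow> 'a set set" where
  "points c = {R. range c \<subseteq> R \<and> is_dvr R}"

definition ord_at :: "'a::field set \<Rightarrow> 'a \<Rightarrow> int" where
  "ord_at R f = (THE n. \<exists>t u. is_uniformizer R t \<and> is_unit_of R u \<and> f = u * t powi n)"

definition divisors :: "('k::field \<Rightarrow> 'a::field) \<Rightarrow> ('a set \<Rightarrow> int) set" where
  "divisors c = {D. finite {P. D P \<noteq> 0} \<and> {P. D P \<noteq> 0} \<subseteq> points c}"

text \<open>
  The ground field is algebraically closed, so every point has residue field k, hence degree 1.
\<close>

definition divisor_degree :: "('a set \<Rightarrow> int) \<Rightarrow> int" where
  "divisor_degree D = (\<Sum>P | D P \<noteq> 0. D P)"

definition riemann_roch_space :: "('k::field \<Rightarrow> 'a::field) \<Rightarrow> ('a set \<Rightarrow> int) \<Rightarrow> 'a set" where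
  "riemann_roch_space c D = {f. f = 0 \<or> (\<forall>P\<in>points c. ord_at P f \<ge> - D P)}"

definition l_dim :: "('k::field \<Rightarrow> 'a::field) \<Rightarrow> ('a set \<Rightarrow> int) \<Rightarrow> nat" where
  "l_dim c D = vector_space.dim (\<lambda>a f. c a * f) (riemann_roch_space c D)"

text \<open>
  By Riemann's theorem, for a function field of one variable over k the supremum is a maximum.
\<close>

definition genus :: "('k::field \<Rightarrow> 'a::field) \<Rightarrow> int" where
  "genus c = (SUP D\<in>divisors c. divisor_degree D - int (l_dim c D) + 1)"


subsection \<open>Morphisms\<close>

text \<open>
  A dominant morphism from the curve cX to the curve cY is a map of points together with an
  embedding h of the function field of cY into that of cX over k, inducing local
  homomorphisms from the local ring of the image point to that of the point.  Since these local
  rings are valuation rings, this says that a point P is sent to the preimage of P under h.  The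
  morphism is therefore recorded by h alone, and composition of morphisms is composition of
  embeddings in the reverse order.  Continuity for the Zariski (cofinite) topology is automatic.
\<close>

definition dominant_morphism ::
  "('k::field \<Rightarrow> 'a::field) \<Rightarrow> ('k \<Rightarrow> 'b::field) \<Rightarrow> ('b \<Rightarrow> 'a) \<Rightarrow> bool" where
  "dominant_morphism cX cY h \<longleftrightarrow>
     field_embedding h \<and> h \<circ> cY = cX \<and> (\<forall>P\<in>points cX. h -` P \<in> points cY)"

definition morphism_degree :: "('b::field \<Rightarrow> 'a::field) \<Rightarrow> nat" where
  "morphism_degree h = vector_space.dim (\<lambda>b f. h b * f) (UNIV :: 'a set)"

definition curve_isomorphism ::
  "('k::field \<Rightarrow> 'a::field) \<Rightarrow> ('k \<Rightarrow> 'b::field) \<Rightarrow> ('b \<Rightarrow> 'a) \<Rightarrow> bool" where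
  "curve_isomorphism cX cY h \<longleftrightarrow>
     bij h \<and> dominant_morphism cX cY h \<and> dominant_morphism cY cX (inv h)"

text \<open>The projective line is the curve with function field k(t).\<close>

definition line_const :: "'k::field \<Rightarrow> 'k poly fract" where
  "line_const a = Fract [:a:] 1"

definition line_coord :: "'k::field poly fract" where
  "line_coord = Fract [:0, 1:] 1"

definition hyperelliptic :: "('k::field \<Rightarrow> 'a::field) \<Rightarrow> bool" where
  "hyperelliptic c \<longleftrightarrow> genus c \<ge> 2 \<and>
     (\<exists>h :: 'k poly fract \<Rightarrow> 'a. dominant_morphism c line_const h \<and> morphism_degree h = 2)"

text \<open>Rational means birational to the projective line.\<close>

definition rational_curve :: "('k::field \<Rightarrow> 'a::field) \<Rightarrow> bool" where
  "rational_curve c \<longleftrightarrow>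
     (\<exists>h :: 'k poly fract \<Rightarrow> 'a. field_embedding h \<and> bij h \<and> h \<circ> line_const = c)"


subsection \<open>Nonsingular projective models\<close>

definition eval_xy :: "('k::field \<Rightarrow> 'a::field) \<Rightarrow> 'k poly poly \<Rightarrow> 'a \<Rightarrow> 'a \<Rightarrow> 'a" where
  "eval_xy c Q x y = poly (map_poly (\<lambda>q. poly (map_poly c q) x) Q) y"

text \<open>
  The plane affine curve F = 0, with F in k[x][y], has coordinate ring k[x,y]/(F).  The following
  says that the function field of the curve c is the fraction field of this ring,
  with x and y the images of the two coordinates.
\<close>

definition plane_curve_model ::
  "('k::field \<Rightarrow> 'a::field) \<Rightarrow> 'k poly poly \<Rightarrow> 'a \<Rightarrow> 'a \<Rightarrow> bool" where
  "plane_curve_model c F x y \<longleftrightarrow>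
     field_embedding c \<and> (\<forall>Q. eval_xy c Q x y = 0 \<longleftrightarrow> F dvd Q) \<and>
     generated_field (range c \<union> {x, y}) = UNIV"

definition square_eq :: "'k::field poly \<Rightarrow> 'k poly poly" where
  "square_eq f = [:- f, 0, 1:]"

text \<open>
  The curve c, with projections p1 and p2, is the nonsingular projective model of the fibre product
  of the curves c1 and c2 over the projective line with respect to the morphisms q1 and q2: the
  square commutes, and c is birational onto its image in the fibre product, i.e. its function
  field is the compositum of the two function fields.  When the fibre product is irreducible, as in
  the use made of this notion here, the image is all of it.
\<close>

definition fibre_product_model ::
  "('k::field \<Rightarrow> 'a::field) \<Rightarrow> ('k \<Rightarrow> 'b::field) \<Rightarrow> ('k \<Rightarrow> 'd::field) \<Rightarrow>
   ('k poly fract \<Rightarrow> 'b) \<Rightarrow> ('k poly fract \<Rightarrow> 'd) \<Rightarrow> ('b \<Rightarrow> 'a) \<Rightarrow> ('d \<Rightarrow> 'a) \<Rightarrow> bool" where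
  "fibre_product_model c c1 c2 q1 q2 p1 p2 \<longleftrightarrow>
     field_embedding c \<and> dominant_morphism c c1 p1 \<and> dominant_morphism c c2 p2 \<and>
     p1 \<circ> q1 = p2 \<circ> q2 \<and> generated_field (range p1 \<union> range p2) = UNIV"


subsection \<open>The notions above are well defined\<close>

lemma vector_space_field_embedding:
  assumes "field_embedding h"
  shows "vector_space (\<lambda>a f. h a * f)"
  using assms by unfold_locales (auto simp: field_embedding_def algebra_simps)

lemma is_unit_of_mult:
  "is_dvr R \<Longrightarrow> is_unit_of R u \<Longrightarrow> is_unit_of R v \<Longrightarrow> is_unit_of R (u * v)"
  by (auto simp: is_unit_of_def is_dvr_def)

lemma is_unit_of_inverse: "is_unit_of R u \<Longrightarrow> is_unit_of R (inverse u)"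
  by (auto simp: is_unit_of_def)

lemma uniformizer_power_mem:
  assumes "is_dvr R" "is_uniformizer R t"
  shows "t ^ n \<in> R"
  using assms by (induction n) (auto simp: is_dvr_def is_uniformizer_def)

lemma uniformizer_pos_power:
  assumes "is_dvr R" "is_uniformizer R t" "n > 0"
  shows "\<not> is_unit_of R (t powi n)"
proof
  assume u: "is_unit_of R (t powi n)"
  obtain m where m: "n = int (Suc m)"
    using assms(3) by (metis zero_less_imp_eq_int gr0_implies_Suc)
  have t0: "t \<noteq> 0" using assms(2) by (simp add: is_uniformizer_def)
  have "inverse t = inverse (t ^ Suc m) * t ^ m"
    using t0 by (simp add: field_simps)
  moreover have "inverse (t ^ Suc m) \<in> R"
    using u unfolding m is_unit_of_def power_int_of_nat by blast
  ultimately have "inverse t \<in> R"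
    using uniformizer_power_mem[OF assms(1,2), of m] assms(1) unfolding is_dvr_def by metis
  then show False using assms(2) by (simp add: is_uniformizer_def)
qed

lemma uniformizer_power_unit:
  assumes "is_dvr R" "is_uniformizer R t" "is_unit_of R (t powi n)"
  shows "n = 0"
proof (rule ccontr)
  assume "n \<noteq> 0"
  then consider "n > 0" | "- n > 0" by linarith
  then show False
  proof cases
    case 1
    then show ?thesis using uniformizer_pos_power assms by blast
  next
    case 2
    have "is_unit_of R (t powi (- n))"
      using is_unit_of_inverse[OF assms(3)] by (simp add: power_int_minus)
    then show ?thesis using uniformizer_pos_power[OF assms(1,2) 2] by blast
  qed
qed

lemma is_unit_of_powi:
  assumes "is_dvr R" "is_unit_of R v"
  shows "is_unit_of R (v powi n)"
proof -
  have *: "is_unit_of R (v ^ k)" for k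
    using assms(2) by (induction k) (auto intro: is_unit_of_mult[OF assms(1)]
        simp: is_unit_of_def assms(1)[unfolded is_dvr_def])
  show ?thesis
    using *[of "nat n"] is_unit_of_inverse[OF *[of "nat (- n)"]]
    by (cases "n \<ge> 0") (auto simp: power_int_def power_inverse)
qed

lemma uniformizer_associated:
  assumes "is_dvr R" "is_uniformizer R s" "is_uniformizer R t"
  shows "\<exists>v. is_unit_of R v \<and> s = v * t"
proof -
  have s0: "s \<noteq> 0" and t0: "t \<noteq> 0" using assms by (auto simp: is_uniformizer_def)
  obtain m v where v: "is_unit_of R v" "s = v * t powi m"
    using assms(3) s0 unfolding is_uniformizer_def by blast
  obtain n w where w: "is_unit_of R w" "t = w * s powi n"
    using assms(2) t0 unfolding is_uniformizer_def by blast
  have v0: "v \<noteq> 0" using v(1) by (simp add: is_unit_of_def)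
  have unit_powi: "is_unit_of R (v powi n)"
    by (rule is_unit_of_powi[OF assms(1) v(1)])
  have "t = (w * v powi n) * t powi (m * n)"
    by (subst w(2), subst v(2)) (simp add: power_int_mult_distrib power_int_mult)
  then have "t powi (1 - m * n) = w * v powi n"
    using t0 by (simp add: power_int_diff field_simps)
  then have "1 - m * n = 0"
    using uniformizer_power_unit[OF assms(1,3)] is_unit_of_mult[OF assms(1) w(1) unit_powi] by metis
  then have "m = 1 \<or> m = - 1" by (metis eq_iff_diff_eq_0 zmult_eq_1_iff)
  moreover have "m \<noteq> - 1"
  proof
    assume "m = - 1"
    then have "inverse t = inverse v * s" using v(2) v0 by (simp add: power_int_minus)
    moreover have "inverse v * s \<in> R"
      using v(1) assms(1,2) unfolding is_unit_of_def is_dvr_def is_uniformizer_def by blast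
    ultimately show False using assms(3) by (simp add: is_uniformizer_def)
  qed
  ultimately show ?thesis using v by auto
qed

lemma ord_at_eqI:
  assumes "is_dvr R" "is_uniformizer R t" "is_unit_of R u"
  shows "ord_at R (u * t powi n) = n"
  unfolding ord_at_def
proof (rule the_equality)
  show "\<exists>s v. is_uniformizer R s \<and> is_unit_of R v \<and> u * t powi n = v * s powi n"
    using assms by blast
next
  fix m
  assume "\<exists>s v. is_uniformizer R s \<and> is_unit_of R v \<and> u * t powi n = v * s powi m"
  then obtain s v where s: "is_uniformizer R s" "is_unit_of R v" "u * t powi n = v * s powi m"
    by blast
  obtain w where w: "is_unit_of R w" "s = w * t"
    using uniformizer_associated[OF assms(1) s(1) assms(2)] by blast
  have t0: "t \<noteq> 0" and u0: "u \<noteq> 0"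
    using assms by (auto simp: is_uniformizer_def is_unit_of_def)
  have "u * t powi n = (v * w powi m) * t powi m"
    using s(3) w(2) by (simp add: power_int_mult_distrib mult.assoc)
  then have "t powi (n - m) = inverse u * (v * w powi m)"
    using t0 u0 by (simp add: power_int_diff field_simps)
  moreover have "is_unit_of R (inverse u * (v * w powi m))"
    by (intro is_unit_of_mult is_unit_of_inverse is_unit_of_powi assms s w)
  ultimately have "n - m = 0" using uniformizer_power_unit[OF assms(1,2)] by metis
  then show "m = n" by simp
qed

end

theory Submission
  imports Defs
begin

text \<open>
  Let K be the function field of C.  If u has degree 2 on C and x does not lie in k(u), then
  K = k(u, x) with x of degree at most 4, and the Castelnuovo inequality, obtained here by counting
  the functions u^i and u^i x, bounds the genus by (2 - 1)(4 - 1) = 3.  So genus at least 4 forces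
  x into k(u), and k(u) is then one of the three quadratic subextensions
  k(x, y1), k(x, y2), k(x, y3) of K over k(x).  A curve y^2 = f(x) with f squarefree of even
  degree at least 4 is not rational: four members of a pencil of coprime polynomials would be
  squares, which an infinite descent excludes.  Hence k(u) = k(x, y3), and the polynomial defining
  C3 has degree 2.  Conversely a conic is rational, and K is quadratic over k(x, y3).
\<close>

section \<open>Squares in a pencil of polynomials\<close>

text \<open>The genus is a supremum over all divisors, and points are abstract discrete valuation
  rings of K. An upper bound for it therefore rests on three facts: there are enough points for a
  function without poles to be constant, every point has residue field k, and the zeros of w have
  total order at most the degree of K over k(w). The first is the costly one, since points must be
  produced by Zorn's lemma as valuation rings and then shown to be discrete. The genus of C is never
  computed: g(C) >= 4 contradicts the bound 3, and supplies the genus >= 2 that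
  \<open>hyperelliptic\<close> asks for. Positivity of g_1 and g_2 means 2 g_i + 2 >= 4 branch
  points, which is what a descent on four squares requires. Four is sharp: (1+t^2)^2, (1-t^2)^2 and
  their difference 4 t^2 are three squares in one pencil. Characteristic different from 2 makes the
  factors P - m Q and P + m Q of a difference of squares coprime, and allows a squared relation
  between y1 and y2 to be solved for y1.\<close>

lemma poly_square_if_even_orders:
  fixes q :: "'k::alg_closed_field poly"
  assumes "q \<noteq> 0" "\<And>z. even (order z q)"
  shows "\<exists>s. q = s\<^sup>2"
  using assms
proof (induction "degree q" arbitrary: q rule: less_induct)
  case less
  show ?case
  proof (cases "degree q = 0")
    case True
    then obtain a where "q = [:a:]" by (metis degree_eq_zeroE)
    moreover obtain d where "d\<^sup>2 = a" using nth_root_exists[of 2 a] by auto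
    ultimately have "q = [:d:]\<^sup>2" by (simp add: power2_eq_square)
    then show ?thesis by blast
  next
    case False
    then obtain z where z: "poly q z = 0" using alg_closed_imp_poly_has_root by blast
    then have "order z q \<noteq> 0" using less.prems(1) order_root by blast
    with less.prems(2)[of z] have "2 \<le> order z q" by (auto elim!: evenE)
    then have "[:- z, 1:] ^ 2 dvd q" by (simp add: order_divides)
    then obtain q' where q': "q = [:- z, 1:] ^ 2 * q'" by (elim dvdE)
    have q'0: "q' \<noteq> 0" using less.prems(1) q' by auto
    have nz: "([:- z, 1:] :: 'k poly) ^ 2 \<noteq> 0" by simp
    have "degree q = 2 + degree q'"
      unfolding q' by (subst degree_mult_eq[OF nz q'0]) (simp add: degree_power_eq)
    moreover have "even (order y q')" for y
    proof -
      have "order y q = order y ([:- z, 1:] ^ 2) + order y q'"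
        unfolding q' by (rule order_mult) (use less.prems(1) q' in blast)
      moreover have "order y ([:- z, 1:] ^ 2) = 2 * order y [:- z, 1:]"
        unfolding power2_eq_square by (subst order_mult) simp_all
      ultimately show ?thesis using less.prems(2)[of y] by simp
    qed
    ultimately obtain s where "q' = s\<^sup>2" using less.hyps[of q'] q'0 by auto
    then have "q = ([:- z, 1:] * s)\<^sup>2" unfolding q' by (simp only: power_mult_distrib)
    then show ?thesis by blast
  qed
qed

text \<open>The factors share no zero, so at each zero of U the even order of the product belongs to
  U alone.\<close>

lemma poly_square_if_prod_square:
  fixes U V W :: "'k::alg_closed_field poly"
  assumes "U * V = W\<^sup>2" "U * V \<noteq> 0" "\<And>z. \<not> (poly U z = 0 \<and> poly V z = 0)"
  shows "\<exists>s. U = s\<^sup>2"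
proof (rule poly_square_if_even_orders)
  show "U \<noteq> 0" using assms(2) by auto
  fix z
  have "order z (U * V) = order z (W * W)"
    using assms(1) by (simp add: power2_eq_square)
  moreover have "W \<noteq> 0" using assms(1,2) by auto
  ultimately have e: "order z U + order z V = 2 * order z W"
    using assms(2) by (simp add: order_mult)
  show "even (order z U)"
  proof (cases "poly U z = 0")
    case True
    with assms(3) have "order z V = 0" by (intro order_0I) blast
    with e show ?thesis by simp
  qed (simp add: order_0I)
qed

text \<open>The difference of squares factors as \<open>(P - m Q) (P + m Q)\<close>. A common zero
  of the factors would be a zero of \<open>2 P\<close> and of \<open>2 m Q\<close>, hence of both P
  and Q.\<close>

lemma coprime_squares_split:
  fixes P Q :: "'k::alg_closed_field poly" and m :: 'k
  assumes two: "(2::'k) \<noteq> 0" and m: "m \<noteq> 0"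
    and cop: "\<And>z. \<not> (poly P z = 0 \<and> poly Q z = 0)"
    and nz: "P\<^sup>2 - smult (m\<^sup>2) (Q\<^sup>2) \<noteq> 0"
    and sq: "P\<^sup>2 - smult (m\<^sup>2) (Q\<^sup>2) = S\<^sup>2"
  shows "\<exists>s. P - smult m Q = s\<^sup>2"
proof (rule poly_square_if_prod_square[where V = "P + smult m Q"])
  have fac: "(P - smult m Q) * (P + smult m Q) = P\<^sup>2 - smult (m\<^sup>2) (Q\<^sup>2)"
    by (simp add: algebra_simps power2_eq_square)
  show "(P - smult m Q) * (P + smult m Q) = S\<^sup>2" using fac sq by simp
  show "(P - smult m Q) * (P + smult m Q) \<noteq> 0" using fac nz by simp
  fix z
  show "\<not> (poly (P - smult m Q) z = 0 \<and> poly (P + smult m Q) z = 0)"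
  proof
    assume *: "poly (P - smult m Q) z = 0 \<and> poly (P + smult m Q) z = 0"
    then have "2 * poly P z = 0" "2 * (m * poly Q z) = 0" by (auto simp: algebra_simps)
    with two m have "poly P z = 0 \<and> poly Q z = 0" by auto
    with cop show False by blast
  qed
qed

lemma poly_no_root_const:
  fixes q :: "'k::alg_closed_field poly"
  assumes "\<And>z. poly q z \<noteq> 0"
  shows "degree q = 0"
  using assms alg_closed_imp_poly_has_root[of q] by auto

text \<open>Two members of a pencil span it, so up to a scalar a third member is
  \<open>P^2 - m^2 Q^2\<close>, where \<open>m^2\<close> is determined by the position of e relative
  to e1 and e2. A square of this shape splits into coprime squares.\<close>

lemma four_squares_in_pencil_aux:
  fixes A B P Q S :: "'k::alg_closed_field poly" and e1 e2 e m :: 'k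
  assumes two: "(2::'k) \<noteq> 0"
    and cop: "\<And>z. \<not> (poly P z = 0 \<and> poly Q z = 0)"
    and P: "A - smult e1 B = P\<^sup>2" and Q: "A - smult e2 B = Q\<^sup>2"
    and S: "A - smult e B = S\<^sup>2" and nz: "A - smult e B \<noteq> 0"
    and ne: "e \<noteq> e1" "e \<noteq> e2" "e1 \<noteq> e2"
    and m: "m\<^sup>2 = (e - e1) / (e - e2)"
  shows "\<exists>s. P - smult m Q = s\<^sup>2"
proof -
  \<comment> \<open>\<open>l\<close> and \<open>l * m\<^sup>2\<close> are the solution of the linear
    system expressing the member at e through the members at e1 and e2, as the two equations
    \<open>c1\<close> and \<open>c2\<close> confirm.\<close>
  define l where "l = (e - e2) / (e1 - e2)"
  have l0: "l \<noteq> 0" using ne by (simp add: l_def)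
  obtain d where d: "d\<^sup>2 = l" using nth_root_exists[of 2 l] by auto
  have d0: "d \<noteq> 0" using d l0 by auto
  have m0: "m \<noteq> 0" using m ne by auto
  have lm: "l * m\<^sup>2 = (e - e1) / (e1 - e2)" using ne by (simp add: l_def m)
  have c1: "l - l * m\<^sup>2 = 1" using ne unfolding lm by (simp add: l_def flip: diff_divide_distrib)
  have c2: "l * e1 - l * m\<^sup>2 * e2 = e"
  proof -
    have "l * e1 - l * m\<^sup>2 * e2 = ((e - e2) * e1 - (e - e1) * e2) / (e1 - e2)"
      unfolding lm by (simp add: l_def diff_divide_distrib left_diff_distrib)
    also have "(e - e2) * e1 - (e - e1) * e2 = e * (e1 - e2)" by (simp add: algebra_simps)
    finally show ?thesis using ne by simp
  qed
  have "smult l (P\<^sup>2 - smult (m\<^sup>2) (Q\<^sup>2)) = smult (l - l * m\<^sup>2) A - smult (l * e1 - l * m\<^sup>2 * e2) B"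
    unfolding P[symmetric] Q[symmetric]
    by (simp add: smult_diff_right smult_diff_left smult_add_right algebra_simps)
  also have "\<dots> = A - smult e B" unfolding c1 c2 by simp
  finally have e: "smult l (P\<^sup>2 - smult (m\<^sup>2) (Q\<^sup>2)) = A - smult e B" .
  show ?thesis
  proof (rule coprime_squares_split[OF two m0 cop, where S = "smult (inverse d) S"])
    show "P\<^sup>2 - smult (m\<^sup>2) (Q\<^sup>2) \<noteq> 0" using e nz by auto
    have "P\<^sup>2 - smult (m\<^sup>2) (Q\<^sup>2) = smult (inverse l) (A - smult e B)"
      using l0 by (simp flip: e)
    also have "\<dots> = smult (inverse (d\<^sup>2)) (S\<^sup>2)" using d S by simp
    also have "\<dots> = (smult (inverse d) S)\<^sup>2" by (simp add: power2_eq_square)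
    finally show "P\<^sup>2 - smult (m\<^sup>2) (Q\<^sup>2) = (smult (inverse d) S)\<^sup>2" .
  qed
qed

text \<open>Infinite descent: the square roots P and Q of two members span a pencil that again has
  four square members, at the parameters m, -m, n, -n obtained from the other two members, while the
  degrees are at least halved.\<close>

lemma four_squares_in_pencil:
  fixes A B :: "'k::alg_closed_field poly" and e :: "nat \<Rightarrow> 'k"
  assumes two: "(2::'k) \<noteq> 0"
    and cop: "\<And>z. \<not> (poly A z = 0 \<and> poly B z = 0)"
    and inj: "inj_on e {..<4}"
    and sq: "\<And>i. i < 4 \<Longrightarrow> \<exists>s. A - smult (e i) B = s\<^sup>2"
  shows "degree A = 0 \<and> degree B = 0"
  using cop inj sq
proof (induction "max (degree A) (degree B)" arbitrary: A B e rule: less_induct)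
  case less
  note cop = less.prems(1) and inj = less.prems(2) and sq = less.prems(3)
  show ?case
  proof (cases "\<exists>i<4. A - smult (e i) B = 0")
    case True
    then obtain i where A: "A = smult (e i) B" by auto
    have "poly B z \<noteq> 0" for z using cop[of z] A by auto
    then have "degree B = 0" by (rule poly_no_root_const)
    then show ?thesis using A by simp
  next
    case False
    then have nz: "A - smult (e i) B \<noteq> 0" if "i < 4" for i using that by blast
    have ne: "e 0 \<noteq> e 1" "e 0 \<noteq> e 2" "e 0 \<noteq> e 3" "e 1 \<noteq> e 2" "e 1 \<noteq> e 3" "e 2 \<noteq> e 3"
      using inj_on_eq_iff[OF inj] by simp_all
    obtain P where P: "A - smult (e 0) B = P\<^sup>2" using sq[of 0] by auto
    obtain Q where Q: "A - smult (e 1) B = Q\<^sup>2" using sq[of 1] by auto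
    obtain S where S: "A - smult (e 2) B = S\<^sup>2" using sq[of 2] by auto
    obtain T where T: "A - smult (e 3) B = T\<^sup>2" using sq[of 3] by auto
    have copPQ: "\<not> (poly P z = 0 \<and> poly Q z = 0)" for z
    proof
      assume "poly P z = 0 \<and> poly Q z = 0"
      then have *: "poly (A - smult (e 0) B) z = 0" "poly (A - smult (e 1) B) z = 0"
        unfolding P Q by simp_all
      then have "(e 0 - e 1) * poly B z = 0" by (simp add: algebra_simps)
      then have "poly B z = 0" using ne by simp
      with * cop[of z] show False by simp
    qed
    obtain m where m: "m\<^sup>2 = (e 2 - e 0) / (e 2 - e 1)" using nth_root_exists[of 2] by auto
    obtain n where n: "n\<^sup>2 = (e 3 - e 0) / (e 3 - e 1)" using nth_root_exists[of 2] by auto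
    \<comment> \<open>\<open>m\<^sup>2\<close> and \<open>n\<^sup>2\<close> are the values at
      \<open>e 2\<close> and \<open>e 3\<close> of one injective fractional linear map, the one with
      zero \<open>e 0\<close> and pole \<open>e 1\<close>.\<close>
    have mn: "m\<^sup>2 \<noteq> n\<^sup>2"
    proof
      assume "m\<^sup>2 = n\<^sup>2"
      then have "(e 2 - e 0) * (e 3 - e 1) = (e 3 - e 0) * (e 2 - e 1)"
        using ne unfolding m n by (simp add: frac_eq_eq)
      then have "(e 2 - e 3) * (e 0 - e 1) = 0" by (simp add: algebra_simps)
      then show False using ne by simp
    qed
    have m0: "m \<noteq> 0" "n \<noteq> 0" using m n ne by auto
    have neg: "- x \<noteq> x" if "x \<noteq> 0" for x :: 'k
    proof
      assume "- x = x"
      then have "2 * x = 0" by (metis add.right_inverse mult_2)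
      then show False using two that by simp
    qed
    define f where "f = (\<lambda>i::nat. if i = 0 then m else if i = 1 then - m else if i = 2 then n else - n)"
    have f_inj: "inj_on f {..<4}"
    proof -
      have "{..<4} = {0, 1, 2, 3::nat}" by auto
      moreover have "m \<noteq> n" "m \<noteq> - n" "- m \<noteq> n" "m \<noteq> - m" "n \<noteq> - n"
        using mn neg[OF m0(1)] neg[OF m0(2)] by auto
      ultimately show ?thesis by (auto simp: inj_on_def f_def)
    qed
    have f_sq: "\<exists>s. P - smult (f i) Q = s\<^sup>2" if "i < 4" for i
    proof -
      have 1: "\<exists>s. P - smult x Q = s\<^sup>2" if "x\<^sup>2 = m\<^sup>2" for x
        by (rule four_squares_in_pencil_aux[OF two copPQ P Q S])
          (use nz[of 2] ne m that in auto)
      have 2: "\<exists>s. P - smult x Q = s\<^sup>2" if "x\<^sup>2 = n\<^sup>2" for x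
        by (rule four_squares_in_pencil_aux[OF two copPQ P Q T])
          (use nz[of 3] ne n that in auto)
      show ?thesis using 1[of "f i"] 2[of "f i"] by (auto simp: f_def)
    qed
    have dP: "2 * degree P \<le> max (degree A) (degree B)"
    proof -
      have "2 * degree P = degree (A - smult (e 0) B)"
        unfolding P by (cases "P = 0") (simp_all add: degree_power_eq)
      also have "\<dots> \<le> max (degree A) (degree B)"
        by (rule degree_diff_le) (auto intro: order.trans[OF degree_smult_le])
      finally show ?thesis .
    qed
    have dQ: "2 * degree Q \<le> max (degree A) (degree B)"
    proof -
      have "2 * degree Q = degree (A - smult (e 1) B)"
        unfolding Q by (cases "Q = 0") (simp_all add: degree_power_eq)
      also have "\<dots> \<le> max (degree A) (degree B)"
        by (rule degree_diff_le) (auto intro: order.trans[OF degree_smult_le])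
      finally show ?thesis .
    qed
    have *: "degree P = 0 \<and> degree Q = 0"
    proof (cases "max (degree A) (degree B) = 0")
      case False
      with dP dQ have "max (degree P) (degree Q) < max (degree A) (degree B)" by linarith
      from less.hyps[OF this copPQ f_inj f_sq] show ?thesis .
    qed (use dP dQ in simp)
    have B: "smult (e 1 - e 0) B = P\<^sup>2 - Q\<^sup>2" unfolding P[symmetric] Q[symmetric]
      by (simp add: smult_diff_left)
    have dPQ: "degree (P\<^sup>2) = 0" "degree (Q\<^sup>2) = 0"
      using * degree_power_le[of P 2] degree_power_le[of Q 2] by auto
    have "degree (P\<^sup>2 - Q\<^sup>2) = 0" using degree_diff_le_max[of "P\<^sup>2" "Q\<^sup>2"] dPQ by simp
    then have dB: "degree B = 0" using ne by (simp flip: B)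
    have "A = P\<^sup>2 + smult (e 0) B" by (simp flip: P)
    then have "degree A \<le> 0" using dB dPQ degree_add_le[of "P\<^sup>2" 0 "smult (e 0) B"] by simp
    then have "degree A = 0" by simp
    then show ?thesis using dB by blast
  qed
qed

section \<open>Equations y^2 = f(x) over the rational function field\<close>

lemma fract_coprime_rep:
  fixes s :: "'k::alg_closed_field poly fract"
  obtains A B where "s = Fract A B" "B \<noteq> 0" "\<And>z. \<not> (poly A z = 0 \<and> poly B z = 0)"
proof -
  define M where "M = (\<lambda>n. \<exists>A B. s = Fract A B \<and> B \<noteq> 0 \<and> degree B = n)"
  have "\<exists>n. M n" unfolding M_def by (metis Fract_cases)
  then have "M (LEAST n. M n)" by (rule LeastI_ex)
  then obtain A B where AB: "s = Fract A B" "B \<noteq> 0" "degree B = (LEAST n. M n)"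
    unfolding M_def by blast
  have "\<not> (poly A z = 0 \<and> poly B z = 0)" for z
  proof
    assume "poly A z = 0 \<and> poly B z = 0"
    then obtain A' B' where A': "A = [:- z, 1:] * A'" and B': "B = [:- z, 1:] * B'"
      by (meson dvdE poly_eq_0_iff_dvd)
    have B'0: "B' \<noteq> 0" using AB B' by auto
    have "A * B' = A' * B" unfolding A' B' by (simp only: ac_simps)
    then have "s = Fract A' B'" using AB B'0 by (simp add: eq_fract)
    then have "M (degree B')" unfolding M_def using B'0 by blast
    moreover have "degree B' < degree B" unfolding B'
      by (subst degree_mult_eq) (use B'0 in auto)
    ultimately show False using AB(3) not_less_Least by metis
  qed
  with AB show thesis using that by blast
qed

text \<open>For s = A/B in lowest terms the factors \<open>A - e B\<close> have pairwise no common
  zero, and their product is a square up to square factors; so each of them is a square and the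
  pencil lemma applies.\<close>

lemma square_eq_prod_imp_const:
  fixes s w :: "'k::alg_closed_field poly fract"
  assumes two: "(2::'k) \<noteq> 0" and T: "finite T" "card T \<ge> 4" "even (card T)"
    and eq: "w\<^sup>2 = (\<Prod>e\<in>T. s - line_const e)"
  shows "s \<in> range line_const"
proof -
  obtain A B where AB: "s = Fract A B" "B \<noteq> 0" and cop: "\<And>z. \<not> (poly A z = 0 \<and> poly B z = 0)"
    using fract_coprime_rep by blast
  obtain U V where UV: "w = Fract U V" "V \<noteq> 0" by (rule Fract_cases)
  \<comment> \<open>Evenness makes the common denominator \<open>B ^ card T\<close> a square, which
    can be moved to the side of \<open>w\<^sup>2\<close>.\<close>
  obtain m where m: "card T = 2 * m" using T by (elim evenE)
  have const: "s \<in> range line_const" if deg: "degree A = 0 \<and> degree B = 0"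
  proof -
    obtain x where x: "A = [:x:]" using deg by (auto elim: degree_eq_zeroE)
    obtain y where xy: "B = [:y:]" using deg by (auto elim: degree_eq_zeroE)
    with AB have y: "y \<noteq> 0" by auto
    then have "[:x:] * 1 = [:x / y:] * [:y:]" by simp
    with y have "Fract [:x:] [:y:] = Fract [:x / y:] 1"
      by (subst eq_fract) (auto simp del: mult_pCons_left mult_pCons_right)
    then have "s = line_const (x / y)" using AB x xy by (simp add: line_const_def)
    then show ?thesis by blast
  qed
  define R where "R = (\<Prod>e\<in>T. A - smult e B)"
  have "(\<Prod>e\<in>T'. s - line_const e) = Fract (\<Prod>e\<in>T'. A - smult e B) (B ^ card T')"
    if "finite T'" for T'
    using that
  proof (induction T')
    case empty
    then show ?case by (simp add: One_fract_def)
  next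
    case (insert e T')
    have "s - line_const e = Fract (A - smult e B) B"
      using AB by (simp add: line_const_def mult.commute)
    then show ?case using insert by simp
  qed
  from this[OF T(1)] eq have "Fract (U * U) (V * V) = Fract R (B ^ card T)"
    by (simp add: R_def UV power2_eq_square)
  then have "U * U * B ^ (2 * m) = R * (V * V)" using UV AB by (simp add: eq_fract m)
  then have main: "(U * B ^ m)\<^sup>2 = R * V\<^sup>2"
    by (simp add: power2_eq_square mult_2_right power_add algebra_simps)
  show ?thesis
  proof (cases "\<exists>e\<in>T. A - smult e B = 0")
    case True
    then obtain e where A: "A = smult e B" by auto
    have "poly B z \<noteq> 0" for z using cop[of z] A by auto
    then have "degree B = 0" by (rule poly_no_root_const)
    then show ?thesis using A const by simp
  next
    case False
    then have nz: "A - smult e B \<noteq> 0" if "e \<in> T" for e using that by blast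
    then have R0: "R \<noteq> 0" using T by (simp add: R_def)
    have sq: "\<exists>s. A - smult e B = s\<^sup>2" if e: "e \<in> T" for e
    proof (rule poly_square_if_even_orders[OF nz[OF e]])
      fix z
      show "even (order z (A - smult e B))"
      proof (cases "poly (A - smult e B) z = 0")
        case True
        define R' where "R' = (\<Prod>e\<in>T - {e}. A - smult e B)"
        have R: "R = (A - smult e B) * R'" unfolding R_def R'_def using e T by (simp add: prod.remove)
        have "poly (A - smult d B) z \<noteq> 0" if "d \<in> T - {e}" for d
        proof
          assume "poly (A - smult d B) z = 0"
          with True have *: "(d - e) * poly B z = 0" by (auto simp: algebra_simps)
          then have "poly B z = 0" using that by auto
          with True cop[of z] show False by simp
        qed
        then have "poly R' z \<noteq> 0" unfolding R'_def using T by (simp add: poly_prod)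
        then have "order z R' = 0" by (rule order_0I)
        then have "order z (R * V\<^sup>2) = order z (A - smult e B) + 2 * order z V"
          using R0 UV R by (simp add: order_mult power2_eq_square)
        moreover have "order z ((U * B ^ m)\<^sup>2) = 2 * order z (U * B ^ m)"
        proof -
          have "U * B ^ m \<noteq> 0" using main R0 UV AB(2) by (metis mult_eq_0_iff power_not_zero zero_power2)
          then show ?thesis unfolding power2_eq_square by (subst order_mult) auto
        qed
        ultimately have "order z (A - smult e B) + 2 * order z V = 2 * order z (U * B ^ m)"
          using main by simp
        then show ?thesis by presburger
      qed (simp add: order_0I)
    qed
    obtain T' where T': "T' \<subseteq> T" "card T' = 4" using T obtain_subset_with_card_n by metis
    then have "finite T'" using T finite_subset by blast
    then obtain f where "bij_betw f {..<4::nat} T'"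
      using T' ex_bij_betw_nat_finite[of T'] by (metis atLeast0LessThan)
    then have "inj_on f {..<4}" "\<And>i. i < 4 \<Longrightarrow> f i \<in> T"
      using T' by (auto simp: bij_betw_def)
    then have "degree A = 0 \<and> degree B = 0"
      using four_squares_in_pencil[OF two cop, of f] sq by blast
    then show ?thesis by (rule const)
  qed
qed

section \<open>Evaluation of polynomials and degrees over k(w)\<close>

lemma field_embedding_0: "field_embedding h \<Longrightarrow> h 0 = 0"
  unfolding field_embedding_def by (metis add.right_neutral add_left_cancel)

lemma field_embedding_uminus: "field_embedding h \<Longrightarrow> h (- u) = - h u"
  using field_embedding_0[of h] unfolding field_embedding_def
  by (metis add.right_inverse add_eq_0_iff)

lemma field_embedding_diff: "field_embedding h \<Longrightarrow> h (u - v) = h u - h v"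
  using field_embedding_uminus[of h v] unfolding field_embedding_def
  by (metis add_uminus_conv_diff)

lemma field_embedding_eq_0_iff: "field_embedding h \<Longrightarrow> h u = 0 \<longleftrightarrow> u = 0"
  using field_embedding_0[of h] unfolding field_embedding_def
  by (metis mult_zero_left right_inverse zero_neq_one)

lemma field_embedding_inverse: "field_embedding h \<Longrightarrow> h (inverse u) = inverse (h u)"
proof (cases "u = 0")
  case False
  assume h: "field_embedding h"
  then have "h u * h (inverse u) = 1"
    using False unfolding field_embedding_def by (metis right_inverse)
  then show ?thesis by (simp add: inverse_unique)
qed (simp add: field_embedding_0)

lemma field_embedding_divide: "field_embedding h \<Longrightarrow> h (u / v) = h u / h v"
  using field_embedding_inverse[of h v] by (simp add: field_embedding_def divide_inverse)

lemma field_embedding_prod: "field_embedding h \<Longrightarrow> h (prod f A) = (\<Prod>i\<in>A. h (f i))"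
  by (induction A rule: infinite_finite_induct) (auto simp: field_embedding_def)

lemma field_embedding_power: "field_embedding h \<Longrightarrow> h (u ^ n) = h u ^ n"
  by (induction n) (auto simp: field_embedding_def)

lemma inj_field_embedding: "field_embedding h \<Longrightarrow> inj h"
  using field_embedding_eq_0_iff[of h] field_embedding_diff[of h]
  by (metis eq_iff_diff_eq_0 injI)

lemma field_embedding_comp:
  "field_embedding h \<Longrightarrow> field_embedding g \<Longrightarrow> field_embedding (h \<circ> g)"
  by (auto simp: field_embedding_def)

lemma field_embedding_add: "field_embedding h \<Longrightarrow> h (u + v) = h u + h v"
  and field_embedding_mult: "field_embedding h \<Longrightarrow> h (u * v) = h u * h v"
  and field_embedding_1: "field_embedding h \<Longrightarrow> h 1 = 1"
  by (simp_all add: field_embedding_def)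

definition pev :: "('k::field \<Rightarrow> 'a::field) \<Rightarrow> 'k poly \<Rightarrow> 'a \<Rightarrow> 'a" where
  "pev c q w = poly (map_poly c q) w"

lemma pev_0 [simp]: "pev c 0 w = 0"
  by (simp add: pev_def)

lemma pev_pCons: "field_embedding c \<Longrightarrow> pev c (pCons a q) w = c a + w * pev c q w"
  by (simp add: pev_def map_poly_pCons field_embedding_0)

lemma pev_const: "field_embedding c \<Longrightarrow> pev c [:a:] w = c a"
  by (simp add: pev_pCons)

lemma pev_1: "field_embedding c \<Longrightarrow> pev c 1 w = 1"
  by (simp add: one_pCons pev_pCons field_embedding_1)

lemma pev_add:
  assumes c: "field_embedding c"
  shows "pev c (p + q) w = pev c p w + pev c q w"
  by (induction p q rule: poly_induct2)
    (simp_all add: pev_pCons[OF c] field_embedding_add[OF c] algebra_simps)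

lemma pev_smult:
  assumes c: "field_embedding c"
  shows "pev c (smult a q) w = c a * pev c q w"
  by (induction q) (simp_all add: pev_pCons[OF c] field_embedding_mult[OF c] algebra_simps)

lemma pev_uminus: "field_embedding c \<Longrightarrow> pev c (- q) w = - pev c q w"
  using pev_smult[of c "- 1" q w] by (simp add: field_embedding_uminus field_embedding_1)

lemma pev_diff: "field_embedding c \<Longrightarrow> pev c (p - q) w = pev c p w - pev c q w"
  using pev_add[of c p "- q" w] by (simp add: pev_uminus)

lemma pev_mult:
  assumes c: "field_embedding c"
  shows "pev c (p * q) w = pev c p w * pev c q w"
  by (induction p)
    (simp_all add: pev_pCons[OF c] pev_add[OF c] pev_smult[OF c] field_embedding_0[OF c] algebra_simps)

lemma pev_power: "field_embedding c \<Longrightarrow> pev c (p ^ n) w = pev c p w ^ n"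
  by (induction n) (simp_all add: pev_1 pev_mult)

lemma pev_sum: "field_embedding c \<Longrightarrow> pev c (sum f A) w = (\<Sum>i\<in>A. pev c (f i) w)"
  by (induction A rule: infinite_finite_induct) (auto simp: pev_add)

lemma pev_prod: "field_embedding c \<Longrightarrow> pev c (prod f A) w = (\<Prod>i\<in>A. pev c (f i) w)"
  by (induction A rule: infinite_finite_induct) (auto simp: pev_mult pev_1)

lemma pev_monom:
  assumes c: "field_embedding c"
  shows "pev c (monom a n) w = c a * w ^ n"
  by (induction n) (simp_all add: monom_0 monom_Suc pev_pCons[OF c] field_embedding_0[OF c])

lemma pev_linear: "field_embedding c \<Longrightarrow> pev c [:- a, 1:] w = w - c a"
  by (simp add: pev_pCons field_embedding_uminus field_embedding_1)

lemma pev_pcompose: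
  assumes c: "field_embedding c"
  shows "pev c (pcompose q r) w = pev c q (pev c r w)"
  by (induction q)
    (simp_all add: pcompose_pCons pev_pCons[OF c] pev_add[OF c] pev_mult[OF c])

lemma pev_hom:
  assumes c: "field_embedding c" and h: "field_embedding h" and hc: "h \<circ> c = d"
  shows "h (pev c q w) = pev d q (h w)"
proof -
  have d: "field_embedding d" using field_embedding_comp[OF h c] hc by simp
  have "h (c a) = d a" for a using hc by (simp add: fun_eq_iff)
  then show ?thesis
    by (induction q)
      (simp_all add: pev_pCons[OF c] pev_pCons[OF d] field_embedding_0[OF h]
        field_embedding_add[OF h] field_embedding_mult[OF h])
qed

section \<open>Transcendental elements and embeddings of k(t)\<close>

definition transcendental :: "('k::field \<Rightarrow> 'a::field) \<Rightarrow> 'a \<Rightarrow> bool" where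
  "transcendental c w \<longleftrightarrow> (\<forall>q. pev c q w = 0 \<longrightarrow> q = 0)"

text \<open>A polynomial over k splits into linear factors, and M behaves like a prime ideal without
  nonzero constants, so one factor lands in M. The set M is {0} when algebraic elements are shown to
  be constant, and the maximal ideal of a valuation ring when residues are computed.\<close>

lemma pev_mem_prime_imp_linear:
  fixes c :: "'k::alg_closed_field \<Rightarrow> 'a::field"
  assumes c: "field_embedding c" and "q \<noteq> 0" "pev c q w \<in> M"
    and prime: "\<And>a q. (w - c a) * pev c q w \<in> M \<Longrightarrow> w - c a \<in> M \<or> pev c q w \<in> M"
    and const: "\<And>a. a \<noteq> 0 \<Longrightarrow> c a \<notin> M"
  shows "\<exists>a. w - c a \<in> M"
  using assms(2,3)
proof (induction "degree q" arbitrary: q rule: less_induct)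
  case less
  show ?case
  proof (cases "degree q = 0")
    case True
    then obtain b where b: "q = [:b:]" by (auto elim: degree_eq_zeroE)
    with less.prems const[of b] show ?thesis by (simp add: pev_const[OF c])
  next
    case False
    then obtain a where "poly q a = 0" using alg_closed_imp_poly_has_root by blast
    then obtain q' where q': "q = [:- a, 1:] * q'" by (meson dvdE poly_eq_0_iff_dvd)
    have q'0: "q' \<noteq> 0" using less.prems q' by auto
    have "degree q' < degree q" unfolding q' by (subst degree_mult_eq) (use q'0 in auto)
    moreover have "w - c a \<in> M \<or> pev c q' w \<in> M"
      using less.prems(2) unfolding q' pev_mult[OF c] pev_linear[OF c] by (rule prime)
    ultimately show ?thesis using less.hyps[of q'] q'0 by blast
  qed
qed

lemma transcendental_if_nonconst:
  fixes c :: "'k::alg_closed_field \<Rightarrow> 'a::field"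
  assumes c: "field_embedding c" and w: "w \<notin> range c"
  shows "transcendental c w"
  unfolding transcendental_def
proof (intro allI impI, rule ccontr)
  fix q assume q: "pev c q w = 0" "q \<noteq> 0"
  have "\<exists>a. w - c a \<in> {0}"
    by (rule pev_mem_prime_imp_linear[OF c q(2)]) (auto simp: q field_embedding_eq_0_iff[OF c])
  with w show False by auto
qed

lemma transcendental_nonconst:
  assumes c: "field_embedding c" and w: "transcendental c w"
  shows "w \<notin> range c"
proof
  assume "w \<in> range c"
  then obtain a where "w = c a" by blast
  then have "pev c [:- a, 1:] w = 0" by (simp add: pev_linear[OF c])
  with w show False unfolding transcendental_def by fastforce
qed

lemma transcendental_hom:
  assumes c: "field_embedding c" and h: "field_embedding h" and hc: "h \<circ> c = d"
    and w: "transcendental c w"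
  shows "transcendental d (h w)"
  unfolding transcendental_def
  using w by (simp add: transcendental_def pev_hom[OF c h hc, symmetric] field_embedding_eq_0_iff[OF h])

lemma field_embedding_line_const: "field_embedding (line_const :: 'k::field \<Rightarrow> _)"
  by (simp add: field_embedding_def line_const_def One_fract_def one_pCons mult.commute)

lemma pev_line_coord: "pev line_const q line_coord = Fract q 1"
proof (induction q)
  case (pCons a q)
  have "line_const a + line_coord * Fract q 1 = Fract (pCons a q) 1"
    by (simp add: line_const_def line_coord_def)
  then show ?case unfolding pev_pCons[OF field_embedding_line_const] pCons.IH .
qed (simp add: Zero_fract_def)

lemma transcendental_line_coord: "transcendental line_const line_coord"
  by (simp add: transcendental_def pev_line_coord Zero_fract_def eq_fract)

lemma line_embedding_Fract:
  assumes c: "field_embedding c" and h: "field_embedding h" and hc: "h \<circ> line_const = c"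
  shows "h (Fract A B) = pev c A (h line_coord) / pev c B (h line_coord)"
proof -
  have "h (Fract A B) = h (Fract A 1 / Fract B 1)" by simp
  also have "\<dots> = h (Fract A 1) / h (Fract B 1)" by (rule field_embedding_divide[OF h])
  finally show ?thesis
    by (simp add: pev_line_coord[symmetric] pev_hom[OF field_embedding_line_const h hc])
qed

lemma line_embedding_exists:
  fixes c :: "'k::field \<Rightarrow> 'a::field"
  assumes c: "field_embedding c" and w: "transcendental c w"
  obtains h where "field_embedding h" "h \<circ> line_const = c" "h line_coord = w"
proof -
  \<comment> \<open>The value on a fraction is first a relation ranging over all its
    representations; cross-multiplication shows that it is single-valued.\<close>
  define g where "g = (\<lambda>q. \<lambda>z. \<exists>A B. B \<noteq> 0 \<and> q = Fract A B \<and> z = pev c A w / pev c B w)"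
  define h where "h = (\<lambda>q. THE z. g q z)"
  have nz: "pev c B w \<noteq> 0" if "B \<noteq> 0" for B using w that by (auto simp: transcendental_def)
  have h: "h (Fract A B) = pev c A w / pev c B w" if B: "B \<noteq> 0" for A B
    unfolding h_def
  proof (rule the_equality)
    show "g (Fract A B) (pev c A w / pev c B w)" using B unfolding g_def by blast
    fix z assume "g (Fract A B) z"
    then obtain A' B' where *: "B' \<noteq> 0" "Fract A B = Fract A' B'" "z = pev c A' w / pev c B' w"
      unfolding g_def by blast
    then have "A * B' = A' * B" using B by (simp add: eq_fract)
    then have "pev c A w * pev c B' w = pev c A' w * pev c B w" by (metis pev_mult[OF c])
    then show "z = pev c A w / pev c B w"
      using * B nz by (simp add: frac_eq_eq)
  qed
  have "field_embedding h"
    unfolding field_embedding_def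
  proof (intro conjI allI)
    show "h 1 = 1" using h[of 1 1] by (simp add: One_fract_def pev_1[OF c])
    fix u v :: "'k poly fract"
    obtain A B where u: "u = Fract A B" "B \<noteq> 0" by (rule Fract_cases)
    obtain A' B' where v: "v = Fract A' B'" "B' \<noteq> 0" by (rule Fract_cases)
    show "h (u + v) = h u + h v"
      using u v nz by (simp add: h pev_add[OF c] pev_mult[OF c] add_frac_eq)
    show "h (u * v) = h u * h v"
      using u v by (simp add: h pev_mult[OF c])
  qed
  moreover have "h \<circ> line_const = c"
    by (simp add: fun_eq_iff line_const_def h pev_const[OF c] pev_1[OF c])
  moreover have "h line_coord = w"
    by (simp add: line_coord_def h pev_pCons[OF c] field_embedding_0[OF c] field_embedding_1[OF c] pev_1[OF c])
  ultimately show thesis by (rule that)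
qed

section \<open>Bounding the degree of K over k(w)\<close>

lemma (in vector_space) family_dependent:
  fixes z :: "nat \<Rightarrow> 'b"
  assumes T: "finite T" "card T \<le> n" and z: "\<And>i. i \<le> n \<Longrightarrow> z i \<in> span T"
  obtains \<beta> i where "i \<le> n" "\<beta> i \<noteq> 0" "(\<Sum>i\<le>n. \<beta> i *s z i) = 0"
proof (cases "inj_on z {..n}")
  case True
  define S where "S = z ` {..n}"
  have "card S = Suc n" using True by (simp add: S_def card_image)
  moreover have "S \<subseteq> span T" using z by (auto simp: S_def)
  ultimately have "dependent S" using independent_span_bound[of T S] T by fastforce
  then obtain u where u: "\<exists>v\<in>S. u v \<noteq> 0" "(\<Sum>v\<in>S. u v *s v) = 0"
    using dependent_finite[of S] by (auto simp: S_def)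
  have "(\<Sum>i\<le>n. u (z i) *s z i) = 0" using u(2) True by (simp add: S_def sum.reindex)
  moreover obtain i where "i \<le> n" "u (z i) \<noteq> 0" using u(1) by (auto simp: S_def)
  ultimately show thesis using that[of i "\<lambda>i. u (z i)"] by simp
next
  case False
  then obtain i j where ij: "i \<le> n" "j \<le> n" "i \<noteq> j" "z i = z j" by (auto simp: inj_on_def)
  \<comment> \<open>A repeated entry, which passing to the set of values would lose, is itself a
    relation with coefficients 1 and -1.\<close>
  define \<beta> :: "nat \<Rightarrow> 'a" where "\<beta> = (\<lambda>k. if k = i then 1 else if k = j then - 1 else 0)"
  have "(\<Sum>k\<le>n. \<beta> k *s z k) = (\<Sum>k\<in>{i, j}. \<beta> k *s z k)"
    by (rule sum.mono_neutral_right) (use ij in \<open>auto simp: \<beta>_def\<close>)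
  also have "\<dots> = 0" using ij by (simp add: \<beta>_def scale_minus_left)
  finally show thesis using that[of i \<beta>] ij by (simp add: \<beta>_def)
qed

text \<open>
  This says that K has degree at most n over k(w), with denominators cleared so that the
  subfield k(w) need not be mentioned.
\<close>

definition degree_le :: "('k::field \<Rightarrow> 'a::field) \<Rightarrow> 'a \<Rightarrow> nat \<Rightarrow> bool" where
  "degree_le c w n \<longleftrightarrow>
     (\<forall>z::nat \<Rightarrow> 'a. \<exists>q. (\<exists>i\<le>n. q i \<noteq> 0) \<and> (\<Sum>i\<le>n. pev c (q i) w * z i) = 0)"

lemma degree_le_of_span:
  fixes h :: "'k::field poly fract \<Rightarrow> 'a::field"
  assumes c: "field_embedding c" and h: "field_embedding h" and hc: "h \<circ> line_const = c"
    and B: "finite B" "card B \<le> n" and sp: "module.span (\<lambda>b f. h b * f) B = UNIV"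
  shows "degree_le c (h line_coord) n"
  unfolding degree_le_def
proof
  fix z :: "nat \<Rightarrow> 'a"
  interpret vector_space "\<lambda>b f. h b * f" by (rule vector_space_field_embedding[OF h])
  let ?w = "h line_coord"
  have nz: "pev c q ?w \<noteq> 0" if "q \<noteq> 0" for q
    using transcendental_hom[OF field_embedding_line_const h hc transcendental_line_coord] that
    by (auto simp: transcendental_def)
  obtain \<beta> i where \<beta>: "i \<le> n" "\<beta> i \<noteq> 0" "(\<Sum>i\<le>n. h (\<beta> i) * z i) = 0"
    using family_dependent[of B n z] B sp by (metis UNIV_I)
  have "\<exists>N D. \<beta> i = Fract N D \<and> D \<noteq> 0" for i by (metis Fract_cases)
  then obtain N D where ND: "\<And>i. \<beta> i = Fract (N i) (D i)" "\<And>i. D i \<noteq> 0" by metis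
  \<comment> \<open>All coefficients are multiplied by the product of all denominators; in the i-th
    one its own denominator cancels.\<close>
  define q where "q = (\<lambda>i. N i * (\<Prod>j\<in>{..n} - {i}. D j))"
  have "N i \<noteq> 0" using \<beta>(2) ND by (auto simp: fract_collapse)
  then have "q i \<noteq> 0" using ND by (simp add: q_def)
  moreover have "(\<Sum>i\<le>n. pev c (q i) ?w * z i) = 0"
  proof -
    have "pev c (q i) ?w = (\<Prod>j\<le>n. pev c (D j) ?w) * h (\<beta> i)" if "i \<le> n" for i
    proof -
      have "(\<Prod>j\<le>n. pev c (D j) ?w) = pev c (D i) ?w * (\<Prod>j\<in>{..n} - {i}. pev c (D j) ?w)"
        using that by (simp add: prod.remove)
      then show ?thesis using nz[OF ND(2)[of i]]
        by (simp add: q_def pev_mult[OF c] pev_prod[OF c] ND(1) line_embedding_Fract[OF c h hc])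
    qed
    then have "(\<Sum>i\<le>n. pev c (q i) ?w * z i) = (\<Prod>j\<le>n. pev c (D j) ?w) * (\<Sum>i\<le>n. h (\<beta> i) * z i)"
      by (simp add: sum_distrib_left mult.assoc)
    then show ?thesis using \<beta>(3) by simp
  qed
  ultimately show "\<exists>q. (\<exists>i\<le>n. q i \<noteq> 0) \<and> (\<Sum>i\<le>n. pev c (q i) ?w * z i) = 0"
    using \<beta>(1) by blast
qed

lemma degree_le_minus:
  fixes c :: "'k::field \<Rightarrow> 'a::field"
  assumes c: "field_embedding c" and w: "degree_le c w n"
  shows "degree_le c (w - c a) n"
  unfolding degree_le_def
proof
  fix z :: "nat \<Rightarrow> 'a"
  obtain q i where q: "i \<le> n" "q i \<noteq> 0" "(\<Sum>i\<le>n. pev c (q i) w * z i) = 0"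
    using w unfolding degree_le_def by blast
  define q' where "q' = (\<lambda>i. pcompose (q i) [:a, 1:])"
  have "pev c (q' i) (w - c a) = pev c (q i) w" for i
    by (simp add: q'_def pev_pcompose[OF c] pev_pCons[OF c] field_embedding_1[OF c])
  moreover have "q' i \<noteq> 0" using q(2) by (simp add: q'_def pcompose_eq_0_iff)
  ultimately show "\<exists>q. (\<exists>i\<le>n. q i \<noteq> 0) \<and> (\<Sum>i\<le>n. pev c (q i) (w - c a) * z i) = 0"
    using q by (intro exI[of _ q']) auto
qed

text \<open>The polynomial is reversed relative to a bound N instead of its own degree, so that one
  power of w serves all the coefficients of a relation at once.\<close>

lemma pev_reverse:
  fixes c :: "'k::field \<Rightarrow> 'a::field"
  assumes c: "field_embedding c" and w: "w \<noteq> 0" and "degree q \<le> N"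
  shows "\<exists>r. pev c r (inverse w) * w ^ N = pev c q w"
  using assms(3)
proof (induction q arbitrary: N)
  case 0
  show ?case by (rule exI[of _ 0]) simp
next
  case (pCons a q)
  show ?case
  proof (cases "q = 0")
    case True
    have "pev c (monom a N) (inverse w) * w ^ N = c a"
      using w by (simp add: pev_monom[OF c] power_inverse)
    then show ?thesis using True by (intro exI[of _ "monom a N"]) (simp add: pev_pCons[OF c])
  next
    case False
    then obtain N' where N: "N = Suc N'" "degree q \<le> N'" using pCons.prems by (cases N) auto
    obtain r where r: "pev c r (inverse w) * w ^ N' = pev c q w" using pCons.IH[OF N(2)] by blast
    have "pev c (r + monom a N) (inverse w) * w ^ N = pev c (pCons a q) w"
      using w by (simp add: pev_add[OF c] pev_monom[OF c] pev_pCons[OF c] N(1) field_simps flip: r)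
    then show ?thesis by blast
  qed
qed

lemma degree_le_inverse:
  fixes c :: "'k::field \<Rightarrow> 'a::field"
  assumes c: "field_embedding c" and tr: "transcendental c w" and w: "degree_le c w n"
  shows "degree_le c (inverse w) n"
  unfolding degree_le_def
proof
  fix z :: "nat \<Rightarrow> 'a"
  have w0: "w \<noteq> 0"
    using transcendental_nonconst[OF c tr] field_embedding_0[OF c] by (metis rangeI)
  obtain q i where q: "i \<le> n" "q i \<noteq> 0" "(\<Sum>i\<le>n. pev c (q i) w * z i) = 0"
    using w unfolding degree_le_def by blast
  define N where "N = (\<Sum>i\<le>n. degree (q i))"
  have "degree (q i) \<le> N" if "i \<le> n" for i
    unfolding N_def by (rule member_le_sum) (use that in auto)
  then have "\<exists>r. i \<le> n \<longrightarrow> pev c r (inverse w) * w ^ N = pev c (q i) w" for i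
    using pev_reverse[OF c w0] by blast
  then obtain r where r: "\<And>i. i \<le> n \<Longrightarrow> pev c (r i) (inverse w) * w ^ N = pev c (q i) w"
    by metis
  have "(\<Sum>i\<le>n. pev c (r i) (inverse w) * z i) * w ^ N = (\<Sum>i\<le>n. pev c (q i) w * z i)"
    unfolding sum_distrib_right by (rule sum.cong) (simp_all add: r[symmetric])
  then have "(\<Sum>i\<le>n. pev c (r i) (inverse w) * z i) = 0" using q(3) w0 by simp
  moreover have "r i \<noteq> 0"
  proof
    assume "r i = 0"
    then have "pev c (q i) w = 0" using r[OF q(1)] by simp
    with tr q(2) show False by (simp add: transcendental_def)
  qed
  ultimately show "\<exists>q. (\<exists>i\<le>n. q i \<noteq> 0) \<and> (\<Sum>i\<le>n. pev c (q i) (inverse w) * z i) = 0"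
    using q(1) by blast
qed

text \<open>Cancelling the largest power of w common to the coefficients leaves one with nonzero
  constant term. In a valuation ring where w is a nonunit, that coefficient is a unit, so the
  relation remains nontrivial modulo the maximal ideal.\<close>

lemma degree_le_primitive:
  fixes c :: "'k::field \<Rightarrow> 'a::field" and z :: "nat \<Rightarrow> 'a"
  assumes c: "field_embedding c" and w: "degree_le c w n" "w \<noteq> 0"
  obtains q i where "i \<le> n" "poly (q i) 0 \<noteq> 0" "(\<Sum>i\<le>n. pev c (q i) w * z i) = 0"
proof -
  obtain q i where q: "i \<le> n" "q i \<noteq> 0" "(\<Sum>i\<le>n. pev c (q i) w * z i) = 0"
    using w unfolding degree_le_def by blast
  define I where "I = {i. i \<le> n \<and> q i \<noteq> 0}"
  define M where "M = Min ((\<lambda>i. order 0 (q i)) ` I)"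
  have I: "finite I" "I \<noteq> {}" using q by (auto simp: I_def)
  have "\<exists>r. i \<le> n \<longrightarrow> q i = [:0, 1:] ^ M * r" for i
  proof (cases "i \<in> I")
    case True
    then have "M \<le> order 0 (q i)" using I by (simp add: M_def)
    then have "[:- 0, 1:] ^ M dvd q i" by (subst order_divides) simp
    then show ?thesis by auto
  next
    case False
    then show ?thesis by (intro exI[of _ 0]) (auto simp: I_def)
  qed
  then obtain r where r: "\<And>i. i \<le> n \<Longrightarrow> q i = [:0, 1:] ^ M * r i" by metis
  have "M \<in> (\<lambda>i. order 0 (q i)) ` I" unfolding M_def by (rule Min_in) (use I in auto)
  then obtain j where j: "j \<in> I" "order 0 (q j) = M" by blast
  have "poly (r j) 0 \<noteq> 0"
  proof
    assume "poly (r j) 0 = 0"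
    then have "[:- 0, 1:] dvd r j" by (subst (asm) poly_eq_0_iff_dvd)
    then have "[:- 0, 1:] ^ Suc M dvd q j"
      using j r[of j] mult_dvd_mono[of "[:0, 1:]" "r j" "[:0, 1:] ^ M" "[:0, 1:] ^ M"]
      by (simp add: I_def mult.commute del: mult_pCons_left mult_pCons_right)
    moreover have "q j \<noteq> 0" using j by (simp add: I_def)
    ultimately show False using j(2) order_2[of "q j" 0] by simp
  qed
  moreover have "(\<Sum>i\<le>n. pev c (r i) w * z i) = 0"
  proof -
    have "(\<Sum>i\<le>n. pev c (q i) w * z i) = w ^ M * (\<Sum>i\<le>n. pev c (r i) w * z i)"
      unfolding sum_distrib_left
      by (rule sum.cong) (simp_all add: r pev_mult[OF c] pev_power[OF c] pev_pCons[OF c]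
          field_embedding_0[OF c] field_embedding_1[OF c])
    then show ?thesis using q(3) w(2) by simp
  qed
  ultimately show thesis using that[of j r] j by (simp add: I_def)
qed

section \<open>Valuation rings\<close>

definition is_vr :: "'a::field set \<Rightarrow> bool" where
  "is_vr V \<longleftrightarrow> 1 \<in> V \<and> (\<forall>u\<in>V. \<forall>v\<in>V. u - v \<in> V \<and> u * v \<in> V) \<and>
     (\<forall>z. z \<in> V \<or> inverse z \<in> V) \<and> V \<noteq> UNIV"

text \<open>The maximal ideal of a valuation ring. Zero needs its own clause because
  \<open>inverse 0 = 0\<close> lies in V.\<close>

definition nonunits :: "'a::field set \<Rightarrow> 'a set" where
  "nonunits V = {z \<in> V. z = 0 \<or> inverse z \<notin> V}"

locale val_ring =
  fixes V :: "'a::field set"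
  assumes vr: "is_vr V"
begin

lemma one_mem: "1 \<in> V" and diff_mem: "u \<in> V \<Longrightarrow> v \<in> V \<Longrightarrow> u - v \<in> V"
  and mult_mem: "u \<in> V \<Longrightarrow> v \<in> V \<Longrightarrow> u * v \<in> V" and total: "z \<in> V \<or> inverse z \<in> V"
  using vr by (auto simp: is_vr_def)

lemma zero_mem: "0 \<in> V" using diff_mem[OF one_mem one_mem] by simp

lemma uminus_mem: "u \<in> V \<Longrightarrow> - u \<in> V" using diff_mem[OF zero_mem, of u] by simp

lemma add_mem: "u \<in> V \<Longrightarrow> v \<in> V \<Longrightarrow> u + v \<in> V" using diff_mem[of u "- v"] uminus_mem[of v] by simp

lemma power_mem: "u \<in> V \<Longrightarrow> u ^ n \<in> V" by (induction n) (auto simp: one_mem mult_mem)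

lemma nonunits_mem: "f \<in> nonunits V \<Longrightarrow> f \<in> V" by (simp add: nonunits_def)

lemma zero_nonunit: "0 \<in> nonunits V" by (simp add: nonunits_def zero_mem)

lemma one_not_nonunit: "1 \<notin> nonunits V" by (simp add: nonunits_def one_mem)

lemma inverse_nonunit: "f \<notin> V \<Longrightarrow> inverse f \<in> nonunits V"
  using total[of f] zero_mem by (auto simp: nonunits_def)

lemma inverse_mem: "f \<notin> nonunits V \<Longrightarrow> inverse f \<in> V"
  using total[of f] zero_mem by (auto simp: nonunits_def)

lemma nonunits_mult: "f \<in> nonunits V \<Longrightarrow> g \<in> V \<Longrightarrow> f * g \<in> nonunits V"
proof -
  assume f: "f \<in> nonunits V" and g: "g \<in> V"
  have "inverse f \<in> V" if "f * g \<noteq> 0" "inverse (f * g) \<in> V"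
  proof -
    have "inverse f = g * inverse (f * g)" using that(1) by (simp add: field_simps)
    then show ?thesis using mult_mem[OF g that(2)] by (simp only:)
  qed
  then show ?thesis using f g mult_mem by (auto simp: nonunits_def)
qed

lemma nonunits_mult2: "g \<in> V \<Longrightarrow> f \<in> nonunits V \<Longrightarrow> g * f \<in> nonunits V"
  using nonunits_mult[of f g] by (simp add: mult.commute)

lemma nonunits_uminus: "f \<in> nonunits V \<Longrightarrow> - f \<in> nonunits V"
  using nonunits_mult[of f "- 1"] uminus_mem[OF one_mem] by simp

lemma nonunits_add:
  assumes "f \<in> nonunits V" "g \<in> nonunits V"
  shows "f + g \<in> nonunits V"
proof (cases "f = 0 \<or> g = 0")
  case False
  have *: "x + y \<in> nonunits V" if "x \<in> nonunits V" "x \<noteq> 0" "y / x \<in> V" for x y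
  proof -
    have "x + y = x * (1 + y / x)" using that by (simp add: field_simps)
    then show ?thesis using nonunits_mult[OF that(1) add_mem[OF one_mem that(3)]] by simp
  qed
  have "f / g \<in> V \<or> g / f \<in> V" using total[of "f / g"] by simp
  then show ?thesis using *[of f g] *[of g f] False assms by (auto simp: add.commute)
qed (use assms in auto)

lemma nonunits_sum: "(\<And>i. i \<in> A \<Longrightarrow> f i \<in> nonunits V) \<Longrightarrow> sum f A \<in> nonunits V"
  by (induction A rule: infinite_finite_induct) (auto simp: zero_nonunit nonunits_add)

lemma nonunits_prime:
  assumes "f \<in> V" "g \<in> V" "f * g \<in> nonunits V"
  shows "f \<in> nonunits V \<or> g \<in> nonunits V"
proof (rule ccontr)
  assume *: "\<not> ?thesis"
  then have "inverse f * inverse g \<in> V" using inverse_mem mult_mem by blast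
  then have "f * g = 0" using assms(3) by (auto simp: nonunits_def)
  then show False using * zero_nonunit by auto
qed

text \<open>The ultrametric principle: divided by its dominant term, the sum is 1 plus a nonunit.
  The arguments by linear independence over k(u) or k(s) all come down to exhibiting such a
  term.\<close>

lemma dominated_sum_nonzero:
  assumes "finite I" "j \<in> I" "f j \<noteq> 0" "\<And>i. i \<in> I \<Longrightarrow> i \<noteq> j \<Longrightarrow> f i / f j \<in> nonunits V"
  shows "sum f I \<noteq> 0"
proof
  assume 0: "sum f I = 0"
  have "sum f I = f j + (\<Sum>i\<in>I - {j}. f i)" using assms by (simp add: sum.remove)
  then have "sum f I / f j = 1 + (\<Sum>i\<in>I - {j}. f i / f j)"
    using assms(3) by (simp add: add_divide_distrib sum_divide_distrib)
  then have "1 = - (\<Sum>i\<in>I - {j}. f i / f j)" using 0 by (simp add: eq_neg_iff_add_eq_0)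
  moreover have "- (\<Sum>i\<in>I - {j}. f i / f j) \<in> nonunits V"
    by (intro nonunits_uminus nonunits_sum) (use assms in auto)
  ultimately show False using one_not_nonunit by simp
qed

end

section \<open>Valuation rings containing the constants\<close>

locale val_ring_over = val_ring V for V :: "'a::field set" +
  fixes c :: "'k::alg_closed_field \<Rightarrow> 'a"
  assumes c: "field_embedding c" and const_mem: "range c \<subseteq> V"
begin

lemma const_unit: "a \<noteq> 0 \<Longrightarrow> c a \<notin> nonunits V"
  using const_mem by (auto simp: nonunits_def field_embedding_eq_0_iff[OF c]
      simp flip: field_embedding_inverse[OF c])

lemma pev_mem: "w \<in> V \<Longrightarrow> pev c q w \<in> V"
proof (induction q)
  case (pCons a q)
  have "c a \<in> V" using const_mem by blast
  then show ?case using pCons by (simp add: pev_pCons[OF c] add_mem mult_mem)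
qed (simp add: zero_mem)

lemma pev_residue:
  assumes w: "w \<in> nonunits V"
  shows "pev c q w - c (poly q 0) \<in> nonunits V"
proof (cases q rule: pCons_cases)
  case (pCons a r)
  have "w * pev c r w \<in> nonunits V" by (intro nonunits_mult w pev_mem nonunits_mem)
  then show ?thesis by (simp add: pCons pev_pCons[OF c])
qed

lemma pev_unit:
  assumes w: "w \<in> nonunits V" and q: "poly q 0 \<noteq> 0"
  shows "pev c q w \<notin> nonunits V" "pev c q w \<noteq> 0" "inverse (pev c q w) \<in> V"
proof -
  show 1: "pev c q w \<notin> nonunits V"
  proof
    assume "pev c q w \<in> nonunits V"
    from nonunits_add[OF this nonunits_uminus[OF pev_residue[OF w, of q]]]
    show False using const_unit[OF q] by simp
  qed
  then show "pev c q w \<noteq> 0" "inverse (pev c q w) \<in> V" using zero_nonunit inverse_mem by auto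
qed

lemma nonunit_linear:
  assumes "w \<in> V" "q \<noteq> 0" "pev c q w \<in> nonunits V"
  shows "\<exists>a. w - c a \<in> nonunits V"
proof (rule pev_mem_prime_imp_linear[OF c assms(2,3) _ const_unit])
  fix a q
  have "w - c a \<in> V" using assms(1) const_mem by (auto intro: diff_mem)
  then show "(w - c a) * pev c q w \<in> nonunits V \<Longrightarrow> w - c a \<in> nonunits V \<or> pev c q w \<in> nonunits V"
    using nonunits_prime pev_mem[OF assms(1)] by blast
qed

text \<open>The danger is that V is trivial on k(u). Then every nonzero polynomial in u would be a
  unit of V, and an f outside V would satisfy an algebraic equation over k[u] whose leading term
  dominates. So V lies over infinity or over a point a of the line, and s is the local parameter
  there; it inherits the degree bound of u.\<close>

lemma center_on_line:
  assumes u: "transcendental c u" "degree_le c u n"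
  obtains s where "s \<in> nonunits V" "s \<noteq> 0" "degree_le c s n" "s = inverse u \<or> (\<exists>a. s = u - c a)"
proof (cases "u \<in> V")
  case False
  moreover have "u \<noteq> 0" using False zero_mem by blast
  ultimately show ?thesis using that[of "inverse u"] inverse_nonunit degree_le_inverse[OF c u] by simp
next
  case True
  have "\<exists>g. g \<noteq> 0 \<and> pev c g u \<in> nonunits V"
  proof (rule ccontr)
    assume *: "\<not> ?thesis"
    obtain f where f: "f \<notin> V" using vr by (auto simp: is_vr_def)
    then have f0: "f \<noteq> 0" using zero_mem by blast
    obtain q i where q: "i \<le> n" "q i \<noteq> 0" "(\<Sum>i\<le>n. pev c (q i) u * f ^ i) = 0"
      using u(2)[unfolded degree_le_def, rule_format, of "\<lambda>i. f ^ i"] by blast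
    define j where "j = Max {i. i \<le> n \<and> q i \<noteq> 0}"
    have "j \<in> {i. i \<le> n \<and> q i \<noteq> 0}" unfolding j_def by (rule Max_in) (use q in auto)
    then have j: "j \<le> n" "q j \<noteq> 0" by auto
    have gt: "q i = 0" if "i \<le> n" "i > j" for i
    proof (rule ccontr)
      assume "q i \<noteq> 0"
      then have "i \<le> j" unfolding j_def using that by (intro Max_ge) auto
      with that show False by simp
    qed
    have qj: "pev c (q j) u \<notin> nonunits V" using * j by blast
    then have qj0: "pev c (q j) u \<noteq> 0" using zero_nonunit by metis
    have "(\<Sum>i\<le>n. pev c (q i) u * f ^ i) \<noteq> 0"
    proof (rule dominated_sum_nonzero[where j = j])
      fix i assume i: "i \<in> {..n}" "i \<noteq> j"
      show "pev c (q i) u * f ^ i / (pev c (q j) u * f ^ j) \<in> nonunits V"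
      proof (cases "i < j")
        case True
        then obtain d where d: "j = Suc (i + d)" using less_iff_Suc_add by blast
        have "pev c (q i) u * f ^ i / (pev c (q j) u * f ^ j)
            = pev c (q i) u * inverse (pev c (q j) u) * inverse f ^ d * inverse f"
          unfolding d using f0 qj0 by (simp add: field_simps power_add power_inverse)
        also have "\<dots> \<in> nonunits V"
          by (intro nonunits_mult2 inverse_nonunit[OF f] mult_mem power_mem pev_mem True
              inverse_mem qj \<open>u \<in> V\<close> nonunits_mem)
        finally show ?thesis .
      qed (use gt i in \<open>auto simp: zero_nonunit\<close>)
    qed (use j f0 qj0 in auto)
    then show False using q(3) by simp
  qed
  then obtain a where a: "u - c a \<in> nonunits V" using nonunit_linear[OF True] by blast
  moreover have "u - c a \<noteq> 0" using transcendental_nonconst[OF c u(1)] by auto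
  ultimately show ?thesis using that[of "u - c a"] degree_le_minus[OF c u(2)] by blast
qed

text \<open>Reducing a primitive relation among the powers of f modulo the maximal ideal gives a
  nonzero polynomial over k that annihilates the residue of f, and k is algebraically
  closed.\<close>

lemma residue_const:
  assumes s: "s \<in> nonunits V" "s \<noteq> 0" "degree_le c s n" and f: "f \<in> V"
  shows "\<exists>a. f - c a \<in> nonunits V"
proof -
  obtain q i where q: "i \<le> n" "poly (q i) 0 \<noteq> 0" "(\<Sum>i\<le>n. pev c (q i) s * f ^ i) = 0"
    using degree_le_primitive[OF c s(3,2), of "\<lambda>i. f ^ i"] by blast
  define g where "g = (\<Sum>i\<le>n. monom (poly (q i) 0) i)"
  have "coeff g i = poly (q i) 0"
    using q(1) by (simp add: g_def coeff_sum sum.delta' cong: if_cong)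
  then have "g \<noteq> 0" using q(2) by auto
  moreover have "pev c g f \<in> nonunits V"
  proof -
    have "pev c g f = (\<Sum>i\<le>n. c (poly (q i) 0) * f ^ i) - (\<Sum>i\<le>n. pev c (q i) s * f ^ i)"
      by (simp add: q(3) g_def pev_sum[OF c] pev_monom[OF c])
    also have "\<dots> = - (\<Sum>i\<le>n. (pev c (q i) s - c (poly (q i) 0)) * f ^ i)"
      by (simp add: left_diff_distrib sum_subtractf)
    also have "\<dots> \<in> nonunits V"
      by (intro nonunits_uminus nonunits_sum nonunits_mult pev_residue s power_mem f)
    finally show ?thesis .
  qed
  ultimately show ?thesis using nonunit_linear[OF f] by blast
qed

text \<open>
  The n + 1 elements would be linearly independent over k(s).  Applied to a chain of proper
  divisors of s, and then to the powers of a generator of the maximal ideal, this makes V discrete.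
\<close>

lemma chain_bound:
  assumes s: "s \<in> nonunits V" "s \<noteq> 0" "degree_le c s n"
    and z: "\<And>i. i \<le> n \<Longrightarrow> z i \<noteq> 0" "\<And>i. i \<le> n \<Longrightarrow> z i \<in> V" "\<And>i. i \<le> n \<Longrightarrow> s / z i \<in> nonunits V"
      "\<And>i j. i < j \<Longrightarrow> j \<le> n \<Longrightarrow> z i / z j \<in> nonunits V"
  shows False
proof -
  obtain q i where q: "i \<le> n" "poly (q i) 0 \<noteq> 0" "(\<Sum>i\<le>n. pev c (q i) s * z i) = 0"
    using degree_le_primitive[OF c s(3,2), of z] by blast
  \<comment> \<open>With j the last index whose coefficient is a unit, terms before j are dominated
    because \<open>z i / z j\<close> is a nonunit, and terms after j because their coefficient
    contains a factor s and \<open>s / z j\<close> is a nonunit.\<close>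
  define j where "j = Max {i. i \<le> n \<and> poly (q i) 0 \<noteq> 0}"
  have "j \<in> {i. i \<le> n \<and> poly (q i) 0 \<noteq> 0}" unfolding j_def by (rule Max_in) (use q in auto)
  then have j: "j \<le> n" "poly (q j) 0 \<noteq> 0" by auto
  have gt: "poly (q i) 0 = 0" if "i \<le> n" "i > j" for i
  proof (rule ccontr)
    assume "poly (q i) 0 \<noteq> 0"
    then have "i \<le> j" unfolding j_def using that by (intro Max_ge) auto
    with that show False by simp
  qed
  note qj = pev_unit[OF s(1) j(2)]
  have sV: "s \<in> V" by (rule nonunits_mem[OF s(1)])
  have "(\<Sum>i\<le>n. pev c (q i) s * z i) \<noteq> 0"
  proof (rule dominated_sum_nonzero[where j = j])
    fix i assume i: "i \<in> {..n}" "i \<noteq> j"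
    show "pev c (q i) s * z i / (pev c (q j) s * z j) \<in> nonunits V"
    proof (cases "i < j")
      case True
      have "pev c (q i) s * z i / (pev c (q j) s * z j)
          = pev c (q i) s * inverse (pev c (q j) s) * (z i / z j)" by (simp add: field_simps)
      also have "\<dots> \<in> nonunits V"
        by (intro nonunits_mult2 z mult_mem pev_mem sV qj True j)
      finally show ?thesis .
    next
      case False
      then have "poly (q i) 0 = 0" using gt i by simp
      then obtain r where r: "q i = pCons 0 r" by (cases "q i" rule: pCons_cases) auto
      have "pev c (q i) s * z i / (pev c (q j) s * z j)
          = pev c r s * z i * inverse (pev c (q j) s) * (s / z j)"
        by (simp add: r pev_pCons[OF c] field_embedding_0[OF c] field_simps)
      also have "\<dots> \<in> nonunits V"
        by (intro nonunits_mult2 z mult_mem pev_mem sV qj j) (use i in auto)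
      finally show ?thesis .
    qed
  qed (use j z qj in auto)
  then show False using q(3) by simp
qed

lemma principal:
  assumes s: "s \<in> nonunits V" "s \<noteq> 0" "degree_le c s n"
  obtains t where "t \<in> nonunits V" "t \<noteq> 0" "\<And>f. f \<in> nonunits V \<Longrightarrow> f / t \<in> V"
proof (rule ccontr)
  assume "\<not> thesis"
  with that have *: "\<exists>f. f \<in> nonunits V \<and> f / t \<notin> V" if "t \<in> nonunits V" "t \<noteq> 0" for t
    using \<open>t \<in> nonunits V\<close> \<open>t \<noteq> 0\<close> by blast
  \<comment> \<open>If t does not generate the maximal ideal, some f in it has \<open>f / t\<close>
    outside V; then \<open>t / f\<close> is a nonunit, so f properly divides t and the chain can be
    continued.\<close>
  have "\<exists>f. t \<in> nonunits V \<and> t \<noteq> 0 \<longrightarrow> f \<in> nonunits V \<and> f \<noteq> 0 \<and> t / f \<in> nonunits V" for t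
    using *[of t] inverse_nonunit zero_mem by (metis div_0 inverse_divide)
  then obtain g where g: "\<And>t. t \<in> nonunits V \<Longrightarrow> t \<noteq> 0 \<Longrightarrow>
      g t \<in> nonunits V \<and> g t \<noteq> 0 \<and> t / g t \<in> nonunits V" by metis
  define y where "y = (\<lambda>k. (g ^^ k) s)"
  have y: "y k \<in> nonunits V \<and> y k \<noteq> 0" for k
    by (induction k) (use s g in \<open>auto simp: y_def\<close>)
  have yS: "y k / y (Suc k) \<in> nonunits V" for k
    using g[of "y k"] y[of k] by (simp add: y_def)
  have yd: "y i / y (Suc (i + d)) \<in> nonunits V" for i d
  proof (induction d)
    case (Suc d)
    have "y i / y (Suc (i + Suc d)) = (y i / y (Suc (i + d))) * (y (Suc (i + d)) / y (Suc (Suc (i + d))))"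
      using y by simp
    with nonunits_mult[OF Suc nonunits_mem[OF yS[of "Suc (i + d)"]]] show ?case by (simp only: mult_Suc)
  qed (use yS in simp)
  then have yy: "y i / y j \<in> nonunits V" if "i < j" for i j
  proof -
    obtain d where "j = Suc (i + d)" using less_imp_Suc_add[OF \<open>i < j\<close>] by (elim exE)
    then show ?thesis using yd[of i d] by simp
  qed
  have y0: "y 0 = s" by (simp add: y_def)
  show False
  proof (rule chain_bound[OF s, of "\<lambda>i. y (Suc i)"])
    fix i j :: nat
    show "y (Suc i) \<noteq> 0" using y by blast
    show "y (Suc i) \<in> V" using y nonunits_mem by blast
    show "s / y (Suc i) \<in> nonunits V" using yy[of 0 "Suc i"] y0 by simp
    show "y (Suc i) / y (Suc j) \<in> nonunits V" if "i < j" using yy that by simp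
  qed
qed

text \<open>The exponent is the order of q at 0: the remaining factor of q has nonzero constant
  term, so its value at s is a unit.\<close>

lemma unit_powers_of_nonunit:
  assumes s: "s \<in> nonunits V" and q: "q \<noteq> 0" 
  obtains k where "s ^ k / pev c q s \<in> V"
proof -
  obtain r where r: "q = [:- 0, 1:] ^ order 0 q * r" "\<not> [:- 0, 1:] dvd r"
    using order_decomp[OF q] by blast
  then have r0: "poly r 0 \<noteq> 0" by (simp only: poly_eq_0_iff_dvd not_False_eq_True)
  have "pev c q s = pev c ([:0, 1:] ^ order 0 q * r) s" using r(1) by simp
  also have "\<dots> = s ^ order 0 q * pev c r s"
    by (simp add: pev_mult[OF c] pev_power[OF c] pev_pCons[OF c] field_embedding_0[OF c]
        field_embedding_1[OF c])
  finally have "s ^ order 0 q / pev c q s = (if s = 0 \<and> order 0 q \<noteq> 0 then 0 else inverse (pev c r s))"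
    by (auto simp: field_simps)
  moreover have "inverse (pev c r s) \<in> V" using pev_unit[OF s r0] by blast
  ultimately have "s ^ order 0 q / pev c q s \<in> V" using zero_mem by simp
  then show thesis by (rule that)
qed

lemma is_dvr:
  assumes s: "s \<in> nonunits V" "s \<noteq> 0" "degree_le c s n"
  shows "is_dvr V"
proof -
  obtain t where t: "t \<in> nonunits V" "t \<noteq> 0" "\<And>f. f \<in> nonunits V \<Longrightarrow> f / t \<in> V"
    using principal[OF s] by blast
  have tV: "t \<in> V" by (rule nonunits_mem[OF t(1)])
  \<comment> \<open>Otherwise s would be properly divisible by every power of t, and the powers from
    \<open>t ^ n\<close> down to \<open>t ^ 0\<close> would form a forbidden chain.\<close>
  have "\<exists>e. s / t ^ e \<notin> nonunits V"
  proof (rule ccontr)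
    assume "\<not> ?thesis"
    then have *: "s / t ^ e \<in> nonunits V" for e by blast
    show False
    proof (rule chain_bound[OF s, of "\<lambda>i. t ^ (n - i)"])
      fix i j assume ij: "i < j" "j \<le> n"
      then obtain d where d: "n - i = Suc ((n - j) + d)"
        using less_iff_Suc_add[of "n - j" "n - i"] by auto
      have "t ^ (n - i) / t ^ (n - j) = t * t ^ d"
        unfolding d using t(2) by (simp add: power_add)
      then show "t ^ (n - i) / t ^ (n - j) \<in> nonunits V"
        using nonunits_mult[OF t(1) power_mem[OF tV]] by simp
    qed (use * t(2) tV power_mem in auto)
  qed
  then obtain e where "s / t ^ e \<notin> nonunits V" by blast
  then have e: "t ^ e / s \<in> V" using inverse_mem[of "s / t ^ e"] by simp
  \<comment> \<open>An f divisible by all powers of t is divisible by all powers of s, because s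
    divides \<open>t ^ e\<close>. Then no nonzero polynomial in s can offset a power of
    \<open>1/f\<close>, and in an algebraic relation for \<open>1/f\<close> over k[s] the term of
    highest degree dominates.\<close>
  have fin: "\<exists>e. f / t ^ e \<notin> nonunits V" if f0: "f \<noteq> 0" for f
  proof (rule ccontr)
    assume "\<not> ?thesis"
    then have *: "f / t ^ k \<in> nonunits V" for k by blast
    have fV: "f \<in> V" using *[of 0] nonunits_mem by simp
    have fs: "f / s ^ k \<in> nonunits V" for k
    proof -
      have "f / s ^ k = f / t ^ (e * k) * (t ^ e / s) ^ k"
        using t(2) by (simp add: power_divide power_mult)
      then show ?thesis using nonunits_mult[OF * power_mem[OF e]] by simp
    qed
    obtain q i where q: "i \<le> n" "q i \<noteq> 0" "(\<Sum>i\<le>n. pev c (q i) s * inverse f ^ i) = 0"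
      using s(3)[unfolded degree_le_def, rule_format, of "\<lambda>i. inverse f ^ i"] by blast
    define j where "j = Max {i. i \<le> n \<and> q i \<noteq> 0}"
    have "j \<in> {i. i \<le> n \<and> q i \<noteq> 0}" unfolding j_def by (rule Max_in) (use q in auto)
    then have j: "j \<le> n" "q j \<noteq> 0" by auto
    have gt: "q i = 0" if "i \<le> n" "i > j" for i
    proof (rule ccontr)
      assume "q i \<noteq> 0"
      then have "i \<le> j" unfolding j_def using that by (intro Max_ge) auto
      with that show False by simp
    qed
    obtain k where k: "s ^ k / pev c (q j) s \<in> V" using unit_powers_of_nonunit[OF s(1) j(2)] .
    have "transcendental c s"
    proof (rule transcendental_if_nonconst[OF c])
      show "s \<notin> range c"
      proof
        assume "s \<in> range c"
        then obtain a where a: "s = c a" by blast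
        then have "a \<noteq> 0" using s(2) field_embedding_0[OF c] by auto
        then show False using const_unit s(1) a by blast
      qed
    qed
    then have qj0: "pev c (q j) s \<noteq> 0" using j by (auto simp: transcendental_def)
    have "(\<Sum>i\<le>n. pev c (q i) s * inverse f ^ i) \<noteq> 0"
    proof (rule dominated_sum_nonzero[where j = j])
      fix i assume i: "i \<in> {..n}" "i \<noteq> j"
      show "pev c (q i) s * inverse f ^ i / (pev c (q j) s * inverse f ^ j) \<in> nonunits V"
      proof (cases "i < j")
        case True
        then obtain d where d: "j = Suc (i + d)" using less_iff_Suc_add by blast
        have "pev c (q i) s * inverse f ^ i / (pev c (q j) s * inverse f ^ j)
            = pev c (q i) s * f ^ d * (s ^ k / pev c (q j) s) * (f / s ^ k)"
          unfolding d using f0 qj0 s(2) by (simp add: field_simps power_add)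
        also have "\<dots> \<in> nonunits V"
          by (intro nonunits_mult2 fs mult_mem power_mem fV k pev_mem nonunits_mem s(1))
        finally show ?thesis .
      qed (use gt i in \<open>auto simp: zero_nonunit\<close>)
    qed (use j f0 qj0 in auto)
    then show False using q(3) by simp
  qed
  have dec: "\<exists>k u. is_unit_of V u \<and> f = u * t ^ k" if f: "f \<in> V" "f \<noteq> 0" for f
  proof -
    \<comment> \<open>By minimality \<open>f / t ^ (k - 1)\<close> is still a nonunit when k > 0,
      hence divisible by t once more; this puts \<open>f / t ^ k\<close> in V.\<close>
    define k where "k = (LEAST e. f / t ^ e \<notin> nonunits V)"
    have k: "f / t ^ k \<notin> nonunits V" unfolding k_def by (rule LeastI_ex[OF fin[OF f(2)]])
    have "f / t ^ k \<in> V"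
    proof (cases k)
      case (Suc m)
      then have "m < (LEAST e. f / t ^ e \<notin> nonunits V)" by (simp add: k_def)
      then have "f / t ^ m \<in> nonunits V" using not_less_Least by blast
      from t(3)[OF this] show ?thesis using Suc by (simp add: mult.commute)
    qed (use f in simp)
    then have "is_unit_of V (f / t ^ k)"
      using inverse_mem[OF k] f t by (auto simp: is_unit_of_def)
    moreover have "f = f / t ^ k * t ^ k" using t by simp
    ultimately show ?thesis by blast
  qed
  have "is_uniformizer V t"
    unfolding is_uniformizer_def
  proof (intro conjI allI impI)
    show "inverse t \<notin> V" using t by (auto simp: nonunits_def)
    fix f :: 'a assume f: "f \<noteq> 0"
    show "\<exists>(m::int) u. is_unit_of V u \<and> f = u * t powi m"
    proof (cases "f \<in> V")
      case True
      then obtain k u where "is_unit_of V u" "f = u * t ^ k" using dec f by blast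
      then show ?thesis by (metis power_int_of_nat)
    next
      case False
      then obtain k u where u: "is_unit_of V u" "inverse f = u * t ^ k"
        using dec[of "inverse f"] f total[of f] by auto
      then have "f = inverse u * t powi (- int k)"
        by (metis inverse_inverse_eq inverse_mult_distrib power_int_minus power_int_of_nat)
      then show ?thesis using is_unit_of_inverse[OF u(1)] by blast
    qed
  qed (use t tV in auto)
  then show ?thesis
    unfolding is_dvr_def using one_mem diff_mem mult_mem by blast
qed

end

text \<open>
  If neither z nor 1/z lies in S, then f lies in both S[z] and S[1/z].  Dividing by f writes 1 as a
  polynomial in z, and as a polynomial in 1/z, with coefficients in S/f; the constant terms 1 - s/f
  are units of S, so the shorter of the two relations can be used to shorten the longer.
\<close>

lemma maximal_subring_is_vr:
  fixes f :: "'a::field" and S :: "'a set"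
  defines "ring \<equiv> \<lambda>S::'a set. 1 \<in> S \<and> (\<forall>u\<in>S. \<forall>v\<in>S. u - v \<in> S \<and> u * v \<in> S)"
  assumes S: "ring S" "f \<notin> S" "inverse f \<in> S"
    and max: "\<And>T. ring T \<Longrightarrow> S \<subseteq> T \<Longrightarrow> f \<notin> T \<Longrightarrow> T = S"
  shows "is_vr S"
proof -
  have one: "1 \<in> S" and diff: "u - v \<in> S" and mult: "u * v \<in> S" if "u \<in> S" "v \<in> S" for u v
    using S(1) that by (auto simp: ring_def)
  have one': "1 \<in> S" using S(1) by (simp add: ring_def)
  have zero: "0 \<in> S" using diff[OF one' one'] by simp
  have uminus: "- u \<in> S" if "u \<in> S" for u using diff[OF zero that] by simp
  have add: "u + v \<in> S" if "u \<in> S" "v \<in> S" for u v using diff[OF that(1) uminus[OF that(2)]] by simp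
  have pow: "u ^ n \<in> S" if "u \<in> S" for u n by (induction n) (use that one' mult in auto)
  have sum: "sum g A \<in> S" if "\<And>i. i \<in> A \<Longrightarrow> g i \<in> S" for g :: "nat \<Rightarrow> 'a" and A
    using that by (induction A rule: infinite_finite_induct) (auto simp: zero add)
  define w where "w = inverse f"
  have f0: "f \<noteq> 0" using S(2) zero by blast
  have w: "w \<in> S" "w \<noteq> 0" "inverse w = f" using S(3) f0 by (auto simp: w_def)
  define adj where "adj = (\<lambda>z. {poly p z | p. \<forall>i. coeff p i \<in> S})"
  have adj_ring: "ring (adj z)" and adj_sub: "S \<subseteq> adj z" and adj_self: "z \<in> adj z" for z
  proof -
    have "poly p z - poly q z \<in> adj z" "poly p z * poly q z \<in> adj z"
      if "\<forall>i. coeff p i \<in> S" "\<forall>i. coeff q i \<in> S" for p q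
    proof -
      have "\<forall>i. coeff (p - q) i \<in> S" using that diff by auto
      then show "poly p z - poly q z \<in> adj z" unfolding adj_def
        by (intro CollectI exI[of _ "p - q"] conjI) simp_all
      have "\<forall>i. coeff (p * q) i \<in> S" unfolding coeff_mult using that by (auto intro!: sum mult)
      then show "poly p z * poly q z \<in> adj z" unfolding adj_def
        by (intro CollectI exI[of _ "p * q"] conjI) simp_all
    qed
    moreover have "1 \<in> adj z" unfolding adj_def
      by (rule CollectI, rule exI[of _ 1]) (use zero one' in \<open>auto simp: coeff_1\<close>)
    moreover have "\<exists>p. (\<forall>i. coeff p i \<in> S) \<and> x = poly p z" if "x \<in> adj z" for x
      using that unfolding adj_def by blast
    ultimately show "ring (adj z)" unfolding ring_def by metis
    show "S \<subseteq> adj z"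
    proof
      fix x assume "x \<in> S"
      then have "\<forall>i. coeff [:x:] i \<in> S" using zero by (auto simp: coeff_pCons split: nat.splits)
      then show "x \<in> adj z" unfolding adj_def by (intro CollectI exI[of _ "[:x:]"]) simp
    qed
    have "\<forall>i. coeff [:0, 1:] i \<in> S" using zero one' by (auto simp: coeff_pCons split: nat.splits)
    then show "z \<in> adj z" unfolding adj_def by (intro CollectI exI[of _ "[:0, 1:]"]) simp
  qed
  have f_adj: "f \<in> adj z" if "z \<notin> S" for z
  proof (rule ccontr)
    assume "f \<notin> adj z"
    then have "adj z = S" by (intro max adj_ring adj_sub)
    then show False using adj_self that by blast
  qed
  \<comment> \<open>If q = 1 - w s had no inverse in S, then f would be a polynomial in 1/q, so
    \<open>q ^ N * f\<close> would lie in S for some N. But \<open>q ^ N\<close> is again of the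
    form 1 - w x, and it equals w times \<open>q ^ N * f\<close>; so 1 would be w times an element
    of S, and that element would be f.\<close>
  have unit: "1 - w * s \<noteq> 0 \<and> inverse (1 - w * s) \<in> S" if s: "s \<in> S" for s
  proof -
    have n1: "1 \<noteq> w * x" if "x \<in> S" for x
    proof
      assume "1 = w * x"
      then have "f = x" using w by (metis inverse_unique)
      then show False using that S(2) by blast
    qed
    have q0: "1 - w * s \<noteq> 0" using n1[OF s] by simp
    define q where "q = 1 - w * s"
    have qS: "q \<in> S" unfolding q_def by (intro diff one' mult w s)
    have "inverse q \<in> S"
    proof (rule ccontr)
      assume "inverse q \<notin> S"
      from f_adj[OF this] obtain p where p: "f = poly p (inverse q)" "\<forall>i. coeff p i \<in> S"
        unfolding adj_def by blast
      define N where "N = degree p"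
      have "q ^ N * f = (\<Sum>i\<le>N. coeff p i * (q ^ N * inverse q ^ i))"
        unfolding p(1) poly_altdef N_def by (simp add: sum_distrib_left mult_ac)
      also have "\<dots> = (\<Sum>i\<le>N. coeff p i * q ^ (N - i))"
        by (rule sum.cong) (use q0 in \<open>auto simp: q_def[symmetric] power_diff power_inverse divide_inverse\<close>)
      also have "\<dots> \<in> S"
        by (intro sum mult pow qS) (use p(2) in blast)
      finally have r: "q ^ N * f \<in> S" .
      have "\<exists>x\<in>S. q ^ n = 1 - w * x" for n
      proof (induction n)
        case (Suc n)
        then obtain x where x: "x \<in> S" "q ^ n = 1 - w * x" by blast
        have "q ^ Suc n = (1 - w * s) * (1 - w * x)" by (simp add: x(2) flip: q_def)
        then have "q ^ Suc n = 1 - w * (s + x - w * s * x)" by (simp add: algebra_simps)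
        moreover have "s + x - w * s * x \<in> S" by (intro diff add mult s x w)
        ultimately show ?case by blast
      qed (use zero in \<open>auto intro: bexI[of _ 0]\<close>)
      then obtain x where x: "x \<in> S" "q ^ N = 1 - w * x" by blast
      have "w * (q ^ N * f) = q ^ N" using f0 by (simp add: w_def)
      then have "1 = w * (x + q ^ N * f)" unfolding distrib_left using x(2) by (simp only: add_diff_eq diff_add_cancel add_diff_cancel_left')
      then show False using n1[OF add[OF x(1) r]] by blast
    qed
    then show ?thesis using q0 by (simp add: q_def)
  qed
  define rel where "rel = (\<lambda>z n. \<exists>a. (\<forall>i. a i \<in> S) \<and> 1 = (\<Sum>i\<le>n. w * a i * z ^ i))"
  have rel_ex: "\<exists>n. rel z n" if zS: "z \<notin> S" for z
  proof -
    obtain p where p: "f = poly p z" "\<forall>i. coeff p i \<in> S" using f_adj[OF zS] unfolding adj_def by blast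
    have "1 = w * f" using w f0 by (simp add: w_def)
    also have "\<dots> = (\<Sum>i\<le>degree p. w * coeff p i * z ^ i)"
      by (simp add: p(1) poly_altdef sum_distrib_left mult_ac)
    finally show ?thesis unfolding rel_def using p(2) by blast
  qed
  have reduce: "\<exists>k<n. rel z k" if z: "z \<noteq> 0" and n: "rel z n" and m: "rel (inverse z) m" and mn: "m \<le> n" for z n m
  proof -
    obtain a where a: "\<And>i. a i \<in> S" "1 = (\<Sum>i\<le>n. w * a i * z ^ i)" using n unfolding rel_def by blast
    obtain b where b: "\<And>i. b i \<in> S" "1 = (\<Sum>i\<le>m. w * b i * inverse z ^ i)" using m unfolding rel_def by blast
    have n1: "1 \<noteq> w * x" if "x \<in> S" for x using unit[OF that] by auto
    have m0: "m \<noteq> 0"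
    proof
      assume "m = 0"
      then show False using b n1 by simp
    qed
    define q where "q = 1 - w * b 0"
    have q: "q \<noteq> 0" "inverse q \<in> S" using unit[OF b(1)] by (auto simp: q_def)
    have "{..m} = insert 0 {1..m}" by auto
    then have "(\<Sum>i\<le>m. w * b i * inverse z ^ i) = w * b 0 + (\<Sum>i=1..m. w * b i * inverse z ^ i)"
      by simp
    then have "q = (\<Sum>i=1..m. w * b i * inverse z ^ i)"
      unfolding q_def using b(2) by (metis add_diff_cancel_left')
    then have "q * z ^ n = (\<Sum>i=1..m. w * b i * inverse z ^ i) * z ^ n" by simp
    also have "\<dots> = (\<Sum>i=1..m. w * b i * z ^ (n - i))"
      unfolding sum_distrib_right
      by (rule sum.cong) (use z mn in \<open>auto simp: power_diff power_inverse divide_inverse\<close>)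
    finally have zn: "z ^ n = (\<Sum>i=1..m. w * b i * inverse q * z ^ (n - i))"
      using q(1) by (simp add: sum_distrib_left field_simps flip: sum_divide_distrib)
    obtain k where k: "n = Suc k" using m0 mn by (cases n) auto
    \<comment> \<open>\<open>d j\<close> is the new coefficient at \<open>z ^ j\<close> once the top
      power \<open>z ^ n\<close> has been replaced; the guard says that i = n - j runs from 1 to
      m.\<close>
    define d where "d = (\<lambda>j. if j \<le> k \<and> n \<le> m + j then w * a n * b (n - j) * inverse q else 0)"
    have "(\<Sum>i=1..m. w * b i * inverse q * z ^ (n - i)) * (w * a n) = (\<Sum>j\<le>k. w * d j * z ^ j)"
    proof -
      have "(\<Sum>j\<le>k. w * d j * z ^ j) = (\<Sum>j\<in>{n - m..k}. w * d j * z ^ j)"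
        by (rule sum.mono_neutral_right) (auto simp: d_def)
      also have "\<dots> = (\<Sum>i\<in>{1..m}. w * d (n - i) * z ^ (n - i))"
        by (rule sum.reindex_bij_witness[of _ "\<lambda>i. n - i" "\<lambda>j. n - j"]) (use mn k in auto)
      also have "\<dots> = (\<Sum>i\<in>{1..m}. w * b i * inverse q * z ^ (n - i) * (w * a n))"
        by (rule sum.cong) (use mn k in \<open>auto simp: d_def\<close>)
      finally show ?thesis by (simp add: sum_distrib_right)
    qed
    then have "w * a n * z ^ n = (\<Sum>j\<le>k. w * d j * z ^ j)" using zn by (simp add: mult.commute)
    then have "1 = (\<Sum>j\<le>k. w * (a j + d j) * z ^ j)"
      using a(2) unfolding k by (simp add: sum.distrib algebra_simps)
    moreover have "a j + d j \<in> S" for j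
      by (auto simp: d_def intro!: add mult a b w q zero)
    ultimately have "rel z k" unfolding rel_def by (intro exI[of _ "\<lambda>j. a j + d j"]) auto
    then show ?thesis using k by blast
  qed
  have "z \<in> S \<or> inverse z \<in> S" for z
  proof (rule ccontr)
    assume *: "\<not> ?thesis"
    then have z0: "z \<noteq> 0" using zero by auto
    define n where "n = (LEAST n. rel z n)"
    define m where "m = (LEAST n. rel (inverse z) n)"
    have n: "rel z n" unfolding n_def by (rule LeastI_ex) (use rel_ex * in blast)
    have m: "rel (inverse z) m" unfolding m_def by (rule LeastI_ex) (use rel_ex * in blast)
    show False
    proof (cases "m \<le> n")
      case True
      then obtain k where "k < n" "rel z k" using reduce[OF z0 n m] by blast
      then show False using not_less_Least n_def by blast
    next
      case False
      then obtain k where "k < m" "rel (inverse z) k"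
        using reduce[of "inverse z" m n] z0 n m by auto
      then show False using not_less_Least m_def by blast
    qed
  qed
  then show ?thesis unfolding is_vr_def using one' diff mult S(2) by blast
qed

text \<open>Among the subrings containing k and 1/f but not f, a maximal one is a valuation ring,
  and it is discrete because K has finite degree over k(u). The family is nonempty: f = q(1/f) would
  be an algebraic equation for 1/f, so k[1/f] belongs to it. The purpose is that a function regular
  at all points is constant.\<close>

lemma exists_pole:
  fixes c :: "'k::alg_closed_field \<Rightarrow> 'a::field"
  assumes c: "field_embedding c" and u: "transcendental c u" "degree_le c u n"
    and f: "f \<notin> range c"
  shows "\<exists>P\<in>points c. f \<notin> P"
proof -
  define ring where "ring = (\<lambda>S::'a set. 1 \<in> S \<and> (\<forall>u\<in>S. \<forall>v\<in>S. u - v \<in> S \<and> u * v \<in> S))"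
  have f0: "f \<noteq> 0" using f field_embedding_0[OF c] by (metis rangeI)
  define w where "w = inverse f"
  have "w \<notin> range c"
  proof
    assume "w \<in> range c"
    then obtain a where "inverse f = c a" unfolding w_def by blast
    then have "f = c (inverse a)" by (metis field_embedding_inverse[OF c] inverse_inverse_eq)
    then show False using f by blast
  qed
  then have wt: "transcendental c w" by (rule transcendental_if_nonconst[OF c])
  define A where "A = {S. ring S \<and> range c \<subseteq> S \<and> w \<in> S \<and> f \<notin> S}"
  have "range (\<lambda>q. pev c q w) \<in> A"
    unfolding A_def ring_def
  proof (intro CollectI conjI ballI)
    show "1 \<in> range (\<lambda>q. pev c q w)" using pev_1[OF c, of w] by (metis rangeI)
    fix x y assume "x \<in> range (\<lambda>q. pev c q w)" "y \<in> range (\<lambda>q. pev c q w)"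
    then obtain p q where "x = pev c p w" "y = pev c q w" by blast
    then show "x - y \<in> range (\<lambda>q. pev c q w)" "x * y \<in> range (\<lambda>q. pev c q w)"
      by (metis pev_diff[OF c] rangeI, metis pev_mult[OF c] rangeI)
  next
    show "range c \<subseteq> range (\<lambda>q. pev c q w)" by (metis image_subsetI pev_const[OF c] rangeI)
    have "pev c [:0, 1:] w = w" by (simp add: pev_pCons[OF c] field_embedding_0[OF c] field_embedding_1[OF c])
    then show "w \<in> range (\<lambda>q. pev c q w)" by (metis rangeI)
    show "f \<notin> range (\<lambda>q. pev c q w)"
    proof
      assume "f \<in> range (\<lambda>q. pev c q w)"
      then obtain q where "f = pev c q w" by blast
      then have "pev c (pCons (- 1) q) w = 0"
        using f0 by (simp add: pev_pCons[OF c] field_embedding_uminus[OF c] field_embedding_1[OF c] w_def)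
      then show False using wt unfolding transcendental_def by fastforce
    qed
  qed
  then have "A \<noteq> {}" by blast
  moreover have "\<Union>C \<in> A" if C: "C \<noteq> {}" "subset.chain A C" for C
  proof -
    have CA: "S \<in> A" if "S \<in> C" for S using C(2) that by (auto simp: subset.chain_def)
    have cl: "x - y \<in> \<Union>C \<and> x * y \<in> \<Union>C" if xy: "x \<in> \<Union>C" "y \<in> \<Union>C" for x y
    proof -
      obtain S T where ST: "S \<in> C" "T \<in> C" "x \<in> S" "y \<in> T" using xy by blast
      then have "S \<subseteq> T \<or> T \<subseteq> S" using C(2) by (auto simp: subset.chain_def)
      then obtain R where "R \<in> C" "x \<in> R" "y \<in> R" using ST by blast
      then show ?thesis using CA[of R] unfolding A_def ring_def by blast
    qed
    obtain S where S: "S \<in> C" using C by blast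
    have "f \<notin> \<Union>C" using CA by (auto simp: A_def)
    moreover have "1 \<in> \<Union>C" "range c \<subseteq> \<Union>C" "w \<in> \<Union>C"
      using CA[OF S] S by (auto simp: A_def ring_def)
    ultimately show ?thesis using cl unfolding A_def ring_def by blast
  qed
  ultimately obtain V where V: "V \<in> A" "\<And>X. X \<in> A \<Longrightarrow> V \<subseteq> X \<Longrightarrow> X = V"
    using subset_Zorn_nonempty[of A] by metis
  have "is_vr V"
  proof (rule maximal_subring_is_vr)
    show "1 \<in> V \<and> (\<forall>u\<in>V. \<forall>v\<in>V. u - v \<in> V \<and> u * v \<in> V)" "f \<notin> V" "inverse f \<in> V"
      using V(1) by (auto simp: A_def ring_def w_def)
    fix T assume "1 \<in> T \<and> (\<forall>u\<in>T. \<forall>v\<in>T. u - v \<in> T \<and> u * v \<in> T)" "V \<subseteq> T" "f \<notin> T"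
    then show "T = V" using V(1) by (intro V(2)) (auto simp: A_def ring_def)
  qed
  then interpret val_ring_over V c
    using c V(1) by unfold_locales (auto simp: A_def)
  obtain s where "s \<in> nonunits V" "s \<noteq> 0" "degree_le c s n" using center_on_line[OF u] by blast
  then have "is_dvr V" by (rule is_dvr)
  then show ?thesis using V(1) by (auto simp: points_def A_def)
qed

section \<open>Orders and the degree of a zero divisor\<close>

locale dvr =
  fixes R :: "'a::field set"
  assumes dvr: "is_dvr R"
begin

lemma uniformizer_exists: "\<exists>t. is_uniformizer R t"
  using dvr by (simp add: is_dvr_def)

lemma ord_decomp:
  assumes "is_uniformizer R t" "f \<noteq> 0"
  obtains u where "is_unit_of R u" "f = u * t powi (ord_at R f)"
proof -
  obtain n u where u: "is_unit_of R u" "f = u * t powi n"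
    using assms unfolding is_uniformizer_def by blast
  then have "ord_at R f = n" using ord_at_eqI[OF dvr assms(1) u(1)] by simp
  then have "f = u * t powi (ord_at R f)" using u(2) by metis
  with u(1) show thesis by (rule that)
qed

lemma ord_mult:
  assumes "f \<noteq> 0" "g \<noteq> 0"
  shows "ord_at R (f * g) = ord_at R f + ord_at R g"
proof -
  obtain t where t: "is_uniformizer R t" using uniformizer_exists by blast
  obtain u where u: "is_unit_of R u" "f = u * t powi (ord_at R f)" using ord_decomp[OF t assms(1)] .
  obtain v where v: "is_unit_of R v" "g = v * t powi (ord_at R g)" using ord_decomp[OF t assms(2)] .
  have "t \<noteq> 0" using t by (simp add: is_uniformizer_def)
  then have "f * g = (u * v) * t powi (ord_at R f + ord_at R g)"
    by (subst u(2), subst v(2)) (simp add: power_int_add)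
  then show ?thesis using ord_at_eqI[OF dvr t is_unit_of_mult[OF dvr u(1) v(1)]] by simp
qed

lemma ord_one [simp]: "ord_at R 1 = 0"
  using ord_mult[of 1 1] by simp

lemma ord_inverse: "f \<noteq> 0 \<Longrightarrow> ord_at R (inverse f) = - ord_at R f"
  using ord_mult[of f "inverse f"] by simp

lemma ord_divide: "f \<noteq> 0 \<Longrightarrow> g \<noteq> 0 \<Longrightarrow> ord_at R (f / g) = ord_at R f - ord_at R g"
  using ord_mult[of f "inverse g"] ord_inverse[of g] by (simp add: divide_inverse)

lemma ord_power: "f \<noteq> 0 \<Longrightarrow> ord_at R (f ^ n) = int n * ord_at R f"
  by (induction n) (auto simp: ord_mult algebra_simps)

lemma mem_iff:
  assumes f: "f \<noteq> 0"
  shows "f \<in> R \<longleftrightarrow> 0 \<le> ord_at R f"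
proof -
  obtain t where t: "is_uniformizer R t" using uniformizer_exists by blast
  define n where "n = ord_at R f"
  obtain u where u: "is_unit_of R u" and fu: "f = u * t powi n"
    unfolding n_def using ord_decomp[OF t f] .
  have u0: "u \<noteq> 0" "u \<in> R" "inverse u \<in> R" using u by (auto simp: is_unit_of_def)
  have mult: "x * y \<in> R" if "x \<in> R" "y \<in> R" for x y using dvr that by (simp add: is_dvr_def)
  have pow: "t powi k \<in> R" if "k \<ge> 0" for k
    using uniformizer_power_mem[OF dvr t] that by (simp add: power_int_def)
  have "0 \<le> n" if fR: "f \<in> R"
  proof (rule ccontr)
    assume neg: "\<not> ?thesis"
    have "t powi n = inverse u * f" using fu u0 by simp
    then have "t powi n \<in> R" using mult[OF u0(3) fR] by simp
    moreover have "inverse (t powi n) \<in> R" using pow[of "- n"] neg by (simp add: power_int_minus)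
    moreover have "t powi n \<noteq> 0" using t by (simp add: is_uniformizer_def)
    ultimately have "is_unit_of R (t powi n)" by (simp add: is_unit_of_def)
    then have "n = 0" by (rule uniformizer_power_unit[OF dvr t])
    with neg show False by simp
  qed
  moreover have "f \<in> R" if "0 \<le> n" unfolding fu using mult[OF u0(2) pow[OF that]] .
  ultimately show ?thesis unfolding n_def[symmetric] by blast
qed

lemma is_vr: "is_vr R"
proof -
  have "1 - 1 \<in> R" using dvr unfolding is_dvr_def by blast
  then have "z \<in> R \<or> inverse z \<in> R" for z
    using mem_iff[of z] mem_iff[of "inverse z"] ord_inverse[of z] by (cases "z = 0") auto
  moreover have "R \<noteq> UNIV" using uniformizer_exists by (auto simp: is_uniformizer_def)
  ultimately show ?thesis using dvr unfolding is_vr_def is_dvr_def by blast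
qed

sublocale val_ring R by unfold_locales (rule is_vr)

lemma nonunits_iff: "f \<noteq> 0 \<Longrightarrow> f \<in> nonunits R \<longleftrightarrow> 0 < ord_at R f"
  using mem_iff[of f] mem_iff[of "inverse f"] ord_inverse[of f] by (auto simp: nonunits_def)

lemma ord_uminus: "ord_at R (- f) = ord_at R f"
proof (cases "f = 0")
  case False
  have "2 * ord_at R (- 1) = 0" using ord_mult[of "- 1" "- 1"] by simp
  then show ?thesis using ord_mult[of "- 1" f] False by simp
qed simp

lemma obtain_ord_one: obtains t where "t \<noteq> 0" "ord_at R t = 1"
proof -
  obtain t where t: "is_uniformizer R t" using uniformizer_exists by blast
  have "is_unit_of R 1" using one_mem by (simp add: is_unit_of_def)
  then have "ord_at R (1 * t powi 1) = 1" by (rule ord_at_eqI[OF dvr t])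
  then have "ord_at R t = 1" by simp
  moreover have "t \<noteq> 0" using t by (simp add: is_uniformizer_def)
  ultimately show thesis using that by blast
qed

end

text \<open>Order at least n, with 0 counted as having infinite order; \<open>ord_at R 0\<close> is
  an unspecified value, so 0 must be treated apart.\<close>

definition vge :: "'a::field set \<Rightarrow> int \<Rightarrow> 'a \<Rightarrow> bool" where
  "vge R n f \<longleftrightarrow> f = 0 \<or> n \<le> ord_at R f"

context dvr
begin

lemma vge_iff_mem: "vge R 0 f \<longleftrightarrow> f \<in> R"
  by (cases "f = 0") (auto simp: vge_def mem_iff zero_mem)

lemma vge_iff_nonunit: "vge R 1 f \<longleftrightarrow> f \<in> nonunits R"
  by (cases "f = 0") (auto simp: vge_def nonunits_iff zero_nonunit)

lemma vge_mult: "vge R m f \<Longrightarrow> vge R n g \<Longrightarrow> vge R (m + n) (f * g)"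
  by (cases "f = 0 \<or> g = 0") (auto simp: vge_def ord_mult)

lemma vge_add: "vge R n f \<Longrightarrow> vge R n g \<Longrightarrow> vge R n (f + g)"
proof -
  assume fg: "vge R n f" "vge R n g"
  obtain t where t: "t \<noteq> 0" "ord_at R t = 1" by (rule obtain_ord_one)
  have tk: "ord_at R (t powi k) = k" for k
  proof (cases "k \<ge> 0")
    case False
    then have "t powi k = inverse (t ^ nat (- k))" by (simp add: power_int_def power_inverse)
    then show ?thesis using False t by (simp add: ord_inverse ord_power)
  qed (use t in \<open>simp add: power_int_def ord_power\<close>)
  \<comment> \<open>Multiplication by a power of t shifts the bound to 0, where the claim is closure
    of R under addition.\<close>
  have "vge R (- n) (t powi (- n))" using tk by (simp add: vge_def)
  from vge_mult[OF fg(1) this] vge_mult[OF fg(2) this]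
  have "(f + g) * t powi (- n) \<in> R" by (simp add: vge_iff_mem distrib_right add_mem)
  moreover have "vge R n (t powi n)" using tk by (simp add: vge_def)
  ultimately have "vge R (0 + n) ((f + g) * t powi (- n) * t powi n)"
    by (intro vge_mult) (simp_all add: vge_iff_mem)
  moreover have "(f + g) * t powi (- n) * t powi n = f + g"
    using t by (simp add: power_int_minus mult.assoc)
  ultimately show ?thesis by simp
qed

lemma vge_uminus: "vge R n f \<Longrightarrow> vge R n (- f)"
  by (simp add: vge_def ord_uminus)

lemma vge_diff: "vge R n f \<Longrightarrow> vge R n g \<Longrightarrow> vge R n (f - g)"
  using vge_add[of n f "- g"] vge_uminus by simp

lemma vge_0 [simp]: "vge R n 0"
  by (simp add: vge_def)

lemma vge_mono: "vge R n f \<Longrightarrow> m \<le> n \<Longrightarrow> vge R m f"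
  by (auto simp: vge_def)

lemma ord_add_eq:
  assumes "f \<noteq> 0" "vge R (ord_at R f + 1) g"
  shows "f + g \<noteq> 0" "ord_at R (f + g) = ord_at R f"
proof -
  have no: "\<not> vge R (ord_at R f + 1) (f + g)"
  proof
    assume "vge R (ord_at R f + 1) (f + g)"
    from vge_diff[OF this assms(2)] assms(1) show False by (simp add: vge_def)
  qed
  then show nz: "f + g \<noteq> 0" using vge_0 by auto
  have "vge R (ord_at R f) (f + g)"
    by (rule vge_add) (use assms in \<open>auto simp: vge_def\<close>)
  with no nz show "ord_at R (f + g) = ord_at R f" by (simp add: vge_def)
qed

end

section \<open>Weak approximation\<close>

lemma dvr_not_subset:
  assumes P: "is_dvr P" and Q: "is_dvr Q" and ne: "P \<noteq> Q"
  shows "\<exists>f\<in>P. f \<notin> Q"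
proof (rule ccontr)
  interpret P: dvr P by unfold_locales (rule P)
  interpret Q: dvr Q by unfold_locales (rule Q)
  assume "\<not> ?thesis"
  then have sub: "P \<subseteq> Q" by blast
  then obtain q where q: "q \<in> Q" "q \<notin> P" using ne by blast
  have q0: "q \<noteq> 0" using q P.zero_mem by blast
  have neg: "ord_at P q < 0" using q q0 P.mem_iff by force
  \<comment> \<open>The powers of q have poles of unbounded order at P, so any f divided by a
    suitable one lies in P; a larger ring Q would therefore be the whole field.\<close>
  have "f \<in> Q" for f
  proof (cases "f = 0")
    case False
    define n where "n = nat \<bar>ord_at P f\<bar>"
    have "int n * ord_at P q \<le> int n * (- 1)" using neg by (intro mult_left_mono) auto
    then have "ord_at P (f / q ^ n) \<ge> 0"
      using False q0 by (simp add: P.ord_divide P.ord_power n_def)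
    then have "f / q ^ n \<in> P" using False q0 P.mem_iff by simp
    then have "f / q ^ n * q ^ n \<in> Q" using sub q Q.mult_mem Q.power_mem by blast
    then show ?thesis using q0 by simp
  qed (simp add: Q.zero_mem)
  then show False using Q.vr by (auto simp: is_vr_def)
qed

lemma separate_two_dvrs:
  assumes P: "is_dvr P" and Q: "is_dvr Q" and ne: "P \<noteq> Q"
  shows "\<exists>f. f \<noteq> 0 \<and> ord_at P f > 0 \<and> ord_at Q f < 0"
proof -
  interpret P: dvr P by unfold_locales (rule P)
  interpret Q: dvr Q by unfold_locales (rule Q)
  obtain f where f: "f \<in> P" "f \<notin> Q" using dvr_not_subset[OF P Q ne] by blast
  obtain g where g: "g \<in> Q" "g \<notin> P" using dvr_not_subset[OF Q P] ne by blast
  have nz: "f \<noteq> 0" "g \<noteq> 0" using f g P.zero_mem Q.zero_mem by auto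
  then have "ord_at P (f / g) > 0" "ord_at Q (f / g) < 0"
    using f g P.mem_iff Q.mem_iff by (auto simp: P.ord_divide Q.ord_divide)
  then show ?thesis using nz by (intro exI[of _ "f / g"]) auto
qed

lemma separate_dvrs:
  assumes "finite S" "is_dvr P" "P \<notin> S" "\<And>Q. Q \<in> S \<Longrightarrow> is_dvr Q"
  shows "\<exists>f. f \<noteq> 0 \<and> ord_at P f > 0 \<and> (\<forall>Q\<in>S. ord_at Q f < 0)"
  using assms
proof (induction S)
  case empty
  interpret P: dvr P by unfold_locales (rule empty)
  obtain t where "t \<noteq> 0" "ord_at P t = 1" by (rule P.obtain_ord_one)
  then show ?case by (intro exI[of _ t]) auto
next
  case (insert Q S)
  interpret P: dvr P by unfold_locales (rule insert)
  obtain f where f: "f \<noteq> 0" "ord_at P f > 0" "\<And>Q. Q \<in> S \<Longrightarrow> ord_at Q f < 0"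
    using insert by blast
  obtain g where g: "g \<noteq> 0" "ord_at P g > 0" "ord_at Q g < 0"
    using separate_two_dvrs[of P Q] insert by blast
  \<comment> \<open>The exponent exceeds all orders of f in absolute value. Where g has a pole, that
    of \<open>g ^ r\<close> outweighs f; elsewhere f has a pole and \<open>g ^ r\<close> has none.
    So no poles cancel in \<open>f + g ^ r\<close>.\<close>
  define r where "r = Suc (\<Sum>Q'\<in>insert Q S. nat \<bar>ord_at Q' f\<bar>)"
  have neg: "f + g ^ r \<noteq> 0 \<and> ord_at Q' (f + g ^ r) < 0" if Q': "Q' \<in> insert Q S" for Q'
  proof -
    interpret Q': dvr Q' by unfold_locales (use insert Q' in blast)
    have "nat \<bar>ord_at Q' f\<bar> \<le> (\<Sum>Q'\<in>insert Q S. nat \<bar>ord_at Q' f\<bar>)"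
      by (rule member_le_sum) (use Q' insert in auto)
    then have "nat \<bar>ord_at Q' f\<bar> < r" unfolding r_def by linarith
    then have r: "\<bar>ord_at Q' f\<bar> < int r" by linarith
    have og: "ord_at Q' (g ^ r) = int r * ord_at Q' g" using g by (simp add: Q'.ord_power)
    consider "ord_at Q' g \<ge> 0" "ord_at Q' f < 0" | "ord_at Q' g < 0"
      using Q' f g by fastforce
    then show ?thesis
    proof cases
      case 1
      then have "0 \<le> int r * ord_at Q' g" by simp
      then have "ord_at Q' f + 1 \<le> ord_at Q' (g ^ r)" using og 1 by linarith
      then have "vge Q' (ord_at Q' f + 1) (g ^ r)" unfolding vge_def ..
      from Q'.ord_add_eq[OF f(1) this] 1 show ?thesis by simp
    next
      case 2
      then have "int r * ord_at Q' g \<le> int r * (- 1)" by (intro mult_left_mono) auto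
      then have lt: "ord_at Q' (g ^ r) < ord_at Q' f" "ord_at Q' (g ^ r) < 0" using og r by linarith+
      then have "vge Q' (ord_at Q' (g ^ r) + 1) f" by (simp add: vge_def)
      from Q'.ord_add_eq[OF _ this] g lt show ?thesis by (simp add: add.commute)
    qed
  qed
  have "vge P 1 f" using f by (simp add: vge_def)
  moreover have "vge P 1 (g ^ r)"
  proof -
    have "int r * 1 \<le> int r * ord_at P g" using g by (intro mult_left_mono) auto
    moreover have "1 \<le> r" by (simp add: r_def)
    moreover have "ord_at P (g ^ r) = int r * ord_at P g" using g by (simp add: P.ord_power)
    ultimately have "1 \<le> ord_at P (g ^ r)" by linarith
    then show ?thesis unfolding vge_def ..
  qed
  ultimately have vge: "vge P 1 (f + g ^ r)" by (rule P.vge_add)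
  have nz: "f + g ^ r \<noteq> 0" using neg[of Q] by blast
  then have "0 < ord_at P (f + g ^ r)" using vge unfolding vge_def by linarith
  with nz neg show ?case by (intro exI[of _ "f + g ^ r"]) blast
qed

text \<open>The function \<open>1 / (1 + f ^ m)\<close> is near 1 where f vanishes and near 0 where
  f has a pole. Taking m = n + 1 keeps m positive, so that \<open>f ^ m\<close> is a nonunit at P
  even for n = 0.\<close>

lemma approximate_indicator:
  assumes "finite S" "is_dvr P" "P \<notin> S" "\<And>Q. Q \<in> S \<Longrightarrow> is_dvr Q"
  shows "\<exists>e. e \<noteq> 0 \<and> ord_at P e = 0 \<and> (\<forall>Q\<in>S. int n \<le> ord_at Q e)"
proof -
  interpret P: dvr P by unfold_locales (rule assms)
  obtain f where f: "f \<noteq> 0" "ord_at P f > 0" "\<And>Q. Q \<in> S \<Longrightarrow> ord_at Q f < 0"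
    using separate_dvrs[OF assms] by blast
  define m where "m = Suc n"
  have "1 \<le> int m * ord_at P f" using f mult_mono[of 1 "int m" 1 "ord_at P f"] by (simp add: m_def)
  then have "vge P (ord_at P 1 + 1) (f ^ m)" using f by (simp add: vge_def P.ord_power)
  from P.ord_add_eq[OF one_neq_zero this]
  have P: "1 + f ^ m \<noteq> 0" "ord_at P (1 + f ^ m) = 0" by simp_all
  have "int n \<le> - ord_at Q (1 + f ^ m)" if Q: "Q \<in> S" for Q
  proof -
    interpret Q: dvr Q by unfold_locales (use assms Q in blast)
    have "int m * ord_at Q f \<le> int m * (- 1)" using f(3)[OF Q] by (intro mult_left_mono) auto
    then have le: "ord_at Q (f ^ m) \<le> - int m" using f by (simp add: Q.ord_power)
    then have "vge Q (ord_at Q (f ^ m) + 1) 1" by (simp add: vge_def m_def)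
    from Q.ord_add_eq(2)[OF _ this] f le show ?thesis by (simp add: add.commute m_def)
  qed
  moreover have "ord_at Q (inverse (1 + f ^ m)) = - ord_at Q (1 + f ^ m)" if "Q \<in> insert P S" for Q
  proof -
    interpret Q: dvr Q by unfold_locales (use assms that in blast)
    show ?thesis by (rule Q.ord_inverse[OF P(1)])
  qed
  ultimately show ?thesis using P by (intro exI[of _ "inverse (1 + f ^ m)"]) auto
qed

lemma points_dvr: "P \<in> points c \<Longrightarrow> is_dvr P"
  by (simp add: points_def)

lemma points_val_ring_over:
  assumes c: "field_embedding c" and P: "P \<in> points c"
  shows "val_ring_over P c"
proof -
  interpret dvr P by unfold_locales (rule points_dvr[OF P])
  show ?thesis by unfold_locales (use c P in \<open>auto simp: points_def\<close>)
qed

text \<open>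
  If t_P is a uniformizer at P, then t_P^j for j below the order of s at P, cut off at the other
  zeros of s, give a family that is linearly independent over k(s).
\<close>

lemma sum_ord_le:
  fixes c :: "'k::alg_closed_field \<Rightarrow> 'a::field"
  assumes c: "field_embedding c" and s: "degree_le c s n" "s \<noteq> 0"
    and S: "finite S" "S \<subseteq> points c" "\<And>P. P \<in> S \<Longrightarrow> 0 < ord_at P s"
  shows "(\<Sum>P\<in>S. ord_at P s) \<le> int n"
proof (rule ccontr)
  assume gt: "\<not> ?thesis"
  have dvr: "is_dvr P" if "P \<in> S" for P using S(2) points_dvr that by blast
  have "\<exists>z. P \<in> S \<longrightarrow> z \<noteq> 0 \<and> ord_at P z = int j \<and> (\<forall>Q\<in>S - {P}. ord_at Q s \<le> ord_at Q z)" for P j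
  proof (cases "P \<in> S")
    case True
    interpret P: dvr P by unfold_locales (rule dvr[OF True])
    obtain t where t: "t \<noteq> 0" "ord_at P t = 1" by (rule P.obtain_ord_one)
    \<comment> \<open>Large enough for e to absorb at the other points both the poles of
      \<open>t ^ j\<close> and the order of s that is to be reached.\<close>
    define N where "N = (\<Sum>Q\<in>S - {P}. nat \<bar>ord_at Q s\<bar> + nat \<bar>ord_at Q (t ^ j)\<bar>)"
    obtain e where e: "e \<noteq> 0" "ord_at P e = 0" "\<And>Q. Q \<in> S - {P} \<Longrightarrow> int N \<le> ord_at Q e"
      using approximate_indicator[of "S - {P}" P N] S(1) dvr True by blast
    have "ord_at Q s \<le> ord_at Q (t ^ j * e)" if Q: "Q \<in> S - {P}" for Q
    proof -
      interpret Q: dvr Q by unfold_locales (use dvr Q in blast)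
      have "nat \<bar>ord_at Q s\<bar> + nat \<bar>ord_at Q (t ^ j)\<bar> \<le> N" unfolding N_def
        by (rule member_le_sum) (use Q S(1) in auto)
      moreover have "ord_at Q (t ^ j * e) = ord_at Q (t ^ j) + ord_at Q e"
        using t e by (simp add: Q.ord_mult)
      ultimately show ?thesis using e(3)[OF Q] by linarith
    qed
    moreover have "ord_at P (t ^ j * e) = int j" using t e by (simp add: P.ord_mult P.ord_power)
    ultimately show ?thesis using t e by (intro exI[of _ "t ^ j * e"]) auto
  qed auto
  then obtain z where z: "\<And>P j. P \<in> S \<Longrightarrow> z P j \<noteq> 0"
      "\<And>P j. P \<in> S \<Longrightarrow> ord_at P (z P j) = int j"
      "\<And>P j Q. P \<in> S \<Longrightarrow> Q \<in> S \<Longrightarrow> Q \<noteq> P \<Longrightarrow> ord_at Q s \<le> ord_at Q (z P j)"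
    by (metis DiffI singletonD)
  define I where "I = (SIGMA P:S. {..<nat (ord_at P s)})"
  have "int (card I) = (\<Sum>P\<in>S. ord_at P s)"
    using S(1) S(3) by (simp add: I_def less_imp_le)
  then have "Suc n \<le> card I" using gt by linarith
  then obtain I' where I': "I' \<subseteq> I" "card I' = Suc n" "finite I'"
    using obtain_subset_with_card_n by metis
  then obtain e where e: "bij_betw e {..<Suc n} I'"
    using ex_bij_betw_nat_finite[of I'] by (metis atLeast0LessThan)
  have eI: "fst (e i) \<in> S" "snd (e i) < nat (ord_at (fst (e i)) s)" if "i \<le> n" for i
  proof -
    have "e i \<in> I" using e I'(1) that by (auto simp: bij_betw_def)
    then show "fst (e i) \<in> S" "snd (e i) < nat (ord_at (fst (e i)) s)" by (auto simp: I_def)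
  qed
  have inj: "i = j" if "i \<le> n" "j \<le> n" "e i = e j" for i j
    using e that by (auto simp: bij_betw_def inj_on_def)
  define y where "y = (\<lambda>i. z (fst (e i)) (snd (e i)))"
  obtain q i0 where q: "i0 \<le> n" "poly (q i0) 0 \<noteq> 0" "(\<Sum>i\<le>n. pev c (q i) s * y i) = 0"
    using degree_le_primitive[OF c s, of y] by blast
  \<comment> \<open>The sum is examined at the point P of an index whose coefficient has nonzero
    constant term; among such indices at P the one of least exponent dominates. The remaining terms
    have at least the order of s, because they belong to another point or have a coefficient
    divisible by s, or they have a strictly larger exponent.\<close>
  define P where "P = fst (e i0)"
  have PS: "P \<in> S" using eI q(1) by (simp add: P_def)
  interpret P: dvr P by unfold_locales (rule dvr[OF PS])
  interpret P': val_ring_over P c by (rule points_val_ring_over[OF c]) (use PS S in blast)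
  have sP: "s \<in> nonunits P" using S(3)[OF PS] s P.nonunits_iff by simp
  define J where "J = {i. i \<le> n \<and> poly (q i) 0 \<noteq> 0 \<and> fst (e i) = P}"
  have "finite J" "J \<noteq> {}" using q by (auto simp: J_def P_def)
  then have "\<exists>j\<in>J. \<forall>i\<in>J. snd (e j) \<le> snd (e i)"
    using arg_min_if_finite[of J "\<lambda>i. snd (e i)"] by (metis not_le_imp_less)
  then obtain j where j: "j \<in> J" "\<And>i. i \<in> J \<Longrightarrow> snd (e j) \<le> snd (e i)" by blast
  then have jn: "j \<le> n" and jq: "poly (q j) 0 \<noteq> 0" and jP: "fst (e j) = P" by (auto simp: J_def)
  note unit = P'.pev_unit[OF sP jq]
  have fj: "pev c (q j) s * y j \<noteq> 0" using unit z(1)[OF PS] by (simp add: y_def jP)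
  have "ord_at P (pev c (q j) s) = 0"
    using unit P.nonunits_iff P.mem_iff[of "inverse (pev c (q j) s)"] P.mem_iff[of "pev c (q j) s"]
      P'.pev_mem[OF P.nonunits_mem[OF sP]] by force
  then have ordj: "ord_at P (pev c (q j) s * y j) = int (snd (e j))"
    using unit z(1,2)[OF PS] by (simp add: y_def jP P.ord_mult)
  have j_less: "int (snd (e j)) < ord_at P s" using eI(2)[OF jn] by (simp add: jP)
  have "(\<Sum>i\<le>n. pev c (q i) s * y i) \<noteq> 0"
  proof (rule P.dominated_sum_nonzero[where j = j])
    fix i assume i: "i \<in> {..n}" "i \<noteq> j"
    show "pev c (q i) s * y i / (pev c (q j) s * y j) \<in> nonunits P"
    proof (cases "pev c (q i) s = 0")
      case False
      have iS: "fst (e i) \<in> S" using eI i by simp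
      have yi: "y i \<noteq> 0" using z(1)[OF iS] by (simp add: y_def)
      have pi: "0 \<le> ord_at P (pev c (q i) s)"
        using P'.pev_mem[OF P.nonunits_mem[OF sP]] P.mem_iff False by blast
      have "int (snd (e j)) < ord_at P (pev c (q i) s) + ord_at P (y i)"
      proof (cases "fst (e i) = P")
        case False
        then have "ord_at P s \<le> ord_at P (y i)" using z(3)[OF iS PS] by (simp add: y_def)
        then show ?thesis using pi j_less by linarith
      next
        case True
        then have yo: "ord_at P (y i) = int (snd (e i))" using z(2)[OF PS] by (simp add: y_def)
        show ?thesis
        proof (cases "poly (q i) 0 = 0")
          case True
          then obtain r where r: "q i = pCons 0 r" by (cases "q i" rule: pCons_cases) auto
          then have sr: "pev c (q i) s = s * pev c r s"
            by (simp add: pev_pCons[OF c] field_embedding_0[OF c])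
          then have r0: "pev c r s \<noteq> 0" using False by auto
          then have "0 \<le> ord_at P (pev c r s)"
            using P'.pev_mem[OF P.nonunits_mem[OF sP]] P.mem_iff by blast
          then have "ord_at P s \<le> ord_at P (pev c (q i) s)"
            unfolding sr using s(2) r0 by (simp add: P.ord_mult)
          then show ?thesis using j_less yo by linarith
        next
          case False
          then have "snd (e j) \<le> snd (e i)" using j(2) i True by (simp add: J_def)
          moreover have "snd (e j) \<noteq> snd (e i)"
            using inj[of i j] i jn jP True by (auto simp: prod_eq_iff)
          ultimately show ?thesis using yo pi by linarith
        qed
      qed
      then show ?thesis using False yi fj ordj
        by (subst P.nonunits_iff) (simp_all add: P.ord_divide P.ord_mult)
    qed (simp add: P.zero_nonunit)
  qed (use jn fj in auto)
  then show False using q(3) by simp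
qed

section \<open>The genus of a double cover of the line\<close>

lemma divisor_degree_superset:
  assumes "finite T" "{P. D P \<noteq> 0} \<subseteq> T"
  shows "divisor_degree D = (\<Sum>P\<in>T. D P)"
  unfolding divisor_degree_def by (rule sum.mono_neutral_left) (use assms in auto)

definition zero_divisor :: "('k::field \<Rightarrow> 'a::field) \<Rightarrow> 'a \<Rightarrow> 'a set \<Rightarrow> int" where
  "zero_divisor c s P = (if P \<in> points c then max 0 (ord_at P s) else 0)"

lemma zero_divisor_nonneg: "0 \<le> zero_divisor c s P"
  by (simp add: zero_divisor_def)

lemma ord_le_zero_divisor: "P \<in> points c \<Longrightarrow> ord_at P s \<le> zero_divisor c s P"
  by (simp add: zero_divisor_def)

lemma zero_divisor_bound:
  fixes c :: "'k::alg_closed_field \<Rightarrow> 'a::field"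
  assumes c: "field_embedding c" and s: "degree_le c s n" "s \<noteq> 0"
  shows "zero_divisor c s \<in> divisors c" "divisor_degree (zero_divisor c s) \<le> int n"
proof -
  define S where "S = {P. zero_divisor c s P \<noteq> 0}"
  have S: "P \<in> points c" "0 < ord_at P s" "zero_divisor c s P = ord_at P s" if "P \<in> S" for P
    using that by (auto simp: S_def zero_divisor_def split: if_splits)
  have bound: "(\<Sum>P\<in>T. ord_at P s) \<le> int n" if "finite T" "T \<subseteq> S" for T
    by (rule sum_ord_le[OF c s]) (use S that in auto)
  \<comment> \<open>Each zero contributes at least 1, so n + 1 of them would already exceed the
    bound.\<close>
  have fin: "finite S"
  proof (rule ccontr)
    assume "infinite S"
    then obtain T where T: "T \<subseteq> S" "finite T" "card T = Suc n"
      using infinite_arbitrarily_large by blast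
    have "int (card T) = (\<Sum>P\<in>T. 1)" by simp
    also have "\<dots> \<le> (\<Sum>P\<in>T. ord_at P s)"
    proof (rule sum_mono)
      fix P assume "P \<in> T"
      then show "1 \<le> ord_at P s" using S(2)[of P] T(1) by auto
    qed
    finally have "int (Suc n) \<le> int n" using bound[OF T(2,1)] unfolding T(3) by (rule order.trans)
    then show False by simp
  qed
  show "zero_divisor c s \<in> divisors c"
    unfolding divisors_def mem_Collect_eq S_def[symmetric] using fin S(1) by blast
  have "divisor_degree (zero_divisor c s) = (\<Sum>P\<in>S. ord_at P s)"
    unfolding divisor_degree_def S_def[symmetric] by (rule sum.cong[OF refl S(3)])
  then show "divisor_degree (zero_divisor c s) \<le> int n" using bound[OF fin] by simp
qed

lemma sum_lessThan_add:
  fixes f :: "nat \<Rightarrow> 'a::comm_monoid_add"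
  shows "(\<Sum>i<m + n. f i) = (\<Sum>i<m. f i) + (\<Sum>i<n. f (m + i))"
  by (induction n) (simp_all add: add.assoc)

section \<open>Riemann-Roch spaces\<close>

locale function_field =
  fixes c :: "'k::alg_closed_field \<Rightarrow> 'a::field" and u :: 'a and n :: nat
  assumes c: "field_embedding c" and u: "transcendental c u" "degree_le c u n"
begin

sublocale vs: vector_space "\<lambda>a f. c a * f"
  by (rule vector_space_field_embedding[OF c])

abbreviation L :: "('a set \<Rightarrow> int) \<Rightarrow> 'a set" where
  "L \<equiv> riemann_roch_space c"

lemma L_iff: "f \<in> L D \<longleftrightarrow> (\<forall>P\<in>points c. vge P (- D P) f)"
  by (auto simp: riemann_roch_space_def vge_def)

lemma points_dvr_locale: "P \<in> points c \<Longrightarrow> dvr P"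
  by (simp add: dvr.intro points_dvr)

lemma vge_const:
  assumes P: "P \<in> points c"
  shows "vge P 0 (c a)"
proof -
  interpret dvr P by (rule points_dvr_locale[OF P])
  show ?thesis using P by (auto simp: vge_iff_mem points_def)
qed

lemma L_subspace: "vs.subspace (L D)"
proof (rule vs.subspaceI)
  show "0 \<in> L D" by (simp add: riemann_roch_space_def)
  show "x + y \<in> L D" if "x \<in> L D" "y \<in> L D" for x y
    using that dvr.vge_add[OF points_dvr_locale] by (auto simp: L_iff)
  show "c a * x \<in> L D" if "x \<in> L D" for a x
    using that dvr.vge_mult[OF points_dvr_locale vge_const] by (fastforce simp: L_iff)
qed

lemma L_zero: "L (\<lambda>_. 0) \<subseteq> range c"
proof
  fix f assume f: "f \<in> L (\<lambda>_. 0)"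
  then have "f \<in> P" if "P \<in> points c" for P
    using that dvr.vge_iff_mem[OF points_dvr_locale] by (fastforce simp: L_iff)
  then show "f \<in> range c" using exists_pole[OF c u] by blast
qed

lemma residue_at_point:
  assumes P: "P \<in> points c" and f: "f \<in> P"
  shows "\<exists>a. vge P 1 (f - c a)"
proof -
  interpret dvr P by (rule points_dvr_locale[OF P])
  interpret val_ring_over P c by (rule points_val_ring_over[OF c P])
  obtain s where "s \<in> nonunits P" "s \<noteq> 0" "degree_le c s n" using center_on_line[OF u] by blast
  then show ?thesis using residue_const[OF _ _ _ f] by (simp add: vge_iff_nonunit)
qed

text \<open>L(D) modulo L(D - P) is at most one-dimensional: if w has the extreme order permitted at
  P, then f/w is regular there, and its value, a constant because the residue field is k, is the
  coefficient to subtract. If no such w exists, 0 serves.\<close>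

lemma L_step:
  assumes P: "P \<in> points c"
  shows "\<exists>w. \<forall>f\<in>L D. \<exists>a. f - c a * w \<in> L (D(P := D P - 1))"
proof (cases "L D \<subseteq> L (D(P := D P - 1))")
  case True
  then show ?thesis by (intro exI[of _ 0]) auto
next
  case False
  interpret dvr P by (rule points_dvr_locale[OF P])
  obtain w where w: "w \<in> L D" "w \<notin> L (D(P := D P - 1))" using False by blast
  have wP: "vge P (- D P) w" using w P by (simp add: L_iff)
  have "\<not> vge P (1 - D P) w" using w by (auto simp: L_iff fun_upd_def split: if_splits)
  with wP have w0: "w \<noteq> 0" "ord_at P w = - D P" by (auto simp: vge_def)
  have "\<exists>a. f - c a * w \<in> L (D(P := D P - 1))" if f: "f \<in> L D" for f
  proof -
    have "vge P (- D P) f" using f P by (simp add: L_iff)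
    moreover have "vge P (D P) (inverse w)" using w0 by (simp add: vge_def ord_inverse)
    ultimately have "vge P 0 (f * inverse w)" using vge_mult by fastforce
    then obtain a where "vge P 1 (f * inverse w - c a)"
      using residue_at_point[OF P] vge_iff_mem by blast
    from vge_mult[OF this wP] have *: "vge P (1 - D P) (f - c a * w)"
      using w0(1) by (simp add: left_diff_distrib mult.assoc)
    have "c a * w \<in> L D" by (rule vs.subspace_scale[OF L_subspace w(1)])
    then have "f - c a * w \<in> L D" by (rule vs.subspace_diff[OF L_subspace f])
    with * have "f - c a * w \<in> L (D(P := D P - 1))" by (auto simp: L_iff)
    then show ?thesis ..
  qed
  then show ?thesis by blast
qed

text \<open>The descent from D' to D proceeds one point at a time and costs at most one generator
  per step.\<close>

lemma L_mono_span:
  assumes T: "finite T" "T \<subseteq> points c"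
    and le: "\<And>P. D P \<le> D' P" "\<And>P. P \<notin> T \<Longrightarrow> D' P = D P"
  shows "\<exists>S. finite S \<and> int (card S) \<le> (\<Sum>P\<in>T. D' P - D P) \<and> L D' \<subseteq> vs.span (L D \<union> S)"
  using le
proof (induction "nat (\<Sum>P\<in>T. D' P - D P)" arbitrary: D')
  case 0
  have "0 \<le> (\<Sum>P\<in>T. D' P - D P)" using 0 by (intro sum_nonneg) simp
  then have "(\<Sum>P\<in>T. D' P - D P) = 0" using 0(1) by simp
  then have "\<forall>P\<in>T. D' P - D P = 0" using T 0(2) by (subst (asm) sum_nonneg_eq_0_iff) auto
  then have "D' = D" using 0(3) by fastforce
  then show ?case using T by (intro exI[of _ "{}"]) (auto intro: vs.span_base)
next
  case (Suc N)
  have "(\<Sum>P\<in>T. D' P - D P) \<noteq> 0" using Suc(2) by linarith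
  then obtain P where P: "P \<in> T" "D' P - D P \<noteq> 0" by (meson sum.neutral)
  define D'' where "D'' = D'(P := D' P - 1)"
  have eq: "(\<Sum>Q\<in>T. D'' Q - D Q) = (\<Sum>Q\<in>T. D' Q - D Q) - 1"
    using T(1) P(1) by (simp add: D''_def sum.remove[of T P])
  have "N = nat (\<Sum>Q\<in>T. D'' Q - D Q)" using Suc(2) eq by linarith
  moreover have "D Q \<le> D'' Q" for Q using Suc(3)[of Q] P(2) by (auto simp: D''_def)
  moreover have "D'' Q = D Q" if "Q \<notin> T" for Q using Suc(4) that P(1) by (auto simp: D''_def)
  ultimately obtain S where S: "finite S" "int (card S) \<le> (\<Sum>P\<in>T. D'' P - D P)"
      "L D'' \<subseteq> vs.span (L D \<union> S)"
    using Suc(1)[of D''] by blast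
  obtain w where w: "\<And>f. f \<in> L D' \<Longrightarrow> \<exists>a. f - c a * w \<in> L D''"
    using L_step[of P D'] P(1) T(2) unfolding D''_def by blast
  have "L D' \<subseteq> vs.span (L D \<union> insert w S)"
  proof
    fix f assume "f \<in> L D'"
    then obtain a where "f - c a * w \<in> L D''" using w by blast
    then have "f - c a * w \<in> vs.span (L D \<union> insert w S)"
      using S(3) vs.span_mono[of "L D \<union> S" "L D \<union> insert w S"] by blast
    moreover have "c a * w \<in> vs.span (L D \<union> insert w S)"
      by (intro vs.span_scale vs.span_base) simp
    ultimately have "(f - c a * w) + c a * w \<in> vs.span (L D \<union> insert w S)" by (rule vs.span_add)
    then show "f \<in> vs.span (L D \<union> insert w S)" by simp
  qed
  moreover have "int (card (insert w S)) \<le> (\<Sum>P\<in>T. D' P - D P)"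
    using S(2) eq card_insert_le_m1[of "Suc (card S)" S w] by (simp add: card_insert_if split: if_splits)
  ultimately show ?case using S(1) by blast
qed

text \<open>\<open>dim\<close> takes the value 0 on infinite-dimensional spaces, so
  \<open>l_dim\<close> is meaningful only once finiteness is known. It follows by comparing the
  positive part of D with the zero divisor, whose space consists of constants.\<close>

lemma L_finite_basis:
  assumes D: "D \<in> divisors c"
  obtains B where "finite B" "L D \<subseteq> vs.span B" "card B = l_dim c D"
proof -
  define T where "T = {P. D P \<noteq> 0}"
  have T: "finite T" "T \<subseteq> points c" using D by (auto simp: divisors_def T_def)
  have "\<exists>S. finite S \<and> int (card S) \<le> (\<Sum>P\<in>T. max 0 (D P) - 0) \<and>
      L (\<lambda>P. max 0 (D P)) \<subseteq> vs.span (L (\<lambda>_. 0) \<union> S)"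
    by (rule L_mono_span[OF T]) (auto simp: T_def)
  then obtain S where S: "finite S" "L (\<lambda>P. max 0 (D P)) \<subseteq> vs.span (L (\<lambda>_. 0) \<union> S)"
    by blast
  have "L D \<subseteq> L (\<lambda>P. max 0 (D P))"
  proof
    fix f assume f: "f \<in> L D"
    have "vge P (- max 0 (D P)) f" if "P \<in> points c" for P
      by (rule dvr.vge_mono[OF points_dvr_locale[OF that], of "- D P"]) (use f that in \<open>auto simp: L_iff\<close>)
    then show "f \<in> L (\<lambda>P. max 0 (D P))" by (simp add: L_iff)
  qed
  moreover have "L (\<lambda>_. 0) \<union> S \<subseteq> vs.span (insert 1 S)"
  proof -
    have "c a * 1 \<in> vs.span (insert 1 S)" for a by (intro vs.span_scale vs.span_base) simp
    then show ?thesis using L_zero by (auto intro: vs.span_base)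
  qed
  then have "vs.span (L (\<lambda>_. 0) \<union> S) \<subseteq> vs.span (insert 1 S)"
    by (rule vs.span_minimal) (rule vs.subspace_span)
  ultimately have sub: "L D \<subseteq> vs.span (insert 1 S)" using S(2) by blast
  obtain B where B: "B \<subseteq> L D" "vs.independent B" "L D \<subseteq> vs.span B" "card B = vs.dim (L D)"
    by (rule vs.basis_exists)
  have "finite B" using vs.independent_span_bound[of "insert 1 S" B] B sub S(1) by auto
  then show thesis using that[of B] B(3,4) by (simp add: l_dim_def)
qed

text \<open>Adding a point raises the degree by one and the dimension by at most one. Hence, in
  bounding the supremum that defines the genus, any D may be replaced by a larger divisor.\<close>

lemma degree_minus_l_dim_mono:
  assumes D: "D \<in> divisors c" and D': "D' \<in> divisors c" and le: "\<And>P. D P \<le> D' P"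
  shows "divisor_degree D - int (l_dim c D) \<le> divisor_degree D' - int (l_dim c D')"
proof -
  define T where "T = {P. D P \<noteq> 0} \<union> {P. D' P \<noteq> 0}"
  have T: "finite T" "T \<subseteq> points c" using D D' by (auto simp: divisors_def T_def)
  have deg: "divisor_degree D = (\<Sum>P\<in>T. D P)" "divisor_degree D' = (\<Sum>P\<in>T. D' P)"
    by (rule divisor_degree_superset; use T in \<open>auto simp: T_def\<close>)+
  have "\<exists>S. finite S \<and> int (card S) \<le> (\<Sum>P\<in>T. D' P - D P) \<and> L D' \<subseteq> vs.span (L D \<union> S)"
    by (rule L_mono_span[OF T le]) (auto simp: T_def)
  then obtain S where S: "finite S" "int (card S) \<le> (\<Sum>P\<in>T. D' P - D P)"
      "L D' \<subseteq> vs.span (L D \<union> S)" by blast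
  obtain B where B: "finite B" "L D \<subseteq> vs.span B" "card B = l_dim c D" using L_finite_basis[OF D] .
  have "L D \<union> S \<subseteq> vs.span (B \<union> S)"
    using B(2) vs.span_mono[of B "B \<union> S"] by (auto intro: vs.span_base)
  then have "vs.span (L D \<union> S) \<subseteq> vs.span (B \<union> S)"
    by (rule vs.span_minimal) (rule vs.subspace_span)
  then have "L D' \<subseteq> vs.span (B \<union> S)" using S(3) by blast
  then have "l_dim c D' \<le> card (B \<union> S)" unfolding l_dim_def
    by (rule vs.dim_le_card) (use B S in simp)
  also have "\<dots> \<le> l_dim c D + card S" using card_Un_le[of B S] B by simp
  finally have "int (l_dim c D') \<le> int (l_dim c D) + (\<Sum>P\<in>T. D' P - D P)" using S(2) by linarith
  then show ?thesis by (simp add: deg sum_subtractf)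
qed

lemma l_dim_ge:
  fixes z :: "nat \<Rightarrow> 'a"
  assumes D: "D \<in> divisors c" and z: "\<And>i. i < m \<Longrightarrow> z i \<in> L D"
    and ind: "\<And>\<beta> i. (\<Sum>i<m. c (\<beta> i) * z i) = 0 \<Longrightarrow> i < m \<Longrightarrow> \<beta> i = 0"
  shows "m \<le> l_dim c D"
proof (rule ccontr)
  assume lt: "\<not> ?thesis"
  then obtain k where k: "m = Suc k" by (cases m) auto
  obtain B where B: "finite B" "L D \<subseteq> vs.span B" "card B = l_dim c D" using L_finite_basis[OF D] .
  obtain \<beta> i where "i \<le> k" "\<beta> i \<noteq> 0" "(\<Sum>i\<le>k. c (\<beta> i) * z i) = 0"
  proof (rule vs.family_dependent[of B k z])
    show "finite B" "card B \<le> k" using B lt k by auto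
    show "z i \<in> vs.span B" if "i \<le> k" for i using z[of i] B(2) that k by auto
  qed
  then show False using ind[of \<beta> i] k by (simp add: lessThan_Suc_atMost)
qed

end

text \<open>
  Let H be the M-th power of a product of k linear factors u - a.  The functions u^i / H and
  u^i x / H with i at most M + M k are independent and lie in L(D'), where D' is at most
  (2 M + m + 2 M k) in degree and dominates any given divisor once M is large; hence
  deg D' - l(D') is at most m - 2.  Only the upper bounds 2, 2 and m for the degrees of the zero
  divisors of 1/u, u - a and 1/x are needed, so that principal divisors having degree 0
  never enters.
\<close>

lemma genus_le_double_cover:
  fixes c :: "'k::alg_closed_field \<Rightarrow> 'a::field"
  assumes c: "field_embedding c" and u: "transcendental c u" "degree_le c u 2"
    and x: "transcendental c x" "degree_le c x m"
    and ind: "\<And>A B. pev c A u + pev c B u * x = 0 \<Longrightarrow> A = 0 \<and> B = 0"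
  shows "genus c \<le> int m - 1"
  unfolding genus_def
proof (rule cSUP_least)
  interpret function_field c u 2 by unfold_locales (fact c u)+
  show "divisors c \<noteq> {}" by (auto simp: divisors_def intro!: exI[of _ "\<lambda>_. 0"])
  fix D assume D: "D \<in> divisors c"
  define S where "S = {P. D P \<noteq> 0}"
  have S: "finite S" "S \<subseteq> points c" using D by (auto simp: divisors_def S_def)
  have nonconst: "u \<noteq> c a" for a using transcendental_nonconst[OF c u(1)] by blast
  then have ua: "u - c a \<noteq> 0" for a by simp
  have u0: "u \<noteq> 0" using nonconst[of 0] by (simp add: field_embedding_0[OF c])
  have x0: "x \<noteq> 0" using transcendental_nonconst[OF c x(1)] field_embedding_0[OF c] by (metis rangeI)
  \<comment> \<open>\<open>res P\<close> is the value of u at a point P of the support of D. At a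
    pole of u it is arbitrary, which merely adds a harmless factor to H.\<close>
  have "\<exists>a. P \<in> S \<and> u \<in> P \<longrightarrow> vge P 1 (u - c a)" for P
    using residue_at_point[of P u] S(2) by blast
  then obtain res where res: "\<And>P. P \<in> S \<Longrightarrow> u \<in> P \<Longrightarrow> vge P 1 (u - c (res P))" by metis
  define E where "E = res ` S"
  define k where "k = card E"
  define M where "M = nat (\<Sum>P\<in>S. \<bar>D P\<bar>)"
  have DM: "D P \<le> int M" for P
  proof (cases "P \<in> S")
    case True
    then have "\<bar>D P\<bar> \<le> (\<Sum>P\<in>S. \<bar>D P\<bar>)" using S(1) by (intro member_le_sum) auto
    then show ?thesis by (simp add: M_def)
  qed (simp add: S_def)
  define H where "H = (\<Prod>a\<in>E. (u - c a)) ^ M"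
  have finE: "finite E" using S(1) by (simp add: E_def)
  have H0: "H \<noteq> 0" using finE ua by (simp add: H_def)
  define A where "A = zero_divisor c (inverse u)"
  define B where "B = zero_divisor c (inverse x)"
  define Z where "Z = (\<lambda>a. zero_divisor c (u - c a))"
  have A: "A \<in> divisors c" "divisor_degree A \<le> 2"
    using zero_divisor_bound[OF c degree_le_inverse[OF c u]] u0 by (auto simp: A_def)
  have B: "B \<in> divisors c" "divisor_degree B \<le> int m"
    using zero_divisor_bound[OF c degree_le_inverse[OF c x]] x0 by (auto simp: B_def)
  have Z: "Z a \<in> divisors c" "divisor_degree (Z a) \<le> 2" for a
    using zero_divisor_bound[OF c degree_le_minus[OF c u(2)] ua] by (auto simp: Z_def)
  have nonneg: "0 \<le> A P" "0 \<le> B P" "0 \<le> Z a P" for P a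
    by (simp_all add: A_def B_def Z_def zero_divisor_nonneg)
  define D' where "D' = (\<lambda>P. int M * A P + B P + int M * (\<Sum>a\<in>E. Z a P))"
  define T where "T = {P. A P \<noteq> 0} \<union> {P. B P \<noteq> 0} \<union> (\<Union>a\<in>E. {P. Z a P \<noteq> 0})"
  have T: "finite T" "T \<subseteq> points c"
    using A(1) B(1) Z(1) finE by (auto simp: T_def divisors_def)
  have D'0: "D' P = 0" if "P \<notin> T" for P using that by (auto simp: D'_def T_def)
  then have suppT: "{P. D' P \<noteq> 0} \<subseteq> T" by blast
  then have D': "D' \<in> divisors c"
    using T finite_subset[OF suppT] by (auto simp: divisors_def)
  have "divisor_degree D' = (\<Sum>P\<in>T. D' P)" by (rule divisor_degree_superset[OF T(1) suppT])
  also have "\<dots> = int M * (\<Sum>P\<in>T. A P) + (\<Sum>P\<in>T. B P) + int M * (\<Sum>a\<in>E. \<Sum>P\<in>T. Z a P)"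
    unfolding D'_def by (simp add: sum.distrib sum_distrib_left[symmetric] sum.swap[of _ T E])
  also have "(\<Sum>P\<in>T. A P) = divisor_degree A"
    by (rule divisor_degree_superset[symmetric, OF T(1)]) (auto simp: T_def)
  also have "(\<Sum>P\<in>T. B P) = divisor_degree B"
    by (rule divisor_degree_superset[symmetric, OF T(1)]) (auto simp: T_def)
  also have "(\<Sum>a\<in>E. \<Sum>P\<in>T. Z a P) = (\<Sum>a\<in>E. divisor_degree (Z a))"
    by (rule sum.cong[OF refl], rule divisor_degree_superset[symmetric, OF T(1)]) (auto simp: T_def)
  also have "int M * divisor_degree A + divisor_degree B + int M * (\<Sum>a\<in>E. divisor_degree (Z a))
      \<le> int M * 2 + int m + int M * (int k * 2)"
    using A(2) B(2) sum_bounded_above[of E "\<lambda>a. divisor_degree (Z a)" 2] Z(2)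
    by (intro add_mono mult_left_mono) (auto simp: k_def)
  finally have degD': "divisor_degree D' \<le> 2 * int M + int m + 2 * int M * int k" by simp
  have le: "D P \<le> D' P" for P
  proof (cases "P \<in> S")
    case True
    then have P: "P \<in> points c" using S(2) by blast
    interpret P: dvr P by (rule points_dvr_locale[OF P])
    show ?thesis
    proof (cases "u \<in> P")
      case uP: True
      have "1 \<le> Z (res P) P"
        using res[OF True uP] ua[of "res P"] ord_le_zero_divisor[OF P, of "u - c (res P)"]
        by (simp add: vge_def Z_def)
      also have "\<dots> \<le> (\<Sum>a\<in>E. Z a P)"
        by (rule member_le_sum) (use True finE nonneg in \<open>auto simp: E_def\<close>)
      finally have "int M * 1 \<le> int M * (\<Sum>a\<in>E. Z a P)" by (intro mult_left_mono) auto
      moreover have "0 \<le> int M * A P" using nonneg by simp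
      ultimately show ?thesis using DM[of P] nonneg(2)[of P] by (simp add: D'_def)
    next
      case False
      then have "1 \<le> ord_at P (inverse u)" using u0 P.mem_iff[OF u0] by (simp add: P.ord_inverse)
      then have "1 \<le> A P" using ord_le_zero_divisor[OF P, of "inverse u"] by (simp add: A_def)
      then have "int M * 1 \<le> int M * A P" by (intro mult_left_mono) auto
      moreover have "0 \<le> int M * (\<Sum>a\<in>E. Z a P)" using nonneg by (simp add: sum_nonneg)
      ultimately show ?thesis using DM[of P] nonneg(2)[of P] by (simp add: D'_def)
    qed
  next
    case False
    have "0 \<le> D' P" unfolding D'_def using nonneg by (intro add_nonneg_nonneg mult_nonneg_nonneg sum_nonneg) auto
    with False show ?thesis by (simp add: S_def)
  qed
  \<comment> \<open>At a pole of u the function \<open>u ^ i / H\<close> has order i - M k times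
    that of u; its pole is within the allowance M A exactly as long as i <= M + M k.\<close>
  define K where "K = Suc (M + M * k)"
  define z where "z = (\<lambda>i. if i < K then u ^ i / H else u ^ (i - K) * x / H)"
  \<comment> \<open>The slack \<open>B P\<close> is what multiplication by x uses up at the poles of
    x.\<close>
  have vge_z: "vge P (B P - D' P) (u ^ i / H)" if P: "P \<in> points c" and i: "i < K" for P i
  proof -
    interpret P: dvr P by (rule points_dvr_locale[OF P])
    have prod0: "(\<Prod>a\<in>E. u - c a) \<noteq> 0" using finE ua by simp
    have "ord_at P (\<Prod>a\<in>E'. u - c a) = (\<Sum>a\<in>E'. ord_at P (u - c a))" if "finite E'" for E'
      using that by (induction E') (use ua in \<open>auto simp: P.ord_mult\<close>)
    then have ordH: "ord_at P H = int M * (\<Sum>a\<in>E. ord_at P (u - c a))"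
      unfolding H_def using prod0 finE by (simp add: P.ord_power)
    have ord: "ord_at P (u ^ i / H) = int i * ord_at P u - int M * (\<Sum>a\<in>E. ord_at P (u - c a))"
      using u0 H0 by (simp add: P.ord_divide P.ord_power ordH)
    show ?thesis
    proof (cases "u \<in> P")
      case True
      have "(\<Sum>a\<in>E. ord_at P (u - c a)) \<le> (\<Sum>a\<in>E. Z a P)"
        by (rule sum_mono) (simp add: Z_def ord_le_zero_divisor[OF P])
      then have "int M * (\<Sum>a\<in>E. ord_at P (u - c a)) \<le> int M * (\<Sum>a\<in>E. Z a P)"
        by (intro mult_left_mono) auto
      moreover have "0 \<le> int i * ord_at P u" using True P.mem_iff[OF u0] by simp
      moreover have "0 \<le> int M * A P" using nonneg by simp
      ultimately show ?thesis unfolding vge_def ord D'_def by linarith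
    next
      case False
      then have neg: "ord_at P u < 0" using P.mem_iff[OF u0] by simp
      have "ord_at P (u - c a) = ord_at P u" for a
      proof -
        have "vge P 0 (- c a)" by (rule P.vge_uminus[OF vge_const[OF P]])
        then have "vge P (ord_at P u + 1) (- c a)" by (rule P.vge_mono) (use neg in simp)
        from P.ord_add_eq(2)[OF u0 this] show ?thesis by simp
      qed
      then have "ord_at P (u ^ i / H) = (int i - int M * int k) * ord_at P u"
        unfolding ord by (simp add: k_def algebra_simps)
      moreover have "int M * ord_at P u \<le> (int i - int M * int k) * ord_at P u"
        using neg i by (intro mult_right_mono_neg) (auto simp: K_def zero_le_mult_iff algebra_simps simp flip: of_nat_mult of_nat_add)
      moreover have "- ord_at P u \<le> A P"
        using ord_le_zero_divisor[OF P, of "inverse u"] u0 by (simp add: A_def P.ord_inverse)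
      then have "int M * (- ord_at P u) \<le> int M * A P" by (intro mult_left_mono) auto
      moreover have "0 \<le> int M * (\<Sum>a\<in>E. Z a P)" using nonneg by (simp add: sum_nonneg)
      ultimately show ?thesis unfolding vge_def D'_def by linarith
    qed
  qed
  have "K + K \<le> l_dim c D'"
  proof (rule l_dim_ge[OF D', where z = z])
    fix i assume i: "i < K + K"
    show "z i \<in> L D'"
      unfolding L_iff
    proof
      fix P assume P: "P \<in> points c"
      interpret P: dvr P by (rule points_dvr_locale[OF P])
      show "vge P (- D' P) (z i)"
      proof (cases "i < K")
        case True
        then show ?thesis using P.vge_mono[OF vge_z[OF P True]] nonneg(2)[of P] by (simp add: z_def)
      next
        case False
        have "- ord_at P x \<le> B P"
          using ord_le_zero_divisor[OF P, of "inverse x"] x0 by (simp add: B_def P.ord_inverse)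
        then have "vge P (- B P) x" by (simp add: vge_def)
        from P.vge_mult[OF this vge_z[OF P, of "i - K"]] show ?thesis
          using False i by (simp add: z_def mult.commute)
      qed
    qed
  next
    fix \<beta> :: "nat \<Rightarrow> 'k" and i
    assume 0: "(\<Sum>i<K + K. c (\<beta> i) * z i) = 0" and i: "i < K + K"
    define p where "p = (\<Sum>i<K. monom (\<beta> i) i)"
    define q where "q = (\<Sum>i<K. monom (\<beta> (K + i)) i)"
    have "(\<Sum>i<K + K. c (\<beta> i) * z i) = (\<Sum>i<K. c (\<beta> i) * z i) + (\<Sum>i<K. c (\<beta> (K + i)) * z (K + i))"
      by (rule sum_lessThan_add)
    also have "\<dots> = (pev c p u + pev c q u * x) / H"
      by (simp add: z_def p_def q_def pev_sum[OF c] pev_monom[OF c] add_divide_distrib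
          sum_divide_distrib sum_distrib_right mult.assoc)
    finally have "pev c p u + pev c q u * x = 0" using 0 H0 by simp
    then have "p = 0" "q = 0" using ind by blast+
    moreover have "coeff p j = \<beta> j" "coeff q j = \<beta> (K + j)" if "j < K" for j
      using that by (simp_all add: p_def q_def coeff_sum sum.delta' cong: if_cong)
    ultimately have *: "\<beta> j = 0" "\<beta> (K + j) = 0" if "j < K" for j using that by auto
    show "\<beta> i = 0"
    proof (cases "i < K")
      case False
      then show ?thesis using *(2)[of "i - K"] i by simp
    qed (use *(1) in simp)
  qed
  then have "2 * int M + 2 * int M * int k + 2 \<le> int (l_dim c D')"
  proof -
    have "int (K + K) \<le> int (l_dim c D')" using \<open>K + K \<le> l_dim c D'\<close> by simp
    moreover have "int (K + K) = 2 * int M + 2 * int M * int k + 2" by (simp add: K_def)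
    ultimately show ?thesis by simp
  qed
  then have "divisor_degree D' - int (l_dim c D') + 1 \<le> int m - 1" using degD' by linarith
  then show "divisor_degree D - int (l_dim c D) + 1 \<le> int m - 1"
    using degree_minus_l_dim_mono[OF D D' le] by linarith
qed

section \<open>Subfields and models\<close>

definition subfield_set :: "'a::field set \<Rightarrow> bool" where
  "subfield_set S \<longleftrightarrow> 1 \<in> S \<and> (\<forall>u\<in>S. \<forall>v\<in>S. u - v \<in> S \<and> u * v \<in> S) \<and> (\<forall>u\<in>S. inverse u \<in> S)"

lemma subfield_set_closed:
  assumes S: "subfield_set S"
  shows "1 \<in> S" "0 \<in> S" "u \<in> S \<Longrightarrow> v \<in> S \<Longrightarrow> u - v \<in> S" "u \<in> S \<Longrightarrow> v \<in> S \<Longrightarrow> u * v \<in> S"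
    "u \<in> S \<Longrightarrow> inverse u \<in> S" "u \<in> S \<Longrightarrow> - u \<in> S" "u \<in> S \<Longrightarrow> v \<in> S \<Longrightarrow> u + v \<in> S"
    "u \<in> S \<Longrightarrow> v \<in> S \<Longrightarrow> u / v \<in> S"
proof -
  show d: "u - v \<in> S" and m: "u * v \<in> S" if "u \<in> S" "v \<in> S" for u v
    using S that by (auto simp: subfield_set_def)
  show i: "inverse u \<in> S" if "u \<in> S" for u using S that by (auto simp: subfield_set_def)
  show "1 \<in> S" using S by (auto simp: subfield_set_def)
  then show 0: "0 \<in> S" using d[of 1 1] by simp
  show n: "- u \<in> S" if "u \<in> S" for u using d[OF 0 that] by simp
  show "u + v \<in> S" if "u \<in> S" "v \<in> S" using d[OF that(1) n[OF that(2)]] by simp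
  show "u / v \<in> S" if "u \<in> S" "v \<in> S" using m[OF that(1) i[OF that(2)]] by (simp add: divide_inverse)
qed

lemma subfield_set_prod: "subfield_set S \<Longrightarrow> (\<And>i. i \<in> A \<Longrightarrow> f i \<in> S) \<Longrightarrow> prod f A \<in> S"
  by (induction A rule: infinite_finite_induct) (auto intro: subfield_set_closed)

lemma generated_field_UNIV:
  "generated_field A = UNIV \<Longrightarrow> A \<subseteq> S \<Longrightarrow> subfield_set S \<Longrightarrow> S = UNIV"
  unfolding generated_field_def subfield_set_def by blast

lemma subfield_set_range: "field_embedding h \<Longrightarrow> subfield_set (range h)"
  unfolding subfield_set_def
  by (auto simp flip: field_embedding_diff field_embedding_mult field_embedding_inverse)
    (metis field_embedding_1 rangeI)

lemma subfield_set_vimage: "field_embedding h \<Longrightarrow> subfield_set S \<Longrightarrow> subfield_set (h -` S)"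
  by (auto simp: subfield_set_def field_embedding_1 field_embedding_diff field_embedding_mult
      field_embedding_inverse)

lemma subfield_set_quadratic:
  assumes S: "subfield_set S" and y: "y\<^sup>2 \<in> S"
  shows "subfield_set {a + b * y | a b. a \<in> S \<and> b \<in> S}"
proof -
  note cl = subfield_set_closed[OF S]
  define A where "A = {a + b * y | a b. a \<in> S \<and> b \<in> S}"
  have mem: "z \<in> A" if "z = a + b * y" "a \<in> S" "b \<in> S" for z a b
    using that unfolding A_def by blast
  have "1 \<in> A" by (rule mem[of _ 1 0]) (simp_all add: cl)
  moreover have "u - v \<in> A \<and> u * v \<in> A" if uv: "u \<in> A" "v \<in> A" for u v
  proof -
    obtain a b a' b' where *: "u = a + b * y" "v = a' + b' * y" "a \<in> S" "b \<in> S" "a' \<in> S" "b' \<in> S"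
      using uv unfolding A_def by blast
    have 1: "u - v = (a - a') + (b - b') * y" using *(1,2) by (simp add: algebra_simps)
    have 2: "u * v = (a * a' + b * b' * y\<^sup>2) + (a * b' + a' * b) * y"
      using *(1,2) by (simp add: algebra_simps power2_eq_square)
    show ?thesis
      by (rule conjI[OF mem[OF 1] mem[OF 2]]; intro cl *(3-6) y)
  qed
  moreover have "inverse u \<in> A" if u: "u \<in> A" for u
  proof -
    obtain a b where *: "u = a + b * y" "a \<in> S" "b \<in> S" using u unfolding A_def by blast
    show ?thesis
    proof (cases "a - b * y = 0")
      \<comment> \<open>y may already lie in S, so the conjugate can vanish for a nonzero u; in that
        case u = 2 a lies in S.\<close>
      case True
      then have "u = a + a" using *(1) by simp
      then have "inverse u = inverse (a + a) + 0 * y" by simp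
      moreover have "inverse (a + a) \<in> S" by (intro cl *(2))
      ultimately show ?thesis using cl(2) by (rule mem)
    next
      case False
      define d where "d = a\<^sup>2 - b\<^sup>2 * y\<^sup>2"
      have d: "u * (a - b * y) = d" using *(1) by (simp add: d_def algebra_simps power2_eq_square)
      have dS: "d \<in> S" unfolding d_def power2_eq_square[of a] power2_eq_square[of b] by (intro cl *(2,3) y)
      have "inverse u = a / d + (- b / d) * y"
      proof (cases "u = 0")
        case True
        then show ?thesis using d by auto
      next
        case u0: False
        then have "d \<noteq> 0" using d False by auto
        then have "inverse u = (a - b * y) / d" using d u0 by (simp add: field_simps)
        then show ?thesis by (simp add: diff_divide_distrib)
      qed
      moreover have "a / d \<in> S" "- b / d \<in> S" by (intro cl *(2,3) dS)+
      ultimately show ?thesis by (rule mem)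
    qed
  qed
  ultimately show ?thesis unfolding subfield_set_def A_def[symmetric] by blast
qed

text \<open>Projection from the branch point (e1, 0): u is the slope of the line through it, and the
  second intersection with the conic expresses x rationally in u.\<close>

lemma conic_parametrization:
  fixes c :: "'k::alg_closed_field \<Rightarrow> 'a::field"
  assumes c: "field_embedding c" and x: "transcendental c x"
    and y: "y\<^sup>2 = (x - c e1) * (x - c e2)" and ne: "e1 \<noteq> e2"
  obtains h where "field_embedding h" "h \<circ> line_const = c" "x \<in> range h" "y \<in> range h"
proof -
  have xc: "x - c e \<noteq> 0" for e using transcendental_nonconst[OF c x] by auto
  define u where "u = y / (x - c e1)"
  have y_eq: "y = u * (x - c e1)" using xc by (simp add: u_def)
  have "u * u * (x - c e1) * (x - c e1) = (x - c e2) * (x - c e1)"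
    using y unfolding y_eq by (simp add: power2_eq_square mult_ac)
  then have u2: "u\<^sup>2 * (x - c e1) = x - c e2" using xc by (simp add: power2_eq_square)
  \<comment> \<open>A constant \<open>u\<^sup>2\<close> would leave a linear equation for x, and it
    is nontrivial because e1 and e2 differ.\<close>
  have no: "u\<^sup>2 \<noteq> c d" for d
  proof
    assume "u\<^sup>2 = c d"
    then have "pev c [:e2 - d * e1, d - 1:] x = 0"
      using u2 by (simp add: pev_pCons[OF c] field_embedding_diff[OF c] field_embedding_mult[OF c]
          field_embedding_1[OF c] algebra_simps)
    then have "[:e2 - d * e1, d - 1:] = 0" using x by (simp only: transcendental_def)
    with ne show False by auto
  qed
  have "transcendental c u"
  proof (rule transcendental_if_nonconst[OF c])
    show "u \<notin> range c" using no by (metis field_embedding_power[OF c] rangeE)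
  qed
  then obtain h where h: "field_embedding h" "h \<circ> line_const = c" "h line_coord = u"
    using line_embedding_exists[OF c] by blast
  note cl = subfield_set_closed[OF subfield_set_range[OF h(1)]]
  have ch: "c e \<in> range h" for e using h(2) by (metis comp_apply rangeI)
  have uh: "u \<in> range h" using h(3) by (metis rangeI)
  have "u\<^sup>2 - 1 \<noteq> 0" using no[of 1] by (simp add: field_embedding_1[OF c])
  moreover have "x * (u\<^sup>2 - 1) = u * u * c e1 - c e2"
    using u2 by (simp add: algebra_simps power2_eq_square)
  ultimately have "x = (u * u * c e1 - c e2) / (u * u - 1)" by (simp add: field_simps power2_eq_square)
  moreover have "\<dots> \<in> range h" by (intro cl uh ch)
  ultimately have xh: "x \<in> range h" by simp
  moreover have "y \<in> range h" unfolding y_eq by (intro cl uh ch xh)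
  ultimately show thesis using that h by blast
qed

text \<open>What must be excluded is that P becomes trivial on k(t); its center on the line provides
  an element of the image with positive order. The least positive order attained there is the
  ramification index e, and an element attaining it is a uniformizer on the line.\<close>

lemma dominant_morphism_to_line:
  fixes c :: "'k::alg_closed_field \<Rightarrow> 'a::field"
  assumes c: "field_embedding c" and h: "field_embedding h" and hc: "h \<circ> line_const = c"
    and deg: "degree_le c (h line_coord) n"
  shows "dominant_morphism c line_const h"
  unfolding dominant_morphism_def
proof (intro conjI ballI h hc)
  fix P assume P: "P \<in> points c"
  interpret P: dvr P by unfold_locales (rule points_dvr[OF P])
  interpret P: val_ring_over P c by (rule points_val_ring_over[OF c P])
  have h0: "h f = 0 \<longleftrightarrow> f = 0" for f by (rule field_embedding_eq_0_iff[OF h])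
  have hinv: "h (inverse f) = inverse (h f)" for f by (rule field_embedding_inverse[OF h])
  have "transcendental c (h line_coord)"
    by (rule transcendental_hom[OF field_embedding_line_const h hc transcendental_line_coord])
  then obtain s where s: "s \<in> nonunits P" "s \<noteq> 0" "s = inverse (h line_coord) \<or> (\<exists>a. s = h line_coord - c a)"
    using P.center_on_line[OF _ deg] by metis
  have "\<exists>f. s = h f"
    using s(3)
  proof
    assume "s = inverse (h line_coord)"
    then have "s = h (inverse line_coord)" by (simp only: hinv)
    then show ?thesis ..
  next
    assume "\<exists>a. s = h line_coord - c a"
    then obtain a where "s = h line_coord - h (line_const a)" using hc by (metis comp_apply)
    then have "s = h (line_coord - line_const a)" by (simp only: field_embedding_diff[OF h])
    then show ?thesis ..
  qed
  then obtain f0 where f0: "s = h f0" ..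
  define Q where "Q = (\<lambda>m. m > 0 \<and> (\<exists>f. f \<noteq> 0 \<and> ord_at P (h f) = int m))"
  have "Q (nat (ord_at P s))" using s P.nonunits_iff[of s] f0 h0 by (auto simp: Q_def)
  define e where "e = (LEAST m. Q m)"
  have "Q e" unfolding e_def by (rule LeastI) fact
  then obtain t where t: "e > 0" "t \<noteq> 0" "ord_at P (h t) = int e" by (auto simp: Q_def)
  have least: "\<not> Q m" if "m < e" for m using that not_less_Least unfolding e_def by blast
  have mem: "f \<in> h -` P \<longleftrightarrow> 0 \<le> ord_at P (h f)" if "f \<noteq> 0" for f
    using P.mem_iff[of "h f"] h0 that by simp
  have "is_uniformizer (h -` P) t"
    unfolding is_uniformizer_def
  proof (intro conjI allI impI)
    show "t \<noteq> 0" "t \<in> h -` P" "inverse t \<notin> h -` P"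
      using t mem[of t] mem[of "inverse t"] h0 by (auto simp: hinv P.ord_inverse)
    fix f :: "'k poly fract" assume f: "f \<noteq> 0"
    \<comment> \<open>Division with remainder by e: the remainder is an order attained on k(t) and
      smaller than e, hence 0.\<close>
    define m where "m = ord_at P (h f) div int e"
    define g where "g = f * inverse (t powi m)"
    have ord_powi: "ord_at P (h (t powi m)) = m * int e" for m
    proof (cases "m \<ge> 0")
      case True
      then show ?thesis using t h0
        by (simp add: power_int_def field_embedding_power[OF h] P.ord_power)
    next
      case False
      then show ?thesis using t h0
        by (simp add: power_int_def field_embedding_power[OF h] P.ord_power hinv P.ord_inverse)
    qed
    have tm: "t powi m \<noteq> 0" using t by simp
    have g0: "g \<noteq> 0" using f tm by (simp add: g_def)
    have "ord_at P (h g) = ord_at P (h f) - m * int e"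
      using f tm h0 by (simp add: g_def field_embedding_mult[OF h] hinv P.ord_mult P.ord_inverse ord_powi)
    also have "\<dots> = ord_at P (h f) mod int e"
      by (simp add: m_def minus_div_mult_eq_mod)
    finally have og: "ord_at P (h g) = ord_at P (h f) mod int e" .
    then have "0 \<le> ord_at P (h g)" "ord_at P (h g) < int e" using t(1) by simp_all
    moreover have "\<not> Q (nat (ord_at P (h g)))"
      using least calculation by simp
    ultimately have "ord_at P (h g) = 0" using g0 by (auto simp: Q_def)
    then have "is_unit_of (h -` P) g"
      using g0 mem[of g] mem[of "inverse g"] h0 by (simp add: is_unit_of_def hinv P.ord_inverse)
    moreover have "f = g * t powi m" using tm by (simp add: g_def)
    ultimately show "\<exists>(m::int) u. is_unit_of (h -` P) u \<and> f = u * t powi m" by blast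
  qed
  then have "is_dvr (h -` P)"
    using P.one_mem P.diff_mem P.mult_mem unfolding is_dvr_def
    by (auto simp: field_embedding_1[OF h] field_embedding_diff[OF h] field_embedding_mult[OF h])
  moreover have "range line_const \<subseteq> h -` P" using P hc by (auto simp: points_def)
  ultimately show "h -` P \<in> points line_const" by (simp add: points_def)
qed

lemma eval_xy_pCons:
  assumes c: "field_embedding c"
  shows "eval_xy c (pCons q Q) x y = pev c q x + y * eval_xy c Q x y"
  by (simp add: eval_xy_def pev_def map_poly_pCons)

lemma eval_xy_0: "eval_xy c 0 x y = 0"
  by (simp add: eval_xy_def)

text \<open>The defining polynomial has degree 2 in y, so no nonzero polynomial of lower degree in y
  vanishes at (x, y). The equation y^2 = 1 is excluded because it splits into two such linear
  factors.\<close>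

lemma plane_curve_model_square_eq:
  fixes c :: "'k::field \<Rightarrow> 'a::field"
  assumes "plane_curve_model c (square_eq f) x y"
  shows "field_embedding c" "transcendental c x" "y\<^sup>2 = pev c f x"
    "generated_field (range c \<union> {x, y}) = UNIV" "f \<noteq> 1"
proof -
  show c: "field_embedding c" and "generated_field (range c \<union> {x, y}) = UNIV"
    using assms by (simp_all add: plane_curve_model_def)
  have dvd: "eval_xy c Q x y = 0 \<longleftrightarrow> square_eq f dvd Q" for Q
    using assms by (simp add: plane_curve_model_def)
  have deg: "Q = 0" if "square_eq f dvd Q" "degree Q < 2" for Q
  proof (rule ccontr)
    assume "Q \<noteq> 0"
    then have "degree (square_eq f) \<le> degree Q" using dvd_imp_degree_le that(1) by blast
    with that(2) show False by (simp add: square_eq_def)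
  qed
  have zero: "Q = 0" if "eval_xy c Q x y = 0" "degree Q < 2" for Q
    using deg dvd that by blast
  show "transcendental c x"
    unfolding transcendental_def
  proof (intro allI impI)
    fix q assume "pev c q x = 0"
    then have "eval_xy c [:q:] x y = 0" by (simp add: eval_xy_pCons[OF c] eval_xy_0)
    then have "[:q:] = 0" by (rule zero) simp
    then show "q = 0" by simp
  qed
  have "eval_xy c (square_eq f) x y = 0" by (simp add: dvd)
  then show y: "y\<^sup>2 = pev c f x"
    by (simp add: square_eq_def eval_xy_pCons[OF c] eval_xy_0 pev_uminus[OF c] pev_1[OF c]
        power2_eq_square)
  show "f \<noteq> 1"
  proof
    assume "f = 1"
    then have "(y - 1) * (y + 1) = 0" using y by (simp add: pev_1[OF c] algebra_simps power2_eq_square)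
    then have "eval_xy c [:- 1, 1:] x y = 0 \<or> eval_xy c [:1, 1:] x y = 0"
      by (auto simp: eval_xy_pCons[OF c] eval_xy_0 pev_uminus[OF c] pev_1[OF c] add.commute)
    then have "([:- 1, 1:] :: 'k poly poly) = 0 \<or> ([:1, 1:] :: 'k poly poly) = 0"
      using zero[of "[:- 1, 1:]"] zero[of "[:1, 1:]"] by (elim disjE) simp_all
    then show False by simp
  qed
qed

text \<open>Injectivity of h pulls the equation back to k(t), where the descent forces x to be
  constant. This is the form in which curves with at least four branch points fail to be
  rational.\<close>

lemma not_both_in_rational_subfield:
  fixes c :: "'k::alg_closed_field \<Rightarrow> 'a::field"
  assumes two: "(2::'k) \<noteq> 0" and h: "field_embedding h" "h \<circ> line_const = c"
    and T: "finite T" "card T \<ge> 4" "even (card T)"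
    and x: "x \<notin> range c" "x \<in> range h" and y: "y\<^sup>2 = (\<Prod>e\<in>T. x - c e)"
  shows "y \<notin> range h"
proof
  assume "y \<in> range h"
  then obtain w where w: "y = h w" by blast
  obtain s where s: "x = h s" using x by blast
  have hl: "h (line_const e) = c e" for e using h(2) by (metis comp_apply)
  have "h (w\<^sup>2) = h (\<Prod>e\<in>T. s - line_const e)"
    using y by (simp add: w s field_embedding_power[OF h(1)] field_embedding_prod[OF h(1)]
        field_embedding_diff[OF h(1)] hl)
  then have "w\<^sup>2 = (\<Prod>e\<in>T. s - line_const e)" using inj_field_embedding[OF h(1)] by (simp add: inj_eq)
  then have "s \<in> range line_const" using square_eq_prod_imp_const[OF two T] by blast
  then show False using x s hl by auto
qed

text \<open>Over a field E with [K : E] = 2 the elements 1, y1, y2 are dependent. A relation with a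
  vanishing coefficient settles the claim at once; otherwise squaring the expression for
  \<open>\<gamma> * y2\<close> isolates y1 with the coefficient
  \<open>2 * \<alpha> * \<beta>\<close>.\<close>

lemma quadratic_subextension:
  fixes y1 y2 :: "'a::field"
  assumes E: "subfield_set E" and two: "(2::'a) \<noteq> 0" and y: "y1\<^sup>2 \<in> E" "y2\<^sup>2 \<in> E"
    and rel: "\<alpha> \<in> E" "\<beta> \<in> E" "\<gamma> \<in> E" "\<alpha> + \<beta> * y1 + \<gamma> * y2 = 0" "\<alpha> \<noteq> 0 \<or> \<beta> \<noteq> 0 \<or> \<gamma> \<noteq> 0"
  shows "y1 \<in> E \<or> y2 \<in> E \<or> y1 * y2 \<in> E"
proof -
  note cl = subfield_set_closed[OF E]
  have two_E: "2 \<in> E" using cl(7)[OF cl(1) cl(1)] by simp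
  show ?thesis
  proof (cases "\<gamma> = 0 \<or> \<beta> = 0 \<or> \<alpha> = 0")
    case True
    then consider "\<gamma> = 0" "\<beta> \<noteq> 0" | "\<beta> = 0" "\<gamma> \<noteq> 0" | "\<alpha> = 0" "\<beta> \<noteq> 0" "\<gamma> \<noteq> 0"
      using rel(4,5) by (cases "\<beta> = 0"; cases "\<gamma> = 0"; cases "\<alpha> = 0") auto
    then show ?thesis
    proof cases
      case 1
      then have "\<beta> * y1 = - \<alpha>" using rel(4) by (simp add: eq_neg_iff_add_eq_0 add.commute)
      then have "y1 = - \<alpha> / \<beta>" using 1 by (metis nonzero_mult_div_cancel_left)
      moreover have "- \<alpha> / \<beta> \<in> E" by (intro cl rel)
      ultimately show ?thesis by simp
    next
      case 2
      then have "\<gamma> * y2 = - \<alpha>" using rel(4) by (simp add: eq_neg_iff_add_eq_0 add.commute)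
      then have "y2 = - \<alpha> / \<gamma>" using 2 by (metis nonzero_mult_div_cancel_left)
      moreover have "- \<alpha> / \<gamma> \<in> E" by (intro cl rel)
      ultimately show ?thesis by simp
    next
      case 3
      then have "\<gamma> * y2 = - \<beta> * y1" using rel(4) by (simp add: eq_neg_iff_add_eq_0 add.commute)
      then have "y2 = - \<beta> * y1 / \<gamma>" using 3 by (metis nonzero_mult_div_cancel_left)
      then have "y1 * y2 = - \<beta> / \<gamma> * y1\<^sup>2" by (simp add: power2_eq_square)
      moreover have "- \<beta> / \<gamma> * y1\<^sup>2 \<in> E" by (intro cl rel y)
      ultimately show ?thesis by simp
    qed
  next
    case False
    have "\<gamma> * y2 = - (\<alpha> + \<beta> * y1)"
      using rel(4) by (simp only: eq_neg_iff_add_eq_0 add.commute[of "\<gamma> * y2"])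
    then have "\<gamma>\<^sup>2 * y2\<^sup>2 = (\<alpha> + \<beta> * y1)\<^sup>2" by (metis power2_minus power_mult_distrib)
    then have "(2 * \<alpha> * \<beta>) * y1 = \<gamma>\<^sup>2 * y2\<^sup>2 - \<alpha>\<^sup>2 - \<beta>\<^sup>2 * y1\<^sup>2"
      by (simp add: power2_eq_square algebra_simps)
    then have "y1 = (\<gamma>\<^sup>2 * y2\<^sup>2 - \<alpha>\<^sup>2 - \<beta>\<^sup>2 * y1\<^sup>2) / (2 * \<alpha> * \<beta>)"
      using False two by (metis mult_eq_0_iff nonzero_mult_div_cancel_left)
    moreover have "(\<gamma>\<^sup>2 * y2\<^sup>2 - \<alpha>\<^sup>2 - \<beta>\<^sup>2 * y1\<^sup>2) / (2 * \<alpha> * \<beta>) \<in> E"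
      unfolding power2_eq_square[of \<alpha>] power2_eq_square[of \<beta>] power2_eq_square[of \<gamma>]
      by (intro cl rel y two_E)
    ultimately show ?thesis by metis
  qed
qed

section \<open>Generalized Howe curves\<close>

lemma pev_prod_linear:
  "field_embedding c \<Longrightarrow> pev c (\<Prod>e\<in>T. [:- e, 1:]) x = (\<Prod>e\<in>T. x - c e)"
  by (simp add: pev_prod pev_linear)

lemma span_subfield_two:
  fixes h :: "'b::field \<Rightarrow> 'a::field"
  assumes h: "field_embedding h"
    and U: "UNIV = {a + b * y | a b. a \<in> range h \<and> b \<in> range h}"
  shows "module.span (\<lambda>b f. h b * f) {1, y} = UNIV"
proof -
  interpret vector_space "\<lambda>b f. h b * f" by (rule vector_space_field_embedding[OF h])
  have "z \<in> span {1, y}" for z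
  proof -
    have "z \<in> {a + b * y | a b. a \<in> range h \<and> b \<in> range h}" using U by blast
    then obtain a b where "z = h a * 1 + h b * y" by auto
    also have "\<dots> \<in> span {1, y}" by (intro span_add span_scale span_base) simp_all
    finally show ?thesis .
  qed
  then show ?thesis by blast
qed

theorem theorem2:
  fixes p g1 g2 r :: nat
    and a b :: "nat \<Rightarrow> 'k::alg_closed_field"
    and c1 :: "'k \<Rightarrow> 'c1::field" and x1 y1 :: 'c1
    and c2 :: "'k \<Rightarrow> 'c2::field" and x2 y2 :: 'c2
    and c3 :: "'k \<Rightarrow> 'c3::field" and x3 y3 :: 'c3
    and c :: "'k \<Rightarrow> 'c::field"
    and psi1 :: "'k poly fract \<Rightarrow> 'c1" and psi2 :: "'k poly fract \<Rightarrow> 'c2"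
    and pi1 :: "'c1 \<Rightarrow> 'c" and pi2 :: "'c2 \<Rightarrow> 'c"
  assumes "CHAR('k) = p" and "p > 2"
    and "0 < g1" and "g1 \<le> g2" and "r \<le> 2 * g1 + 2"
    and "inj_on a {1..2 * g1 + 2}" and "inj_on b {r + 1..2 * g2 + 2}"
    and "\<forall>i\<in>{1..2 * g1 + 2}. \<forall>j\<in>{r + 1..2 * g2 + 2}. a i \<noteq> b j"
    and "plane_curve_model c1
           (square_eq ((\<Prod>i=1..r. [:- a i, 1:]) * (\<Prod>i=r+1..2*g1+2. [:- a i, 1:]))) x1 y1"
    and "plane_curve_model c2
           (square_eq ((\<Prod>i=1..r. [:- a i, 1:]) * (\<Prod>j=r+1..2*g2+2. [:- b j, 1:]))) x2 y2"
    and "dominant_morphism c1 line_const psi1" and "psi1 line_coord = x1"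
    and "dominant_morphism c2 line_const psi2" and "psi2 line_coord = x2"
    and "\<nexists>phi :: 'c2 \<Rightarrow> 'c1. curve_isomorphism c1 c2 phi \<and> phi \<circ> psi2 = psi1"
    and "fibre_product_model c c1 c2 psi1 psi2 pi1 pi2"
    and "plane_curve_model c3
           (square_eq ((\<Prod>i=r+1..2*g1+2. [:- a i, 1:]) * (\<Prod>j=r+1..2*g2+2. [:- b j, 1:]))) x3 y3"
    and "genus c \<ge> 4"
  shows "(hyperelliptic c \<longleftrightarrow> r = g1 + g2 + 1) \<and> (r = g1 + g2 + 1 \<longleftrightarrow> rational_curve c3)"
proof -
  have two: "(2::'k) \<noteq> 0"
  proof
    assume "(2::'k) = 0"
    then have "of_nat 2 = (0::'k)" by simp
    then have "CHAR('k) dvd 2" by (simp only: of_nat_eq_0_iff_char_dvd)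
    then have "p \<le> 2" using assms(1) dvd_imp_le[of p 2] by simp
    with assms(2) show False by simp
  qed

  \<comment> \<open>Branch points as sets\<close>
  define T0 where "T0 = a ` {1..r}"
  define Ta where "Ta = a ` {r + 1..2 * g1 + 2}"
  define Tb where "Tb = b ` {r + 1..2 * g2 + 2}"
  have sub: "{1..r} \<subseteq> {1..2 * g1 + 2}" "{r + 1..2 * g1 + 2} \<subseteq> {1..2 * g1 + 2}"
    using assms(5) by auto
  have inja: "inj_on a {1..r}" "inj_on a {r + 1..2 * g1 + 2}"
    using inj_on_subset[OF assms(6)] sub by blast+
  have fin: "finite T0" "finite Ta" "finite Tb" by (simp_all add: T0_def Ta_def Tb_def)
  have card: "card T0 = r" "card Ta = 2 * g1 + 2 - r" "card Tb = 2 * g2 + 2 - r"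
    using inja assms(7) by (simp_all add: T0_def Ta_def Tb_def card_image)
  have disj: "T0 \<inter> Ta = {}" "T0 \<inter> Tb = {}" "Ta \<inter> Tb = {}"
  proof -
    have "a ` ({1..r} \<inter> {r + 1..2 * g1 + 2}) = T0 \<inter> Ta"
      unfolding T0_def Ta_def by (rule inj_on_image_Int[OF assms(6) sub])
    then show "T0 \<inter> Ta = {}" by auto
    show "T0 \<inter> Tb = {}" "Ta \<inter> Tb = {}" using assms(5,8) by (auto simp: T0_def Ta_def Tb_def)
  qed
  have prods: "(\<Prod>i=1..r. [:- a i, 1:]) = (\<Prod>e\<in>T0. [:- e, 1:])"
    "(\<Prod>i=r+1..2*g1+2. [:- a i, 1:]) = (\<Prod>e\<in>Ta. [:- e, 1:])"
    "(\<Prod>j=r+1..2*g2+2. [:- b j, 1:]) = (\<Prod>e\<in>Tb. [:- e, 1:])"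
    unfolding T0_def Ta_def Tb_def
    by (simp_all only: prod.reindex[OF inja(1)] prod.reindex[OF inja(2)] prod.reindex[OF assms(7)] comp_def)
  define T1 where "T1 = T0 \<union> Ta"
  define T2 where "T2 = T0 \<union> Tb"
  define T3 where "T3 = Ta \<union> Tb"
  have finT: "finite T1" "finite T2" "finite T3" using fin by (simp_all add: T1_def T2_def T3_def)
  have r_le: "r \<le> 2 * g2 + 2" using assms(4,5) by simp
  have cardT: "card T1 = 2 * g1 + 2" "card T2 = 2 * g2 + 2" "card T3 + 2 * r = 2 * (g1 + g2 + 2)"
    using fin disj card assms(5) r_le by (simp_all add: T1_def T2_def T3_def card_Un_disjoint)
  then have "even (card T3 + 2 * r)" by simp
  then have even3: "even (card T3)" by simp
  note m1 = plane_curve_model_square_eq[OF assms(9)[unfolded prods prod.union_disjoint[OF fin(1,2) disj(1), symmetric], folded T1_def]]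
  note m2 = plane_curve_model_square_eq[OF assms(10)[unfolded prods prod.union_disjoint[OF fin(1,3) disj(2), symmetric], folded T2_def]]
  note m3 = plane_curve_model_square_eq[OF assms(17)[unfolded prods prod.union_disjoint[OF fin(2,3) disj(3), symmetric], folded T3_def]]
  \<comment> \<open>An empty T3 would give the reducible equation y3^2 = 1. With parity this leaves
    2 or at least 4 branch points for C3.\<close>
  have "T3 \<noteq> {}" using m3(5) by auto
  then have card3: "card T3 \<noteq> 0" using finT(3) by simp
  have r_iff: "r = g1 + g2 + 1 \<longleftrightarrow> card T3 = 2" using cardT(3) by presburger
  have ge4: "card T3 \<ge> 4" if "card T3 \<noteq> 2" using even3 card3 that by presburger

  \<comment> \<open>Stated for an arbitrary target field, because it is applied both to the function
    field of C3 and inside that of C.\<close>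
  have rational: "\<exists>h. field_embedding h \<and> h \<circ> line_const = d \<and> x \<in> range h \<and> y \<in> range h"
    if T3: "card T3 = 2" and d: "field_embedding d" and x: "transcendental d x"
      and y: "y\<^sup>2 = (\<Prod>e\<in>T3. x - d e)"
    for d :: "'k \<Rightarrow> 'd::field" and x y
  proof -
    obtain e1 e2 where e: "T3 = {e1, e2}" "e1 \<noteq> e2" using T3 by (meson card_2_iff)
    have "y\<^sup>2 = (x - d e1) * (x - d e2)" using y e by simp
    from conic_parametrization[OF d x this e(2)] show ?thesis by blast
  qed

  \<comment> \<open>Rationality of C3\<close>
  have rational_iff: "rational_curve c3 \<longleftrightarrow> r = g1 + g2 + 1"
  proof
    assume "rational_curve c3"
    then obtain h :: "'k poly fract \<Rightarrow> 'c3" where h: "field_embedding h" "bij h" "h \<circ> line_const = c3"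
      unfolding rational_curve_def by blast
    show "r = g1 + g2 + 1"
    proof (rule ccontr)
      assume "r \<noteq> g1 + g2 + 1"
      then have "card T3 \<ge> 4" using r_iff ge4 by blast
      from not_both_in_rational_subfield[OF two h(1,3) finT(3) this even3, of x3 y3]
      show False using h(2) transcendental_nonconst[OF m3(1,2)] m3(3)
        by (simp add: pev_prod_linear[OF m3(1)] bij_is_surj)
    qed
  next
    assume "r = g1 + g2 + 1"
    then have "card T3 = 2" using r_iff by blast
    then obtain h where h: "field_embedding h" "h \<circ> line_const = c3" "x3 \<in> range h" "y3 \<in> range h"
      using rational[OF _ m3(1,2)] m3(3) pev_prod_linear[OF m3(1)] by metis
    have "range c3 \<subseteq> range h" using h(2) by auto
    then have "range h = UNIV"
      using h(3,4) by (intro generated_field_UNIV[OF m3(4)] subfield_set_range h(1)) auto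
    then show "rational_curve c3"
      unfolding rational_curve_def using h inj_field_embedding[OF h(1)] by (auto simp: bij_def)
  qed

  \<comment> \<open>The function field of C\<close>
  from assms(16) have c: "field_embedding c" and pi1: "field_embedding pi1" "pi1 \<circ> c1 = c"
    and pi2: "field_embedding pi2" "pi2 \<circ> c2 = c" and comm: "pi1 \<circ> psi1 = pi2 \<circ> psi2"
    and gen: "generated_field (range pi1 \<union> range pi2) = UNIV"
    by (auto simp: fibre_product_model_def dominant_morphism_def)
  have psi1: "field_embedding psi1" "psi1 \<circ> line_const = c1"
    using assms(11) by (simp_all add: dominant_morphism_def)
  define X where "X = pi1 x1"
  define Y1 where "Y1 = pi1 y1"
  define Y2 where "Y2 = pi2 y2"
  have X2: "X = pi2 x2" using comm assms(12,14) by (simp add: X_def fun_eq_iff) (metis)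
  have X: "transcendental c X" unfolding X_def by (rule transcendental_hom[OF m1(1) pi1 m1(2)])
  have Xc: "X \<notin> range c" by (rule transcendental_nonconst[OF c X])
  have Y1: "Y1\<^sup>2 = (\<Prod>e\<in>T1. X - c e)"
    using arg_cong[OF m1(3), of pi1]
    by (simp add: Y1_def X_def field_embedding_power[OF pi1(1)] pev_hom[OF m1(1) pi1] pev_prod_linear[OF c])
  have Y2: "Y2\<^sup>2 = (\<Prod>e\<in>T2. X - c e)"
    using arg_cong[OF m2(3), of pi2]
    by (simp add: Y2_def X2 field_embedding_power[OF pi2(1)] pev_hom[OF m2(1) pi2] pev_prod_linear[OF c])
  have Xe: "X - c e \<noteq> 0" for e using Xc by auto
  \<comment> \<open>The common branch points occur twice in \<open>Y1\<^sup>2 * Y2\<^sup>2\<close>;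
    division by Q removes them and leaves the equation of C3.\<close>
  define Q where "Q = (\<Prod>e\<in>T0. X - c e)"
  have Q0: "Q \<noteq> 0" using fin Xe by (simp add: Q_def)
  define Y3 where "Y3 = Y1 * Y2 / Q"
  have Y3: "Y3\<^sup>2 = (\<Prod>e\<in>T3. X - c e)"
  proof -
    have "Y1\<^sup>2 * Y2\<^sup>2 = Q\<^sup>2 * (\<Prod>e\<in>T3. X - c e)"
      unfolding Y1 Y2 T1_def T2_def T3_def Q_def using fin disj
      by (simp add: prod.union_disjoint power2_eq_square mult_ac)
    then show ?thesis using Q0 by (simp add: Y3_def power_divide power_mult_distrib)
  qed
  have Y10: "Y1 \<noteq> 0" using Y1 finT(1) Xe by (metis prod_zero_iff zero_power2)
  have whole: "S = UNIV" if S: "subfield_set S" "range c \<subseteq> S" "X \<in> S" "Y1 \<in> S" "Y2 \<in> S" for S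
  proof (rule generated_field_UNIV[OF gen _ S(1)])
    have "pi1 -` S = UNIV"
    proof (rule generated_field_UNIV[OF m1(4)])
      show "range c1 \<union> {x1, y1} \<subseteq> pi1 -` S" using S pi1(2) by (auto simp: X_def Y1_def)
    qed (rule subfield_set_vimage[OF pi1(1) S(1)])
    moreover have "pi2 -` S = UNIV"
    proof (rule generated_field_UNIV[OF m2(4)])
      show "range c2 \<union> {x2, y2} \<subseteq> pi2 -` S" using S pi2(2) by (auto simp: X2 Y2_def)
    qed (rule subfield_set_vimage[OF pi2(1) S(1)])
    ultimately show "range pi1 \<union> range pi2 \<subseteq> S" by auto
  qed
  have Q_mem: "Q \<in> E" if "subfield_set E" "range c \<subseteq> E" "X \<in> E" for E
    unfolding Q_def using that by (auto intro!: subfield_set_prod subfield_set_closed(3))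
  have sq_mem: "Y1\<^sup>2 \<in> E" "Y2\<^sup>2 \<in> E" if "subfield_set E" "range c \<subseteq> E" "X \<in> E" for E
    unfolding Y1 Y2 using that by (auto intro!: subfield_set_prod subfield_set_closed(3))
  \<comment> \<open>Here g1 > 0 gives at least four branch points, so no rational subfield
    containing X contains Y1; the same holds for Y2.\<close>
  have not1: "Y1 \<notin> range h" if "field_embedding h" "h \<circ> line_const = c" "X \<in> range h" for h
    by (rule not_both_in_rational_subfield[OF two that(1,2) finT(1) _ _ Xc that(3) Y1])
      (use cardT assms(3) in auto)
  have not2: "Y2 \<notin> range h" if "field_embedding h" "h \<circ> line_const = c" "X \<in> range h" for h
    by (rule not_both_in_rational_subfield[OF two that(1,2) finT(2) _ _ Xc that(3) Y2])
      (use cardT assms(3,4) in auto)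

  \<comment> \<open>From r = g1 + g2 + 1 to a double cover of the line\<close>
  have "hyperelliptic c" if r: "r = g1 + g2 + 1"
  proof -
    have "card T3 = 2" using r r_iff by blast
    then obtain h where h: "field_embedding h" "h \<circ> line_const = c" "X \<in> range h" "Y3 \<in> range h"
      using rational[OF _ c X Y3] by blast
    note E = subfield_set_range[OF h(1)]
    have cE: "range c \<subseteq> range h" using h(2) by auto
    have Y1n: "Y1 \<notin> range h" by (rule not1[OF h(1-3)])
    interpret vector_space "\<lambda>b f. h b * f" by (rule vector_space_field_embedding[OF h(1)])
    define A where "A = {a + b * Y1 | a b. a \<in> range h \<and> b \<in> range h}"
    have A: "subfield_set A"
      unfolding A_def by (rule subfield_set_quadratic[OF E sq_mem(1)[OF E cE h(3)]])
    have sub: "range h \<subseteq> A"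
    proof
      fix z assume "z \<in> range h"
      then show "z \<in> A" unfolding A_def using subfield_set_closed(2)[OF E]
        by (intro CollectI exI[of _ z] exI[of _ 0]) simp
    qed
    have Y1A: "Y1 \<in> A" unfolding A_def using subfield_set_closed(1,2)[OF E]
      by (intro CollectI exI[of _ 0] exI[of _ 1]) simp
    \<comment> \<open>Adjoining Y1 to the rational field k(X, Y3) recovers Y2, so K has the basis 1,
      Y1 over it.\<close>
    have "Y2 = Y3 * Q / Y1" using Y10 Q0 by (simp add: Y3_def)
    moreover have "Y3 * Q / Y1 \<in> A"
      using Q_mem[OF E cE h(3)] h(4) sub Y1A by (intro subfield_set_closed[OF A]) auto
    ultimately have "A = UNIV" using whole[OF A] cE h(3) sub Y1A by blast
    then have sp: "span {1, Y1} = UNIV"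
      by (intro span_subfield_two[OF h(1)]) (simp add: A_def)
    have one: "1 \<in> range h" by (rule subfield_set_closed(1)[OF E])
    have "Y1 \<notin> span {1}"
    proof
      assume "Y1 \<in> span {1}"
      then obtain k where "Y1 = h k * 1" by (auto simp: span_singleton)
      then show False using Y1n by simp
    qed
    then have ind: "independent {1, Y1}"
      by (subst insert_commute) (rule independent_insertI, simp_all)
    have card: "card {1, Y1} = 2" using one Y1n by (metis card_2_iff)
    have deg: "degree_le c (h line_coord) 2"
      by (rule degree_le_of_span[OF c h(1,2) _ _ sp]) (simp_all add: card)
    have "morphism_degree h = 2"
      unfolding morphism_degree_def by (rule dim_unique[OF _ _ ind card]) (use sp in auto)
    then show ?thesis
      unfolding hyperelliptic_def using assms(18) dominant_morphism_to_line[OF c h(1,2) deg] by auto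
  qed

  \<comment> \<open>From a double cover of the line to r = g1 + g2 + 1\<close>
  moreover have "r = g1 + g2 + 1" if hyp: "hyperelliptic c"
  proof -
    obtain h :: "'k poly fract \<Rightarrow> 'c" where h: "field_embedding h" "h \<circ> line_const = c"
        and deg: "morphism_degree h = 2"
      using hyp unfolding hyperelliptic_def dominant_morphism_def by blast
    note E = subfield_set_range[OF h(1)]
    have cE: "range c \<subseteq> range h" using h(2) by auto
    interpret vector_space "\<lambda>b f. h b * f" by (rule vector_space_field_embedding[OF h(1)])
    obtain B where B: "UNIV \<subseteq> span B" "card B = 2"
      using basis_exists[of UNIV] deg unfolding morphism_degree_def by metis
    have finB: "finite B" using B(2) by (metis card.infinite zero_neq_numeral)
    define u where "u = h line_coord"
    have u: "transcendental c u" unfolding u_def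
      by (rule transcendental_hom[OF field_embedding_line_const h transcendental_line_coord])
    have udeg: "degree_le c u 2" unfolding u_def
      by (rule degree_le_of_span[OF c h finB]) (use B in auto)
    have X_mem: "X \<in> range h"
    proof (rule ccontr)
      assume nX: "X \<notin> range h"
      \<comment> \<open>K is spanned over k(X) by 1, Y1, Y2, Y1 Y2; the value m = 4 in the genus
        bound then gives genus at most 3.\<close>
      have "degree_le c X 4"
      proof -
        define \<Phi> where "\<Phi> = pi1 \<circ> psi1"
        have \<Phi>: "field_embedding \<Phi>" "\<Phi> \<circ> line_const = c" "\<Phi> line_coord = X"
          using field_embedding_comp[OF pi1(1) psi1(1)] psi1(2) pi1(2) assms(12)
          by (auto simp: \<Phi>_def X_def fun_eq_iff)
        note F = subfield_set_range[OF \<Phi>(1)]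
        have cF: "range c \<subseteq> range \<Phi>" using \<Phi>(2) by auto
        have XF: "X \<in> range \<Phi>" using \<Phi>(3) by (metis rangeI)
        define A1 where "A1 = {a + b * Y1 | a b. a \<in> range \<Phi> \<and> b \<in> range \<Phi>}"
        define A2 where "A2 = {a + b * Y2 | a b. a \<in> A1 \<and> b \<in> A1}"
        have A1: "subfield_set A1"
          unfolding A1_def by (rule subfield_set_quadratic[OF F sq_mem(1)[OF F cF XF]])
        have sub1: "range \<Phi> \<subseteq> A1"
        proof
          fix z assume "z \<in> range \<Phi>"
          then show "z \<in> A1" unfolding A1_def using subfield_set_closed(2)[OF F]
            by (intro CollectI exI[of _ z] exI[of _ 0]) simp
        qed
        have Y1A: "Y1 \<in> A1" unfolding A1_def using subfield_set_closed(1,2)[OF F]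
          by (intro CollectI exI[of _ 0] exI[of _ 1]) simp
        have A2: "subfield_set A2" unfolding A2_def
          by (rule subfield_set_quadratic[OF A1 sq_mem(2)[OF A1]]) (use cF XF sub1 in auto)
        have sub2: "A1 \<subseteq> A2"
        proof
          fix z assume "z \<in> A1"
          then show "z \<in> A2" unfolding A2_def using subfield_set_closed(2)[OF A1]
            by (intro CollectI exI[of _ z] exI[of _ 0]) simp
        qed
        have Y2A: "Y2 \<in> A2" unfolding A2_def using subfield_set_closed(1,2)[OF A1]
          by (intro CollectI exI[of _ 0] exI[of _ 1]) simp
        have U: "A2 = UNIV" by (rule whole[OF A2]) (use cF XF sub1 sub2 Y1A Y2A in auto)
        interpret \<Phi>: vector_space "\<lambda>b f. \<Phi> b * f" by (rule vector_space_field_embedding[OF \<Phi>(1)])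
        define B4 where "B4 = {1, Y1, Y2, Y1 * Y2}"
        have "z \<in> \<Phi>.span B4" for z
        proof -
          obtain v w where vw: "z = v + w * Y2" "v \<in> A1" "w \<in> A1" using U unfolding A2_def by blast
          obtain a b where v: "v = \<Phi> a + \<Phi> b * Y1" using vw(2) unfolding A1_def by blast
          obtain a' b' where w: "w = \<Phi> a' + \<Phi> b' * Y1" using vw(3) unfolding A1_def by blast
          have "z = (\<Phi> a * 1 + \<Phi> b * Y1) + (\<Phi> a' * Y2 + \<Phi> b' * (Y1 * Y2))"
            by (simp add: vw(1) v w algebra_simps)
          also have "\<dots> \<in> \<Phi>.span B4"
            by (intro \<Phi>.span_add \<Phi>.span_scale \<Phi>.span_base) (simp_all add: B4_def)
          finally show ?thesis .
        qed
        then have "\<Phi>.span B4 = UNIV" by blast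
        moreover have "card B4 \<le> 4" unfolding B4_def
          by (simp add: card_insert_if)
        ultimately show ?thesis
          using degree_le_of_span[OF c \<Phi>(1,2), of B4 4] \<Phi>(3) by (simp add: B4_def)
      qed
      moreover have "A = 0 \<and> B = 0" if AB: "pev c A u + pev c B u * X = 0" for A B
      proof -
        have "B = 0"
        proof (rule ccontr)
          assume B: "B \<noteq> 0"
          then have "pev c B u \<noteq> 0" using u by (auto simp: transcendental_def)
          then have "X = - pev c A u / pev c B u" using AB
            by (metis eq_neg_iff_add_eq_0 add.commute nonzero_mult_div_cancel_left)
          also have "\<dots> = h (Fract (- A) B)"
            by (simp add: line_embedding_Fract[OF c h] u_def pev_uminus[OF c])
          finally show False using nX by blast
        qed
        then show ?thesis using AB u by (simp add: transcendental_def)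
      qed
      ultimately have "genus c \<le> int 4 - 1" by (intro genus_le_double_cover[OF c u udeg X])
      then show False using assms(18) by simp
    qed
    \<comment> \<open>The three elements 1, Y1, Y2 are dependent over k(u), since K has dimension 2
      there; as Y1 and Y2 lie outside k(u), their product lies in it.\<close>
    have "Y1 * Y2 \<in> range h"
    proof -
      define z :: "nat \<Rightarrow> 'c" where "z = (\<lambda>i. if i = 0 then 1 else if i = 1 then Y1 else Y2)"
      obtain \<beta> i where \<beta>: "i \<le> 2" "\<beta> i \<noteq> 0" "(\<Sum>i\<le>2. h (\<beta> i) * z i) = 0"
      proof (rule family_dependent[of B 2 z])
        show "z i \<in> span B" for i using B(1) by blast
      qed (use finB B(2) in auto)
      have "h (\<beta> 0) + h (\<beta> 1) * Y1 + h (\<beta> 2) * Y2 = 0"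
        using \<beta>(3) by (simp add: z_def numeral_2_eq_2)
      moreover have "h (\<beta> 0) \<noteq> 0 \<or> h (\<beta> 1) \<noteq> 0 \<or> h (\<beta> 2) \<noteq> 0"
      proof -
        have "i = 0 \<or> i = 1 \<or> i = 2" using \<beta>(1) by auto
        then show ?thesis using \<beta>(2) by (auto simp: field_embedding_eq_0_iff[OF h(1)])
      qed
      moreover have "(2::'c) \<noteq> 0"
        using two field_embedding_add[OF c, of 1 1] field_embedding_eq_0_iff[OF c, of 2]
        by (simp add: field_embedding_1[OF c])
      ultimately show ?thesis
        using quadratic_subextension[OF E _ sq_mem[OF E cE X_mem]] not1[OF h X_mem] not2[OF h X_mem]
        by blast
    qed
    then have "Y3 \<in> range h" unfolding Y3_def
      using Q_mem[OF E cE X_mem] by (intro subfield_set_closed(8)[OF E])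
    \<comment> \<open>X and Y3 now lie in one rational field, which four or more branch points of C3
      would forbid.\<close>
    then have "\<not> card T3 \<ge> 4"
      using not_both_in_rational_subfield[OF two h finT(3) _ even3 Xc X_mem Y3] by blast
    then show ?thesis using ge4 r_iff by blast
  qed
  ultimately show ?thesis using rational_iff by blast
qed

end
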